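(* (i) Problem $\mathrm{VI}_{h,\sigma}$ admits a unique solution $u_h\in V_{\tau h,\sigma}$. Furthermore, it satisfies $$a(u_h,u_h)+j_h(u_{hn})=(f,u_h)_{L^2(\Omega)^2}.$$ (ii) Problems $\mathrm{VI}_h$ and $\mathrm{VE}_h$ are equivalent in the following sense. (a) If $(u_h,p_h)\in V_{\tau h}\times Q_h$ is a solution of Problem $\mathrm{VI}_h$, then there exists a unique $\lambda_h\in\tilde\Lambda_h$ such that $(u_h,p_h,\lambda_h)$ solves Problem $\mathrm{VE}_h$. (b) If $(u_h,p_h,\lambda_h)\in V_{\tau h}\times Q_h\times\tilde\Lambda_h$ is a solution of Problem $\mathrm{VE}_h$, then $(u_h,p_h)$ solves Problem $\mathrm{VI}_h$.
   Context: Geometry. $\Omega\subset\mathbf R^2$ is a bounded polygonal domain with boundary $\Gamma=\partial\Omega=\overline\Gamma_0\cup\overline\Gamma_1$, where $\Gamma_0,\Gamma_1$ are disjoint nonempty relatively open subsets of $\Gamma$ and $\overline\Gamma_1$ is exactly one whole side of the polygon, with endpoints $M_1,M_{m+1}$. On $\Gamma_1$, $n=(n_1,n_2)$ is the (constant) outer unit normal and $\tau=(n_2,-n_1)$; for a vector field $v$, $v_n=v\cdot n$, $v_\tau=v\cdot\tau$ on $\Gamma_1$ (and $v_{hn}$, $v_{h\tau}$ for $v_h$). Data. $\nu>0$, $f\in L^2(\Omega)^2$, $g\in C^0(\overline\Gamma_1)$ with $g>0$ on $\Gamma_1$. Mesh. $\{\mathscr T_h\}_h$ is a family of triangulations of $\overline\Omega$,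 $h$ being the length of the greatest side, such that: two distinct triangles meet in a side, a node or $\emptyset$; the triangles cover $\overline\Omega$ and the boundary vertices belong to $\Gamma$; for some constants $K,K'>0$ independent of $h$ each triangle contains a circle of radius $Kh$ and is contained in a circle of radius $K'h$; each triangle has at least one vertex not on $\Gamma$. $\Sigma_h$ is the set of all vertices and all midpoints of sides of triangles. $\Gamma_{0,h}=\overline\Gamma_0\cap\Sigma_h$, $\overline\Gamma_1\cap\Sigma_h=\{M_1,M_{3/2},M_2,\dots,M_{m+1/2},M_{m+1}\}$, where $M_1,\dots,M_{m+1}$ are the vertices on $\overline\Gamma_1$ in order along $\overline\Gamma_1$ ($m$ depends on $h$) and $M_{i+1/2}$ is the midpoint of $e_i=[M_i,M_{i+1}]$, of length $|e_i|$; $\mathring\Gamma_{1,h}=\Gamma_1\cap\Sigma_h$. Spaces ($\mathscr P_k$ = polynomials of degree $\le k$). $V_h=\{v_h\in C^0(\overline\Omega)^2: v_h|_T\in\mathscr P_2(T)^2\ \forall T\in\mathscr T_h\}$, $Q_h=\{q_h\in C^0(\overline\Omega): q_h|_T\in\mathscr P_1(T)\ \forall T\in\mathscr T_h\}$, $V_{\tau h}=\{v_h\in V_h: v_h(M)=0\ \forall M\in\Gamma_{0,h},\ v_{h\tau}(M)=0\ \forall M\in\mathring\Gamma_{1,h}\}$, $V_{\tau h,\sigma}=\{v_h\in V_{\tau h}: b(v_h,q_h)=0\ \forall q_h\in Q_h\}$. $\Lambda_h=\{\mu_h\in C^0(\overline\Gamma_1):\mu_h|_{e_i}\in\mathscr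 P_2(e_i)\ (1\le i\le m),\ \mu_h(M_1)=\mu_h(M_{m+1})=0\}$, $\tilde\Lambda_h=\{\mu_h\in\Lambda_h:|\mu_h(M)|\le1\ \forall M\in\mathring\Gamma_{1,h}\}$. Forms. $a(u,v)=2\nu\sum_{i,j=1}^2\int_\Omega e_{ij}(u)e_{ij}(v)\,dx$ with $e_{ij}(u)=\frac12(\partial u_i/\partial x_j+\partial u_j/\partial x_i)$; $b(v,q)=-\int_\Omega(\mathrm{div}\,v)q\,dx$. With $g_i=g(M_i)$, $\lambda_{h,i}=\lambda_h(M_i)$, etc. (also for half-integer indices), $$(\lambda_h,\mu_h)_{\Lambda_h}=\frac16\sum_{i=1}^m|e_i|\big(g_i\lambda_{h,i}\mu_{h,i}+4g_{i+\frac12}\lambda_{h,i+\frac12}\mu_{h,i+\frac12}+g_{i+1}\lambda_{h,i+1}\mu_{h,i+1}\big),$$ $$j_h(\eta_h)=\frac16\sum_{i=1}^m|e_i|\big(g_i|\eta_{h,i}|+4g_{i+\frac12}|\eta_{h,i+\frac12}|+g_{i+1}|\eta_{h,i+1}|\big)\quad(\lambda_h,\mu_h,\eta_h\in\Lambda_h).$$ Problem $\mathrm{VI}_h$: find $(u_h,p_h)\in V_{\tau h}\times Q_h$ with $a(u_h,v_h-u_h)+b(v_h-u_h,p_h)+j_h(v_{hn})-j_h(u_{hn})\ge(f,v_h-u_h)_{L^2(\Omega)^2}$ for all $v_h\in V_{\tau h}$ and $b(u_h,q_h)=0$ for all $q_h\in Q_h$. Problem $\mathrm{VI}_{h,\sigma}$: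 find $u_h\in V_{\tau h,\sigma}$ with $a(u_h,v_h-u_h)+j_h(v_{hn})-j_h(u_{hn})\ge(f,v_h-u_h)_{L^2(\Omega)^2}$ for all $v_h\in V_{\tau h,\sigma}$. Problem $\mathrm{VE}_h$: find $(u_h,p_h,\lambda_h)\in V_{\tau h}\times Q_h\times\tilde\Lambda_h$ with $a(u_h,v_h)+b(v_h,p_h)+(v_{hn},\lambda_h)_{\Lambda_h}=(f,v_h)_{L^2(\Omega)^2}$ for all $v_h\in V_{\tau h}$, $b(u_h,q_h)=0$ for all $q_h\in Q_h$, and $(u_{hn},\mu_h-\lambda_h)_{\Lambda_h}\le0$ for all $\mu_h\in\tilde\Lambda_h$. *)

theory Defs
  imports "HOL-Analysis.Analysis"
begin

subsection \<open>Polygonal domains\<close>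

type_synonym point = "real^2"

definition polygon_side :: "point list \<Rightarrow> nat \<Rightarrow> point set" where
  "polygon_side vs i = closed_segment (vs ! i) (vs ! (Suc i mod length vs))"

definition polygon_path :: "point list \<Rightarrow> point set" where
  "polygon_path vs = (\<Union>i<length vs. polygon_side vs i)"

text \<open>A simple closed polygon, given by the cyclic list of its vertices.  The last condition
  excludes straight angles, so that each \<^term>\<open>polygon_side vs i\<close> is a whole side.\<close>

definition simple_polygon :: "point list \<Rightarrow> bool" where
  "simple_polygon vs \<longleftrightarrow>
     3 \<le> length vs \<and> distinct vs \<and>
     (\<forall>i<length vs. \<forall>j<length vs. i \<noteq> j \<longrightarrow>
        polygon_side vs i \<inter> polygon_side vs j =
          {vs ! i, vs ! (Suc i mod length vs)} \<inter> {vs ! j, vs ! (Suc j mod length vs)}) \<and>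
     (\<forall>i<length vs.
        \<not> collinear {vs ! i, vs ! (Suc i mod length vs), vs ! (Suc (Suc i) mod length vs)})"

text \<open>The boundary may have several components (holes are allowed); \<open>P\<close> contains one vertex list
  for each of them.\<close>

definition polygonal_domain :: "point list set \<Rightarrow> point set \<Rightarrow> bool" where
  "polygonal_domain P \<Omega> \<longleftrightarrow>
     open \<Omega> \<and> connected \<Omega> \<and> bounded \<Omega> \<and> \<Omega> \<noteq> {} \<and>
     finite P \<and> (\<forall>vs\<in>P. simple_polygon vs) \<and>
     (\<forall>vs\<in>P. \<forall>ws\<in>P. vs \<noteq> ws \<longrightarrow> polygon_path vs \<inter> polygon_path ws = {}) \<and>
     frontier \<Omega> = (\<Union>vs\<in>P. polygon_path vs)"

text \<open>\<open>\<Gamma>\<^sub>1\<close> is the open side with endpoints \<open>A\<close>, \<open>B\<close>.  Asking only that its closure be this side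
  would also admit, say, the side with a point removed.\<close>

definition boundary_partition ::
    "point list set \<Rightarrow> point set \<Rightarrow> point set \<Rightarrow> point set \<Rightarrow> point \<Rightarrow> point \<Rightarrow> bool" where
  "boundary_partition P \<Omega> \<Gamma>0 \<Gamma>1 A B \<longleftrightarrow>
     openin (top_of_set (frontier \<Omega>)) \<Gamma>0 \<and> openin (top_of_set (frontier \<Omega>)) \<Gamma>1 \<and>
     \<Gamma>0 \<noteq> {} \<and> \<Gamma>1 \<noteq> {} \<and> \<Gamma>0 \<inter> \<Gamma>1 = {} \<and>
     frontier \<Omega> = closure \<Gamma>0 \<union> closure \<Gamma>1 \<and>
     (\<exists>vs\<in>P. \<exists>i<length vs. {A, B} = {vs ! i, vs ! (Suc i mod length vs)}) \<and>
     \<Gamma>1 = open_segment A B"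

definition outer_unit_normal :: "point set \<Rightarrow> point \<Rightarrow> point \<Rightarrow> point \<Rightarrow> bool" where
  "outer_unit_normal \<Omega> A B n \<longleftrightarrow>
     norm n = 1 \<and> n \<bullet> (B - A) = 0 \<and>
     (\<forall>x\<in>open_segment A B. \<exists>\<epsilon>>0. \<forall>t. 0 < t \<and> t < \<epsilon> \<longrightarrow>
        x + t *\<^sub>R n \<notin> closure \<Omega> \<and> x - t *\<^sub>R n \<in> \<Omega>)"

definition tangent :: "point \<Rightarrow> point" where
  "tangent n = vector [n $ 2, - n $ 1]"

subsection \<open>Triangulations\<close>

definition mesh_vertices :: "point set set \<Rightarrow> point set" where
  "mesh_vertices \<T> = {M. \<exists>T\<in>\<T>. M extreme_point_of T}"

definition mesh_nodes :: "point set set \<Rightarrow> point set" where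
  "mesh_nodes \<T> = mesh_vertices \<T> \<union>
     {midpoint C D |C D. \<exists>T\<in>\<T>. closed_segment C D edge_of T}"

text \<open>\<^const>\<open>triangulation\<close> (finite; two members meet in a common face) restricted to \<open>2\<close>-simplices says
  that distinct triangles meet in a common side, a common vertex, or not at all.\<close>

definition admissible_mesh :: "point set \<Rightarrow> real \<Rightarrow> point set set \<Rightarrow> bool" where
  "admissible_mesh \<Omega> h \<T> \<longleftrightarrow>
     triangulation \<T> \<and> (\<forall>T\<in>\<T>. 2 simplex T) \<and>
     \<Union>\<T> = closure \<Omega> \<and>
     mesh_vertices \<T> \<inter> frontier (\<Union>\<T>) \<subseteq> frontier \<Omega> \<and>
     (\<forall>T\<in>\<T>. \<exists>M. M extreme_point_of T \<and> M \<notin> frontier \<Omega>) \<and>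
     h = Max {dist C D |C D. \<exists>T\<in>\<T>. closed_segment C D edge_of T}"

definition regular_mesh_family ::
    "point set \<Rightarrow> real set \<Rightarrow> (real \<Rightarrow> point set set) \<Rightarrow> bool" where
  "regular_mesh_family \<Omega> H \<T> \<longleftrightarrow>
     (\<forall>h\<in>H. admissible_mesh \<Omega> h (\<T> h)) \<and>
     (\<exists>K>0. \<exists>K'>0. \<forall>h\<in>H. \<forall>T\<in>\<T> h.
        (\<exists>c. cball c (K * h) \<subseteq> T) \<and> (\<exists>c. T \<subseteq> cball c (K' * h)))"

text \<open>\<open>M 1 = A, \<dots>, M (m + 1) = B\<close> are the mesh vertices on the side from \<open>A\<close> to \<open>B\<close>, in order.\<close>

definition side_vertices ::
    "point set set \<Rightarrow> point \<Rightarrow> point \<Rightarrow> nat \<Rightarrow> (nat \<Rightarrow> point) \<Rightarrow> bool" where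
  "side_vertices \<T> A B m M \<longleftrightarrow>
     M 1 = A \<and> M (m + 1) = B \<and>
     M ` {1..m + 1} = mesh_vertices \<T> \<inter> closed_segment A B \<and>
     (\<forall>i j. 1 \<le> i \<and> i < j \<and> j \<le> m + 1 \<longrightarrow> dist A (M i) < dist A (M j))"

subsection \<open>Finite element spaces\<close>

definition polynomial_on :: "nat \<Rightarrow> point set \<Rightarrow> (point \<Rightarrow> real) \<Rightarrow> bool" where
  "polynomial_on k S p \<longleftrightarrow>
     (\<exists>c::nat \<Rightarrow> nat \<Rightarrow> real. \<forall>x\<in>S. p x = (\<Sum>i\<le>k. \<Sum>j\<le>k - i. c i j * (x $ 1) ^ i * (x $ 2) ^ j))"

text \<open>A function on \<open>S\<close> (here \<open>closure \<Omega>\<close> or \<open>closure \<Gamma>1\<close>) is represented by its extension by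
  zero, so that equality of representatives is equality on \<open>S\<close>.\<close>

definition C0 :: "point set \<Rightarrow> (point \<Rightarrow> 'b::real_normed_vector) set" where
  "C0 S = {v. continuous_on S v \<and> (\<forall>x. x \<notin> S \<longrightarrow> v x = 0)}"

definition V_h :: "point set \<Rightarrow> point set set \<Rightarrow> (point \<Rightarrow> point) set" where
  "V_h \<Omega> \<T> = {v \<in> C0 (closure \<Omega>). \<forall>T\<in>\<T>. \<forall>i. polynomial_on 2 T (\<lambda>x. v x $ i)}"

definition Q_h :: "point set \<Rightarrow> point set set \<Rightarrow> (point \<Rightarrow> real) set" where
  "Q_h \<Omega> \<T> = {q \<in> C0 (closure \<Omega>). \<forall>T\<in>\<T>. polynomial_on 1 T q}"

definition V_tau_h ::
    "point set \<Rightarrow> point set \<Rightarrow> point set \<Rightarrow> point \<Rightarrow> point set set \<Rightarrow> (point \<Rightarrow> point) set" where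
  "V_tau_h \<Omega> \<Gamma>0 \<Gamma>1 n \<T> =
     {v \<in> V_h \<Omega> \<T>. (\<forall>x \<in> closure \<Gamma>0 \<inter> mesh_nodes \<T>. v x = 0) \<and>
                    (\<forall>x \<in> \<Gamma>1 \<inter> mesh_nodes \<T>. v x \<bullet> tangent n = 0)}"

definition Lambda_h :: "point set \<Rightarrow> nat \<Rightarrow> (nat \<Rightarrow> point) \<Rightarrow> (point \<Rightarrow> real) set" where
  "Lambda_h \<Gamma>1 m M =
     {\<mu> \<in> C0 (closure \<Gamma>1).
        (\<forall>i\<in>{1..m}. polynomial_on 2 (closed_segment (M i) (M (i + 1))) \<mu>) \<and>
        \<mu> (M 1) = 0 \<and> \<mu> (M (m + 1)) = 0}"

definition Lambda_tilde_h ::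
    "point set \<Rightarrow> point set set \<Rightarrow> nat \<Rightarrow> (nat \<Rightarrow> point) \<Rightarrow> (point \<Rightarrow> real) set" where
  "Lambda_tilde_h \<Gamma>1 \<T> m M =
     {\<mu> \<in> Lambda_h \<Gamma>1 m M. \<forall>x \<in> \<Gamma>1 \<inter> mesh_nodes \<T>. \<bar>\<mu> x\<bar> \<le> 1}"

definition normal_trace :: "point set \<Rightarrow> point \<Rightarrow> (point \<Rightarrow> point) \<Rightarrow> point \<Rightarrow> real" where
  "normal_trace \<Gamma>1 n v = (\<lambda>x. if x \<in> closure \<Gamma>1 then v x \<bullet> n else 0)"

subsection \<open>Forms\<close>

definition L2_vec :: "point set \<Rightarrow> (point \<Rightarrow> point) set" where
  "L2_vec \<Omega> = {f. set_borel_measurable lebesgue \<Omega> f \<and>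
                  set_integrable lebesgue \<Omega> (\<lambda>x. (norm (f x))\<^sup>2)}"

definition L2_inner :: "point set \<Rightarrow> (point \<Rightarrow> point) \<Rightarrow> (point \<Rightarrow> point) \<Rightarrow> real" where
  "L2_inner \<Omega> f v = (LINT x:\<Omega>|lebesgue. f x \<bullet> v x)"

text \<open>The partial derivatives are classical.  They are only applied to members of \<^const>\<open>V_h\<close>, which
  are differentiable off the sides of the triangles, a null set; there the classical derivatives
  agree with the weak ones.\<close>

definition partial_deriv :: "(point \<Rightarrow> point) \<Rightarrow> 2 \<Rightarrow> 2 \<Rightarrow> point \<Rightarrow> real" where
  "partial_deriv u i j x = jacobian u (at x) $ i $ j"

definition strain :: "(point \<Rightarrow> point) \<Rightarrow> 2 \<Rightarrow> 2 \<Rightarrow> point \<Rightarrow> real" where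
  "strain u i j x = (partial_deriv u i j x + partial_deriv u j i x) / 2"

definition divergence :: "(point \<Rightarrow> point) \<Rightarrow> point \<Rightarrow> real" where
  "divergence u x = (\<Sum>i\<in>UNIV. partial_deriv u i i x)"

definition form_a :: "point set \<Rightarrow> real \<Rightarrow> (point \<Rightarrow> point) \<Rightarrow> (point \<Rightarrow> point) \<Rightarrow> real" where
  "form_a \<Omega> \<nu> u v =
     2 * \<nu> * (\<Sum>i\<in>UNIV. \<Sum>j\<in>UNIV. LINT x:\<Omega>|lebesgue. strain u i j x * strain v i j x)"

definition form_b :: "point set \<Rightarrow> (point \<Rightarrow> point) \<Rightarrow> (point \<Rightarrow> real) \<Rightarrow> real" where
  "form_b \<Omega> v q = - (LINT x:\<Omega>|lebesgue. divergence v x * q x)"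

definition V_tau_sigma_h ::
    "point set \<Rightarrow> point set \<Rightarrow> point set \<Rightarrow> point \<Rightarrow> point set set \<Rightarrow> (point \<Rightarrow> point) set" where
  "V_tau_sigma_h \<Omega> \<Gamma>0 \<Gamma>1 n \<T> =
     {v \<in> V_tau_h \<Omega> \<Gamma>0 \<Gamma>1 n \<T>. \<forall>q \<in> Q_h \<Omega> \<T>. form_b \<Omega> v q = 0}"

definition form_Lambda ::
    "(point \<Rightarrow> real) \<Rightarrow> nat \<Rightarrow> (nat \<Rightarrow> point) \<Rightarrow> (point \<Rightarrow> real) \<Rightarrow> (point \<Rightarrow> real) \<Rightarrow> real" where
  "form_Lambda g m M lam \<mu> = 1/6 * (\<Sum>i=1..m. dist (M i) (M (i + 1)) *
     (g (M i) * lam (M i) * \<mu> (M i) +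
      (let M' = midpoint (M i) (M (i + 1)) in 4 * g M' * lam M' * \<mu> M') +
      g (M (i + 1)) * lam (M (i + 1)) * \<mu> (M (i + 1))))"

definition j_h :: "(point \<Rightarrow> real) \<Rightarrow> nat \<Rightarrow> (nat \<Rightarrow> point) \<Rightarrow> (point \<Rightarrow> real) \<Rightarrow> real" where
  "j_h g m M \<eta> = 1/6 * (\<Sum>i=1..m. dist (M i) (M (i + 1)) *
     (g (M i) * \<bar>\<eta> (M i)\<bar> +
      (let M' = midpoint (M i) (M (i + 1)) in 4 * g M' * \<bar>\<eta> M'\<bar>) +
      g (M (i + 1)) * \<bar>\<eta> (M (i + 1))\<bar>))"

subsection \<open>The discrete problems\<close>

definition solves_VI_h ::
    "point set \<Rightarrow> point set \<Rightarrow> point set \<Rightarrow> point \<Rightarrow> real \<Rightarrow>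
      (point \<Rightarrow> point) \<Rightarrow> (point \<Rightarrow> real) \<Rightarrow> point set set \<Rightarrow> nat \<Rightarrow> (nat \<Rightarrow> point) \<Rightarrow>
      (point \<Rightarrow> point) \<Rightarrow> (point \<Rightarrow> real) \<Rightarrow> bool" where
  "solves_VI_h \<Omega> \<Gamma>0 \<Gamma>1 n \<nu> f g \<T> m M u p \<longleftrightarrow>
     u \<in> V_tau_h \<Omega> \<Gamma>0 \<Gamma>1 n \<T> \<and> p \<in> Q_h \<Omega> \<T> \<and>
     (\<forall>v \<in> V_tau_h \<Omega> \<Gamma>0 \<Gamma>1 n \<T>.
        form_a \<Omega> \<nu> u (\<lambda>x. v x - u x) + form_b \<Omega> (\<lambda>x. v x - u x) p
          + j_h g m M (normal_trace \<Gamma>1 n v) - j_h g m M (normal_trace \<Gamma>1 n u)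
        \<ge> L2_inner \<Omega> f (\<lambda>x. v x - u x)) \<and>
     (\<forall>q \<in> Q_h \<Omega> \<T>. form_b \<Omega> u q = 0)"

definition solves_VI_h_sigma ::
    "point set \<Rightarrow> point set \<Rightarrow> point set \<Rightarrow> point \<Rightarrow> real \<Rightarrow>
      (point \<Rightarrow> point) \<Rightarrow> (point \<Rightarrow> real) \<Rightarrow> point set set \<Rightarrow> nat \<Rightarrow> (nat \<Rightarrow> point) \<Rightarrow>
      (point \<Rightarrow> point) \<Rightarrow> bool" where
  "solves_VI_h_sigma \<Omega> \<Gamma>0 \<Gamma>1 n \<nu> f g \<T> m M u \<longleftrightarrow>
     u \<in> V_tau_sigma_h \<Omega> \<Gamma>0 \<Gamma>1 n \<T> \<and>
     (\<forall>v \<in> V_tau_sigma_h \<Omega> \<Gamma>0 \<Gamma>1 n \<T>.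
        form_a \<Omega> \<nu> u (\<lambda>x. v x - u x)
          + j_h g m M (normal_trace \<Gamma>1 n v) - j_h g m M (normal_trace \<Gamma>1 n u)
        \<ge> L2_inner \<Omega> f (\<lambda>x. v x - u x))"

definition solves_VE_h ::
    "point set \<Rightarrow> point set \<Rightarrow> point set \<Rightarrow> point \<Rightarrow> real \<Rightarrow>
      (point \<Rightarrow> point) \<Rightarrow> (point \<Rightarrow> real) \<Rightarrow> point set set \<Rightarrow> nat \<Rightarrow> (nat \<Rightarrow> point) \<Rightarrow>
      (point \<Rightarrow> point) \<Rightarrow> (point \<Rightarrow> real) \<Rightarrow> (point \<Rightarrow> real) \<Rightarrow> bool" where
  "solves_VE_h \<Omega> \<Gamma>0 \<Gamma>1 n \<nu> f g \<T> m M u p lam \<longleftrightarrow>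
     u \<in> V_tau_h \<Omega> \<Gamma>0 \<Gamma>1 n \<T> \<and> p \<in> Q_h \<Omega> \<T> \<and> lam \<in> Lambda_tilde_h \<Gamma>1 \<T> m M \<and>
     (\<forall>v \<in> V_tau_h \<Omega> \<Gamma>0 \<Gamma>1 n \<T>.
        form_a \<Omega> \<nu> u v + form_b \<Omega> v p + form_Lambda g m M (normal_trace \<Gamma>1 n v) lam
        = L2_inner \<Omega> f v) \<and>
     (\<forall>q \<in> Q_h \<Omega> \<T>. form_b \<Omega> u q = 0) \<and>
     (\<forall>\<mu> \<in> Lambda_tilde_h \<Gamma>1 \<T> m M.
        form_Lambda g m M (normal_trace \<Gamma>1 n u) (\<lambda>x. \<mu> x - lam x) \<le> 0)"

end

theory Submission
  imports Defs
begin

text \<open>A velocity with \<open>a(v, v) = 0\<close> is a rigid motion on each triangle.  Rigid motions that agree at two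
  points coincide, so it is one rigid motion on all of \<open>\<Omega>\<close>, and it vanishes at the two endpoints of
  \<open>\<Gamma>\<^sub>1\<close>, which are mesh vertices in the closure of \<open>\<Gamma>\<^sub>0\<close>; hence \<open>a\<close> is definite.  The problem on
  divergence-free velocities is then solved by minimising the coercive convex functional
  \<open>a(v, v)/2 + j(v\<^sub>n) - (f, v)\<close> over the nodal values.  For the equivalence, a solution of the
  variational inequality satisfies \<open>|L(v)| \<le> j(v\<^sub>n)\<close> for the residual \<open>L\<close>, so that \<open>L\<close> depends only on
  the normal nodal values on \<open>\<Gamma>\<^sub>1\<close>; testing with the nodal basis functions there gives the multiplier.
  Conversely, the nodal interpolant of \<open>sgn u\<^sub>n\<close> as test multiplier yields \<open>(u\<^sub>n, \<lambda>) = j(u\<^sub>n)\<close>.\<close>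

subsection \<open>Triangular meshes and nodal bases\<close>

text \<open>Two facts about the mesh are not given and have to be derived. First, \<open>M i\<close>
  and \<open>M (i + 1)\<close> bound a side of a triangle: this rests on convexity, the outer normal
  and conformity, and it makes the Simpson midpoints mesh nodes and interpolants quadratic on each
  interval. Second, the endpoints of the friction side lie in the closure of
  \<open>\<Gamma>0\<close>: this rests on simplicity of the polygon and supplies the two zeros that
  fix a rigid motion. The Simpson weights drive the duality: being nonnegative, they make
  \<open>j_h\<close> convex and let it bound the pairing with any admissible multiplier; being
  positive at the nodes inside the side, they make the multiplier unique. The forms use classical
  derivatives, which are uncontrolled on the sides of the triangles, so identities between
  integrands are proved off this null set. Coercivity comes from compactness of the unit sphere of
  nodal coordinates, so its constant depends on the mesh.\<close>

lemma polynomial_on_2_iff: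
  "polynomial_on 2 S p \<longleftrightarrow> (\<exists>a b c d e f. \<forall>x\<in>S. p x =
     a + b * x $ 1 + c * x $ 2 + d * (x $ 1)\<^sup>2 + e * (x $ 1 * x $ 2) + f * (x $ 2)\<^sup>2)"
  (is "_ \<longleftrightarrow> ?R")
proof
  assume "polynomial_on 2 S p"
  then obtain k where k: "\<forall>x\<in>S. p x = (\<Sum>i\<le>2. \<Sum>j\<le>2 - i. k i j * (x $ 1) ^ i * (x $ 2) ^ j)"
    unfolding polynomial_on_def by blast
  show ?R
    by (rule exI[of _ "k 0 0"], rule exI[of _ "k 1 0"], rule exI[of _ "k 0 1"],
        rule exI[of _ "k 2 0"], rule exI[of _ "k 1 1"], rule exI[of _ "k 0 2"])
      (simp add: k numeral_2_eq_2 algebra_simps)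
next
  assume ?R
  then obtain a b c d e f where eq: "\<forall>x\<in>S. p x =
     a + b * x $ 1 + c * x $ 2 + d * (x $ 1)\<^sup>2 + e * (x $ 1 * x $ 2) + f * (x $ 2)\<^sup>2" by blast
  show "polynomial_on 2 S p"
    unfolding polynomial_on_def
    \<comment> \<open>Row \<open>i\<close> of the nested list holds the coefficients belonging to
      \<open>(x $ 1) ^ i\<close>; it has \<open>3 - i\<close> entries, exactly the range
      \<open>j \<le> 2 - i\<close>.\<close>
    by (rule exI[of _ "\<lambda>i j. ([[a, c, f], [b, e], [d]] ! i) ! j"])
      (simp add: eq numeral_2_eq_2 algebra_simps)
qed

lemma polynomial_on_subset: "polynomial_on k S p \<Longrightarrow> T \<subseteq> S \<Longrightarrow> polynomial_on k T p"
  unfolding polynomial_on_def by blast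

lemma polynomial_on_cong:
  "polynomial_on k S p \<Longrightarrow> (\<And>x. x \<in> S \<Longrightarrow> q x = p x) \<Longrightarrow> polynomial_on k S q"
  unfolding polynomial_on_def by auto

lemma polynomial_on_zero: "polynomial_on k S (\<lambda>x. 0)"
  unfolding polynomial_on_def by (rule exI[of _ "\<lambda>i j. 0"]) simp

lemma polynomial_on_lincomb:
  assumes "polynomial_on k S p" "polynomial_on k S q"
  shows "polynomial_on k S (\<lambda>x. \<alpha> * p x + \<beta> * q x)"
proof -
  obtain c d where "\<forall>x\<in>S. p x = (\<Sum>i\<le>k. \<Sum>j\<le>k - i. c i j * (x $ 1) ^ i * (x $ 2) ^ j)"
    "\<forall>x\<in>S. q x = (\<Sum>i\<le>k. \<Sum>j\<le>k - i. d i j * (x $ 1) ^ i * (x $ 2) ^ j)"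
    using assms unfolding polynomial_on_def by blast
  then show ?thesis
    unfolding polynomial_on_def
    by (intro exI[of _ "\<lambda>i j. \<alpha> * c i j + \<beta> * d i j"])
      (simp add: sum_distrib_left sum.distrib [symmetric] algebra_simps)
qed

text \<open>Quadratic basis functions are built as products of affine hats.\<close>

lemma polynomial_on_2_mult_affine:
  assumes "\<And>x. x \<in> S \<Longrightarrow> p x = r + a \<bullet> x" "\<And>x. x \<in> S \<Longrightarrow> q x = s + b \<bullet> x"
  shows "polynomial_on 2 S (\<lambda>x. p x * q x)"
  unfolding polynomial_on_2_iff
  apply (rule exI[of _ "r * s"], rule exI[of _ "r * b$1 + s * a$1"], rule exI[of _ "r * b$2 + s * a$2"],
      rule exI[of _ "a$1 * b$1"], rule exI[of _ "a$1 * b$2 + a$2 * b$1"], rule exI[of _ "a$2 * b$2"])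
  by (auto simp: assms inner_vec_def sum_2 power2_eq_square algebra_simps)

text \<open>Degree two survives an affine change of coordinates. The directions \<open>u\<close>,
  \<open>w\<close> may be dependent, so degenerate triangles are covered too.\<close>

lemma polynomial_on_2_affine_subst:
  assumes "polynomial_on 2 S p"
  obtains k0 k1 k2 k3 k4 k5 where
    "\<And>s t. a + s *\<^sub>R u + t *\<^sub>R w \<in> S \<Longrightarrow>
       p (a + s *\<^sub>R u + t *\<^sub>R w) = k0 + k1 * s + k2 * t + k3 * s\<^sup>2 + k4 * (s * t) + k5 * t\<^sup>2"
proof -
  obtain c0 c1 c2 c3 c4 c5 where eq: "\<forall>x\<in>S. p x =
     c0 + c1 * x $ 1 + c2 * x $ 2 + c3 * (x $ 1)\<^sup>2 + c4 * (x $ 1 * x $ 2) + c5 * (x $ 2)\<^sup>2"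
    using assms unfolding polynomial_on_2_iff by blast
  show thesis
    apply (rule that[of "c0 + c1 * a$1 + c2 * a$2 + c3 * (a$1)\<^sup>2 + c4 * (a$1 * a$2) + c5 * (a$2)\<^sup>2"
        "c1 * u$1 + c2 * u$2 + c3 * 2 * a$1 * u$1 + c4 * (a$1 * u$2 + a$2 * u$1) + c5 * 2 * a$2 * u$2"
        "c1 * w$1 + c2 * w$2 + c3 * 2 * a$1 * w$1 + c4 * (a$1 * w$2 + a$2 * w$1) + c5 * 2 * a$2 * w$2"
        "c3 * (u$1)\<^sup>2 + c4 * u$1 * u$2 + c5 * (u$2)\<^sup>2"
        "c3 * 2 * u$1 * w$1 + c4 * (u$1 * w$2 + u$2 * w$1) + c5 * 2 * u$2 * w$2"
        "c3 * (w$1)\<^sup>2 + c4 * w$1 * w$2 + c5 * (w$2)\<^sup>2"])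
    apply (subst eq[rule_format], assumption)
    by (simp add: power2_eq_square algebra_simps)
qed

text \<open>Unisolvence of the six quadratic nodes. In the parameters \<open>s\<close>,
  \<open>t\<close> the nodes are fixed reference points, so the argument is the same for every
  triangle, \<open>b = c\<close> included.\<close>

lemma polynomial_on_2_triangle_eq_0:
  assumes p: "polynomial_on 2 (convex hull {a, b, c}) p"
    and "p a = 0" "p b = 0" "p c = 0"
    and "p (midpoint a b) = 0" "p (midpoint b c) = 0" "p (midpoint a c) = 0"
    and y: "y \<in> convex hull {a, b, c}"
  shows "p y = 0"
proof -
  obtain k0 k1 k2 k3 k4 k5 where k: "\<And>s t. a + s *\<^sub>R (b - a) + t *\<^sub>R (c - a) \<in> convex hull {a, b, c} \<Longrightarrow>
       p (a + s *\<^sub>R (b - a) + t *\<^sub>R (c - a)) = k0 + k1 * s + k2 * t + k3 * s\<^sup>2 + k4 * (s * t) + k5 * t\<^sup>2"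
    using polynomial_on_2_affine_subst[OF p] by metis
  have hull: "convex hull {a, b, c} = {a + s *\<^sub>R (b - a) + t *\<^sub>R (c - a) |s t. 0 \<le> s \<and> 0 \<le> t \<and> s + t \<le> 1}"
    by (rule convex_hull_3_alt)
  have k': "p (a + s *\<^sub>R (b - a) + t *\<^sub>R (c - a)) = k0 + k1 * s + k2 * t + k3 * s\<^sup>2 + k4 * (s * t) + k5 * t\<^sup>2"
    if "0 \<le> s" "0 \<le> t" "s + t \<le> 1" for s t
    by (rule k) (use that hull in blast)
  have pts: "a = a + 0 *\<^sub>R (b - a) + 0 *\<^sub>R (c - a)" "b = a + 1 *\<^sub>R (b - a) + 0 *\<^sub>R (c - a)"
     "c = a + 0 *\<^sub>R (b - a) + 1 *\<^sub>R (c - a)"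
     "midpoint a b = a + (1/2) *\<^sub>R (b - a) + 0 *\<^sub>R (c - a)"
     "midpoint b c = a + (1/2) *\<^sub>R (b - a) + (1/2) *\<^sub>R (c - a)"
     "midpoint a c = a + 0 *\<^sub>R (b - a) + (1/2) *\<^sub>R (c - a)"
    by (auto simp: midpoint_def vec_eq_iff field_simps)
  \<comment> \<open>The three values along each leg kill its one-variable quadratic; the midpoint of
    the third side then disposes of the mixed coefficient \<open>k4\<close>.\<close>
  have "k0 = 0" using k'[of 0 0] pts assms by simp
  moreover have "k0 + k1 + k3 = 0" using k'[of 1 0] pts(2) assms by simp
  moreover have "k0 + k2 + k5 = 0" using k'[of 0 1] pts(3) assms by simp
  moreover have "k0 + k1 * (1/2) + k3 * (1/2)\<^sup>2 = 0" using k'[of "1/2" 0] pts(4) assms(5) by simp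
  moreover have "k0 + k1 * (1/2) + k2 * (1/2) + k3 * (1/2)\<^sup>2 + k4 * (1/2 * (1/2)) + k5 * (1/2)\<^sup>2 = 0"
    using k'[of "1/2" "1/2"] pts(5) assms(6) by simp
  moreover have "k0 + k2 * (1/2) + k5 * (1/2)\<^sup>2 = 0" using k'[of 0 "1/2"] pts(6) assms(7) by simp
  ultimately have "k0 = 0" "k1 = 0" "k2 = 0" "k3 = 0" "k4 = 0" "k5 = 0"
    by (simp_all add: power2_eq_square)
  moreover obtain s t where "y = a + s *\<^sub>R (b - a) + t *\<^sub>R (c - a)" "0 \<le> s" "0 \<le> t" "s + t \<le> 1"
    using y hull by blast
  ultimately show ?thesis using k' by simp
qed

text \<open>The segment is the degenerate triangle \<open>{a, b, b}\<close>, whose only nodes are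
  \<open>a\<close>, \<open>b\<close> and their midpoint.\<close>

lemma polynomial_on_2_segment_eq_0:
  assumes p: "polynomial_on 2 (closed_segment a b) p"
    and "p a = 0" "p b = 0" "p (midpoint a b) = 0" and y: "y \<in> closed_segment a b"
  shows "p y = 0"
proof -
  have eq: "convex hull {a, b, b} = closed_segment a b"
    by (simp add: segment_convex_hull)
  have "p ((1/2) *\<^sub>R (b + b)) = 0"
    using assms(3) by (simp flip: scaleR_2)
  then show ?thesis
    by (intro polynomial_on_2_triangle_eq_0[of a b b p y]) (use assms eq in \<open>auto simp: midpoint_def\<close>)
qed

lemma simplex_2E:
  fixes T :: "point set"
  assumes "2 simplex T"
  obtains a b c where "T = convex hull {a, b, c}" "\<not> affine_dependent {a, b, c}"
    "a \<noteq> b" "b \<noteq> c" "a \<noteq> c"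
proof -
  obtain C where C: "\<not> affine_dependent C" "int (card C) = 2 + 1" "T = convex hull C"
    using assms unfolding simplex_def by blast
  then have "card C = 3" by linarith
  then obtain a b c where "C = {a, b, c}" "a \<noteq> b" "b \<noteq> c" "a \<noteq> c"
    by (auto simp: card_3_iff)
  then show thesis using C that by blast
qed

text \<open>The differences to one base point of \<open>C\<close> are linearly independent, so a
  linear functional can take prescribed values on them; shifting back to the base point gives the
  affine interpolant.\<close>

lemma affine_independent_interpolation:
  fixes C :: "point set"
  assumes "\<not> affine_dependent C"
  shows "\<exists>r p. \<forall>x\<in>C. w x = r + p \<bullet> x"
proof (cases "C = {}")
  case False
  then obtain a where a: "a \<in> C" by blast
  let ?B = "(\<lambda>x. -a + x) ` (C - {a})"
  have "independent ?B"
    using affine_dependent_iff_dependent2[OF a] assms by simp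
  then obtain L where L: "linear L" "\<And>x. x \<in> ?B \<Longrightarrow> L x = w (a + x) - w a"
    using linear_independent_extend[of ?B "\<lambda>x. w (a + x) - w a"] by blast
  \<comment> \<open>A linear functional is the inner product with a vector, here the image of 1
    under the adjoint.\<close>
  have LA: "L x = adjoint L 1 \<bullet> x" for x
    using adjoint_works[OF L(1), of x 1] by (simp add: inner_commute)
  have "w x = (w a - L a) + adjoint L 1 \<bullet> x" if "x \<in> C" for x
  proof (cases "x = a")
    case True then show ?thesis using LA by simp
  next
    case False
    then have "L (-a + x) = w x - w a" using L(2)[of "-a + x"] that by force
    then have "L x - L a = w x - w a" using linear_diff[OF L(1), of x a] by simp
    then show ?thesis using LA by simp
  qed
  then show ?thesis by blast
qed auto

text \<open>The part of \<open>admissible_mesh\<close> that does not refer to the domain.\<close>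

definition triangular_mesh :: "point set set \<Rightarrow> bool" where
  "triangular_mesh \<T> \<longleftrightarrow> triangulation \<T> \<and> (\<forall>T\<in>\<T>. 2 simplex T)"

context
  fixes \<T> :: "point set set"
  assumes mesh: "triangular_mesh \<T>"
begin

lemma mesh_finite: "finite \<T>"
  using mesh by (simp add: triangular_mesh_def triangulation_def)

lemma mesh_face: "T \<in> \<T> \<Longrightarrow> T' \<in> \<T> \<Longrightarrow> T \<inter> T' face_of T"
  using mesh by (simp add: triangular_mesh_def triangulation_def)

lemma mesh_simplex: "T \<in> \<T> \<Longrightarrow> 2 simplex T"
  using mesh by (simp add: triangular_mesh_def)

lemma mesh_triangle:
  assumes "T \<in> \<T>"
  shows "convex T" "compact T" "closed T" "bounded T"
  using mesh_simplex[OF assms] convex_simplex compact_simplex closed_simplex compact_imp_bounded by blast+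

lemma mesh_triangle_vertices:
  assumes "T \<in> \<T>"
  obtains a b c where "T = convex hull {a, b, c}" "\<not> affine_dependent {a, b, c}"
    "a \<noteq> b" "b \<noteq> c" "a \<noteq> c" "{x. x extreme_point_of T} = {a, b, c}"
proof -
  obtain a b c where *: "T = convex hull {a, b, c}" "\<not> affine_dependent {a, b, c}"
    "a \<noteq> b" "b \<noteq> c" "a \<noteq> c" using simplex_2E[OF mesh_simplex[OF assms]] by blast
  then have "{x. x extreme_point_of T} = {a, b, c}"
    using extreme_point_of_convex_hull_affine_independent by blast
  then show thesis using * that by blast
qed

text \<open>No hanging nodes: a vertex of another triangle that lies in \<open>T\<close> is extreme
  in the common face \<open>T \<inter> T'\<close>, and extreme points of a face are extreme in
  \<open>T\<close>.\<close>

lemma mesh_vertex_extreme: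
  assumes "x \<in> mesh_vertices \<T>" "x \<in> T" "T \<in> \<T>"
  shows "x extreme_point_of T"
proof -
  obtain T' where T': "T' \<in> \<T>" "x extreme_point_of T'"
    using assms(1) by (auto simp: mesh_vertices_def)
  have "x \<in> T \<inter> T'" using T' assms by (simp add: extreme_point_of_def)
  then have "x extreme_point_of (T' \<inter> T)"
    using T'(2) by (auto simp: extreme_point_of_def)
  then show ?thesis
    using extreme_point_of_face[OF mesh_face[OF assms(3) T'(1)]] by (simp add: Int_commute)
qed

lemma finite_mesh_vertices: "finite (mesh_vertices \<T>)"
proof -
  have "finite {x. x extreme_point_of T}" if "T \<in> \<T>" for T
    using mesh_triangle_vertices[OF that] by (metis finite.emptyI finite_insert)
  moreover have "mesh_vertices \<T> = (\<Union>T\<in>\<T>. {x. x extreme_point_of T})"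
    by (auto simp: mesh_vertices_def)
  ultimately show ?thesis using mesh_finite by simp
qed

lemma edge_of_extreme:
  assumes "closed_segment C D edge_of T"
  shows "C extreme_point_of T" "D extreme_point_of T" "C \<noteq> D"
proof -
  have f: "closed_segment C D face_of T" "aff_dim (closed_segment C D) = 1"
    using assms by (auto simp: edge_of_def)
  show "C extreme_point_of T" "D extreme_point_of T"
    using extreme_point_of_face[OF f(1)] by (auto simp: extreme_point_of_segment)
  show "C \<noteq> D" using f(2) by auto
qed

lemma edge_of_mesh_vertices:
  assumes "closed_segment C D edge_of T" "T \<in> \<T>"
  shows "C \<in> mesh_vertices \<T>" "D \<in> mesh_vertices \<T>" "C \<noteq> D"
  using edge_of_extreme[OF assms(1)] assms(2) by (auto simp: mesh_vertices_def)

lemma finite_mesh_nodes: "finite (mesh_nodes \<T>)"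
proof -
  have "{midpoint C D |C D. \<exists>T\<in>\<T>. closed_segment C D edge_of T} \<subseteq>
      (\<lambda>(C, D). midpoint C D) ` (mesh_vertices \<T> \<times> mesh_vertices \<T>)"
    using edge_of_mesh_vertices by fastforce
  then show ?thesis
    unfolding mesh_nodes_def using finite_mesh_vertices by (meson finite_SigmaI finite_UnI finite_imageI finite_subset)
qed

section \<open>Continuous affine and quadratic nodal functions on the mesh\<close>

lemma p1_interpolant:
  fixes w :: "point \<Rightarrow> real"
  obtains \<psi> where "continuous_on (\<Union>\<T>) \<psi>" "\<And>x. x \<in> mesh_vertices \<T> \<Longrightarrow> \<psi> x = w x"
    "\<And>T. T \<in> \<T> \<Longrightarrow> \<exists>r p. \<forall>y\<in>T. \<psi> y = r + p \<bullet> y"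
proof -
  have "\<exists>r p. \<forall>x\<in>{x. x extreme_point_of T}. w x = r + p \<bullet> x" if T: "T \<in> \<T>" for T
  proof -
    obtain a b c where "\<not> affine_dependent {a, b, c}" "{x. x extreme_point_of T} = {a, b, c}"
      using mesh_triangle_vertices[OF T] by metis
    then show ?thesis using affine_independent_interpolation by metis
  qed
  then obtain R P where RP: "\<And>T x. T \<in> \<T> \<Longrightarrow> x extreme_point_of T \<Longrightarrow> w x = R T + P T \<bullet> x"
    by (metis mem_Collect_eq)
  \<comment> \<open>Any triangle containing the point will do; \<open>agree\<close> shows that the
    choice is immaterial.\<close>
  define tri where "tri y = (SOME T. T \<in> \<T> \<and> y \<in> T)" for y
  define \<psi> where "\<psi> y = R (tri y) + P (tri y) \<bullet> y" for y
  have tri: "tri y \<in> \<T> \<and> y \<in> tri y" if "y \<in> T" "T \<in> \<T>" for y T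
    unfolding tri_def by (rule someI[of _ T]) (use that in blast)
  \<comment> \<open>A common face is the hull of its extreme points, which are vertices of both triangles.\<close>
  have agree: "R T + P T \<bullet> y = R T' + P T' \<bullet> y" if T: "T \<in> \<T>" "T' \<in> \<T>" "y \<in> T" "y \<in> T'" for T T' y
  proof -
    let ?F = "T \<inter> T'"
    have conv: "compact ?F" "convex ?F"
      using T mesh_triangle by (auto intro: convex_Int compact_Int)
    have F1: "?F face_of T" and F2: "?F face_of T'"
      using mesh_face[OF T(1,2)] mesh_face[OF T(2,1)] by (simp_all add: Int_commute)
    have "?F = convex hull {x. x extreme_point_of ?F}"
      using Krein_Milman_Minkowski[OF conv] .
    also have "\<dots> \<subseteq> {y. (P T - P T') \<bullet> y = R T' - R T}"
    proof (rule hull_minimal, safe)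
      fix x assume "x extreme_point_of ?F"
      then have "x extreme_point_of T" "x extreme_point_of T'"
        using extreme_point_of_face[OF F1] extreme_point_of_face[OF F2] by blast+
      then show "(P T - P T') \<bullet> x = R T' - R T"
        using RP[of T x] RP[of T' x] T by (simp add: inner_diff_left)
    qed (rule convex_hyperplane)
    finally have "(P T - P T') \<bullet> y = R T' - R T" using T by blast
    then show ?thesis by (simp add: inner_diff_left)
  qed
  have \<psi>: "\<psi> y = R T + P T \<bullet> y" if "T \<in> \<T>" "y \<in> T" for T y
    unfolding \<psi>_def using agree[of "tri y" T y] tri[OF that(2,1)] that by auto
  show thesis
  proof (rule that)
    show "continuous_on (\<Union>\<T>) \<psi>"
    proof (rule continuous_on_closed_Union[where U = id, simplified])
      show "finite \<T>" by (rule mesh_finite)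
      show "closed T" if "T \<in> \<T>" for T using mesh_triangle that by blast
      show "continuous_on T \<psi>" if "T \<in> \<T>" for T
        by (rule continuous_on_eq[where f = "\<lambda>y. R T + P T \<bullet> y"], intro continuous_intros)
          (simp add: \<psi>[OF that])
    qed
    show "\<psi> x = w x" if "x \<in> mesh_vertices \<T>" for x
    proof -
      obtain T where T: "T \<in> \<T>" "x extreme_point_of T"
        using \<open>x \<in> mesh_vertices \<T>\<close> by (auto simp: mesh_vertices_def)
      then show ?thesis using \<psi>[OF T(1), of x] RP[OF T] by (simp add: extreme_point_of_def)
    qed
    show "\<exists>r p. \<forall>y\<in>T. \<psi> y = r + p \<bullet> y" if "T \<in> \<T>" for T
      using \<psi>[OF that] by blast
  qed
qed

text \<open>At the midpoint of a side an affine function is the mean of its end values. These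
  midpoint values are recorded for evaluating the quadratic basis.\<close>

lemma p1_hat_functions:
  "\<exists>\<psi>. \<forall>x. continuous_on (\<Union>\<T>) (\<psi> x) \<and>
    (\<forall>y\<in>mesh_vertices \<T>. \<psi> x y = (if y = x then 1 else 0 :: real)) \<and>
    (\<forall>T\<in>\<T>. \<exists>r p. \<forall>y\<in>T. \<psi> x y = r + p \<bullet> y) \<and>
    (\<forall>T\<in>\<T>. \<forall>C D. closed_segment C D edge_of T \<longrightarrow>
        \<psi> x (midpoint C D) = (if x = C \<or> x = D then 1/2 else 0))"
proof -
  have "\<exists>\<psi>. continuous_on (\<Union>\<T>) \<psi> \<and> (\<forall>y\<in>mesh_vertices \<T>. \<psi> y = (if y = x then 1 else 0 :: real))
      \<and> (\<forall>T\<in>\<T>. \<exists>r p. \<forall>y\<in>T. \<psi> y = r + p \<bullet> y)" for x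
    using p1_interpolant[of "\<lambda>y. if y = x then 1 else 0"] by metis
  then obtain \<psi> where \<psi>: "\<And>x. continuous_on (\<Union>\<T>) (\<psi> x)"
    "\<And>x y. y \<in> mesh_vertices \<T> \<Longrightarrow> \<psi> x y = (if y = x then 1 else 0 :: real)"
    "\<And>x T. T \<in> \<T> \<Longrightarrow> \<exists>r p. \<forall>y\<in>T. \<psi> x y = r + p \<bullet> y" by metis
  moreover have "\<psi> x (midpoint C D) = (if x = C \<or> x = D then 1/2 else 0)"
    if e: "closed_segment C D edge_of T" "T \<in> \<T>" for x T C D
  proof -
    obtain r p where rp: "\<And>y. y \<in> T \<Longrightarrow> \<psi> x y = r + p \<bullet> y" using \<psi>(3)[OF e(2)] by metis
    have sub: "closed_segment C D \<subseteq> T" using e(1) by (rule edge_of_imp_subset)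
    then have "C \<in> T" "D \<in> T" "midpoint C D \<in> T" by (auto simp: midpoint_in_closed_segment)
    then have "\<psi> x (midpoint C D) = (\<psi> x C + \<psi> x D) / 2"
      by (simp add: rp midpoint_def inner_simps field_simps)
    then show ?thesis using \<psi>(2) edge_of_mesh_vertices[OF e] by auto
  qed
  ultimately show ?thesis by (intro exI[of _ \<psi>]) blast
qed

text \<open>The usual barycentric formulas: \<open>t * (2 * t - 1)\<close> of the hat at a vertex,
  and four times the product of the two end hats at a midpoint.\<close>

lemma p2_nodal_basis:
  obtains \<phi> where "\<And>x. x \<in> mesh_nodes \<T> \<Longrightarrow> continuous_on (\<Union>\<T>) (\<phi> x)"
    "\<And>x T. x \<in> mesh_nodes \<T> \<Longrightarrow> T \<in> \<T> \<Longrightarrow> polynomial_on 2 T (\<phi> x)"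
    "\<And>x y. x \<in> mesh_nodes \<T> \<Longrightarrow> y \<in> mesh_nodes \<T> \<Longrightarrow> \<phi> x y = (if y = x then 1 else 0 :: real)"
proof -
  obtain \<psi> where *: "\<forall>x. continuous_on (\<Union>\<T>) (\<psi> x) \<and>
    (\<forall>y\<in>mesh_vertices \<T>. \<psi> x y = (if y = x then 1 else 0 :: real)) \<and>
    (\<forall>T\<in>\<T>. \<exists>r p. \<forall>y\<in>T. \<psi> x y = r + p \<bullet> y) \<and>
    (\<forall>T\<in>\<T>. \<forall>C D. closed_segment C D edge_of T \<longrightarrow>
        \<psi> x (midpoint C D) = (if x = C \<or> x = D then 1/2 else 0))"
    using p1_hat_functions by blast
  have \<psi>: "continuous_on (\<Union>\<T>) (\<psi> x)"
    "y \<in> mesh_vertices \<T> \<Longrightarrow> \<psi> x y = (if y = x then 1 else 0 :: real)"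
    "T \<in> \<T> \<Longrightarrow> \<exists>r p. \<forall>y\<in>T. \<psi> x y = r + p \<bullet> y"
    "closed_segment C D edge_of T \<Longrightarrow> T \<in> \<T> \<Longrightarrow>
        \<psi> x (midpoint C D) = (if x = C \<or> x = D then 1/2 else 0)" for x y T C D
    using * by blast+
  have "\<exists>\<phi>. continuous_on (\<Union>\<T>) \<phi> \<and> (\<forall>T\<in>\<T>. polynomial_on 2 T \<phi>) \<and>
     (\<forall>y\<in>mesh_nodes \<T>. \<phi> y = (if y = x then 1 else 0 :: real))" if "x \<in> mesh_nodes \<T>" for x
  proof -
    consider "x \<in> mesh_vertices \<T>" | C D T where "x = midpoint C D" "T \<in> \<T>" "closed_segment C D edge_of T"
      using \<open>x \<in> mesh_nodes \<T>\<close> by (auto simp: mesh_nodes_def)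
    then show ?thesis
    proof cases
      case 1
      let ?\<phi> = "\<lambda>y. \<psi> x y * (2 * \<psi> x y - 1)"
      have "continuous_on (\<Union>\<T>) ?\<phi>" by (intro continuous_intros \<psi>)
      moreover have "polynomial_on 2 T ?\<phi>" if T: "T \<in> \<T>" for T
      proof -
        obtain r p where "\<forall>y\<in>T. \<psi> x y = r + p \<bullet> y" using \<psi>(3)[OF T] by metis
        then show ?thesis
          by (intro polynomial_on_2_mult_affine[where r = r and a = p and s = "2 * r - 1" and b = "2 *\<^sub>R p"])
            (auto simp: algebra_simps)
      qed
      \<comment> \<open>The hat takes only the values 0, 1/2 and 1 at nodes;
        \<open>t * (2 * t - 1)\<close> vanishes at the first two and is 1 at the third.\<close>
      moreover have "?\<phi> y = (if y = x then 1 else 0)" if y: "y \<in> mesh_nodes \<T>" for y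
      proof (cases "y \<in> mesh_vertices \<T>")
        case True
        then show ?thesis using \<psi>(2) by simp
      next
        case False
        then obtain C D T where "y = midpoint C D" "T \<in> \<T>" "closed_segment C D edge_of T"
          using y by (auto simp: mesh_nodes_def)
        then have "\<psi> x y = 1/2 \<or> \<psi> x y = 0" using \<psi>(4)[of C D T x] by auto
        then show ?thesis using False 1 by auto
      qed
      ultimately show ?thesis by blast
    next
      case 2
      let ?\<phi> = "\<lambda>y. 4 * \<psi> C y * \<psi> D y"
      have "continuous_on (\<Union>\<T>) ?\<phi>" by (intro continuous_intros \<psi>)
      moreover have "polynomial_on 2 T ?\<phi>" if T: "T \<in> \<T>" for T
      proof -
        obtain r p s q where "\<forall>y\<in>T. \<psi> C y = r + p \<bullet> y" "\<forall>y\<in>T. \<psi> D y = s + q \<bullet> y"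
          using \<psi>(3)[OF T] by metis
        then show ?thesis
          by (intro polynomial_on_2_mult_affine[where r = "4 * r" and a = "4 *\<^sub>R p" and s = s and b = q])
            (auto simp: algebra_simps)
      qed
      moreover have "?\<phi> y = (if y = x then 1 else 0)" if y: "y \<in> mesh_nodes \<T>" for y
      proof (cases "\<exists>E F T. y = midpoint E F \<and> T \<in> \<T> \<and> closed_segment E F edge_of T")
        case True
        then obtain E F T' where EF: "y = midpoint E F" "T' \<in> \<T>" "closed_segment E F edge_of T'"
          by blast
        have CD: "C \<noteq> D" "E \<noteq> F" using edge_of_extreme[OF 2(3)] edge_of_extreme[OF EF(3)] by auto
        have *: "?\<phi> y = (if {E, F} = {C, D} then 1 else 0)"
          using \<psi>(4)[OF EF(3,2), of C] \<psi>(4)[OF EF(3,2), of D] EF(1) CD by (auto simp: doubleton_eq_iff)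
        have half: "\<psi> C x = 1/2" "\<psi> D x = 1/2"
          using \<psi>(4)[OF 2(3,2), of C] \<psi>(4)[OF 2(3,2), of D] 2(1) by (simp_all del: divide_eq_eq)
        \<comment> \<open>The value 1 at \<open>x\<close> against the value 0 at the midpoint of any
          other side shows that distinct sides have distinct midpoints.\<close>
        have **: "?\<phi> x = 1" unfolding half by simp
        have "y = x" if "{E, F} = {C, D}"
          using that 2(1) EF(1) by (auto simp: doubleton_eq_iff midpoint_sym)
        then show ?thesis using * ** by (metis (full_types))
      next
        case False
        then have v: "y \<in> mesh_vertices \<T>" using y by (auto simp: mesh_nodes_def)
        moreover have "y \<noteq> x" using False 2 by blast
        moreover have "C \<noteq> D" using edge_of_extreme[OF 2(3)] by auto
        ultimately show ?thesis using \<psi>(2)[OF v, of C] \<psi>(2)[OF v, of D] by auto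
      qed
      ultimately show ?thesis by blast
    qed
  qed
  then show thesis using that by metis
qed

text \<open>Every pair of vertices of a triangle spans a side of it, so all six points of the
  unisolvence argument are mesh nodes.\<close>

lemma p2_eq_0_if_nodal_eq_0:
  assumes "T \<in> \<T>" "polynomial_on 2 T p" "\<And>x. x \<in> mesh_nodes \<T> \<Longrightarrow> p x = 0" "y \<in> T"
  shows "p y = 0"
proof -
  obtain a b c where abc: "T = convex hull {a, b, c}" "\<not> affine_dependent {a, b, c}"
    "a \<noteq> b" "b \<noteq> c" "a \<noteq> c" "{x. x extreme_point_of T} = {a, b, c}"
    using mesh_triangle_vertices[OF assms(1)] by metis
  have edge: "closed_segment x z edge_of T" if "{x, z} \<subseteq> {a, b, c}" "x \<noteq> z" for x z
  proof -
    have "convex hull {x, z} face_of T"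
      using face_of_convex_hull_affine_independent[OF abc(2), of "convex hull {x,z}"] abc(1) that(1) by blast
    then show ?thesis
      using that(2) by (simp add: edge_of_def segment_convex_hull aff_dim_convex_hull aff_dim_2)
  qed
  have vert: "x \<in> mesh_nodes \<T>" if "x \<in> {a, b, c}" for x
    using that abc(6) assms(1) unfolding mesh_nodes_def mesh_vertices_def by blast
  have mid: "midpoint x z \<in> mesh_nodes \<T>" if "{x, z} \<subseteq> {a, b, c}" "x \<noteq> z" for x z
    using edge[OF that] assms(1) unfolding mesh_nodes_def by blast
  show ?thesis
    by (rule polynomial_on_2_triangle_eq_0[of a b c p y])
      (use assms abc mid vert in auto)
qed

end

subsection \<open>Calculus on broken polynomials and the kernel of the strain\<close>

lemma V_h_lincomb:
  assumes "u \<in> V_h \<Omega> \<T>" "v \<in> V_h \<Omega> \<T>"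
  shows "(\<lambda>x. \<alpha> *\<^sub>R u x + \<beta> *\<^sub>R v x) \<in> V_h \<Omega> \<T>"
  using assms unfolding V_h_def C0_def
  by (auto intro!: continuous_intros polynomial_on_lincomb)

lemma affine_eq_0_on_open:
  fixes S :: "point set"
  assumes "open S" "S \<noteq> {}" and eq: "\<And>x. x \<in> S \<Longrightarrow> k + l * x $ 1 + m * x $ 2 = (0::real)"
  shows "k = 0" "l = 0" "m = 0"
proof -
  obtain x where x: "x \<in> S" using assms(2) by blast
  obtain \<epsilon> where e: "\<epsilon> > 0" "cball x \<epsilon> \<subseteq> S"
    using open_contains_cball assms(1) x by metis
  have 1: "x + \<epsilon> *\<^sub>R axis i 1 \<in> S" for i
    using e by (intro subsetD[OF e(2)]) (simp add: dist_norm)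
  have *: "k + l * (x $ 1 + \<epsilon>) + m * x $ 2 = 0" "k + l * x $ 1 + m * (x $ 2 + \<epsilon>) = 0"
    using eq[OF 1[of 1]] eq[OF 1[of 2]] by (simp_all add: axis_def)
  have "l * \<epsilon> = 0" "m * \<epsilon> = 0" using * eq[OF x] unfolding distrib_left by linarith+
  then show "l = 0" "m = 0" using e by auto
  then show "k = 0" using eq[OF x] by simp
qed

text \<open>Values and derivatives are given with the same coefficients, so that a condition on the
  strain can be read back as a condition on the function itself.\<close>

lemma V_h_local:
  assumes "v \<in> V_h \<Omega> \<T>" "T \<in> \<T>"
  shows "\<exists>a b c d e f.
    (\<forall>x\<in>T. \<forall>i. v x $ i = a i + b i * x $ 1 + c i * x $ 2 + d i * (x $ 1)\<^sup>2 + e i * (x $ 1 * x $ 2) + f i * (x $ 2)\<^sup>2) \<and>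
    (\<forall>x\<in>interior T. v differentiable at x \<and>
      (\<forall>i. partial_deriv v i 1 x = b i + (2 * d i) * x $ 1 + e i * x $ 2) \<and>
      (\<forall>i. partial_deriv v i 2 x = c i + e i * x $ 1 + (2 * f i) * x $ 2))"
proof -
  have "\<forall>i. \<exists>a b c d e f. \<forall>x\<in>T. v x $ i = a + b * x $ 1 + c * x $ 2 + d * (x $ 1)\<^sup>2 + e * (x $ 1 * x $ 2) + f * (x $ 2)\<^sup>2"
  proof
    fix i
    have "polynomial_on 2 T (\<lambda>x. v x $ i)" using assms by (simp add: V_h_def)
    then show "\<exists>a b c d e f. \<forall>x\<in>T. v x $ i = a + b * x $ 1 + c * x $ 2 + d * (x $ 1)\<^sup>2 + e * (x $ 1 * x $ 2) + f * (x $ 2)\<^sup>2"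
      unfolding polynomial_on_2_iff .
  qed
  then obtain a b c d e f where v: "\<And>x i. x \<in> T \<Longrightarrow>
      v x $ i = a i + b i * x $ 1 + c i * x $ 2 + d i * (x $ 1)\<^sup>2 + e i * (x $ 1 * x $ 2) + f i * (x $ 2)\<^sup>2"
    unfolding choice_iff by blast
  let ?D = "\<lambda>x h. \<chi> i. (b i + (2 * d i) * x $ 1 + e i * x $ 2) * h $ 1 + (c i + e i * x $ 1 + (2 * f i) * x $ 2) * h $ (2::2)"
  have der: "(v has_derivative ?D x) (at x)" if x: "x \<in> interior T" for x
  proof (rule has_derivative_transform_within_open[OF _ open_interior x])
    let ?q = "\<lambda>x::point. (\<chi> i. a i + b i * x $ 1 + c i * x $ 2 + d i * (x $ 1)\<^sup>2 + e i * (x $ 1 * x $ 2) + f i * (x $ 2)\<^sup>2) :: point"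
    have nth: "((\<lambda>x::point. x $ j) has_derivative (\<lambda>h. h $ j)) (at x)" for j
      by (rule bounded_linear.has_derivative[OF bounded_linear_vec_nth has_derivative_ident])
    show "(?q has_derivative ?D x) (at x)"
    proof (subst has_derivative_componentwise_within, clarsimp simp: Basis_vec_def inner_axis)
      fix i :: 2
      show "((\<lambda>x. a i + b i * x $ 1 + c i * x $ 2 + d i * (x $ 1)\<^sup>2 + e i * (x $ 1 * x $ 2) + f i * (x $ 2)\<^sup>2)
        has_derivative (\<lambda>h. (b i + 2 * d i * x $ 1 + e i * x $ 2) * h $ 1 + (c i + e i * x $ 1 + 2 * f i * x $ 2) * h $ 2)) (at x)"
      proof -
        have "((\<lambda>x. a i + b i * x $ 1 + c i * x $ 2 + d i * (x $ 1 * x $ 1) + e i * (x $ 1 * x $ 2) + f i * (x $ 2 * x $ 2))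
          has_derivative (\<lambda>h. 0 + b i * h $ 1 + c i * h $ 2 + d i * (x $ 1 * h $ 1 + h $ 1 * x $ 1)
            + e i * (x $ 1 * h $ 2 + h $ 1 * x $ 2) + f i * (x $ 2 * h $ 2 + h $ 2 * x $ 2))) (at x)"
          by (intro has_derivative_add has_derivative_const has_derivative_mult_right has_derivative_mult nth)
        then show ?thesis by (simp add: power2_eq_square algebra_simps)
      qed
    qed
    show "?q y = v y" if "y \<in> interior T" for y
      using v[OF subsetD[OF interior_subset that]] by (simp add: vec_eq_iff)
  qed
  have pd: "partial_deriv v i j x = ?D x (axis j 1) $ i" if "x \<in> interior T" for i j x
    unfolding partial_deriv_def jacobian_def matrix_def frechet_derivative_at[OF der[OF that], symmetric] by simp
  have "v differentiable at x" if "x \<in> interior T" for x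
    using der[OF that] by (auto simp: differentiable_def)
  moreover have "partial_deriv v i 1 x = b i + (2 * d i) * x $ 1 + e i * x $ 2" if "x \<in> interior T" for i x
    unfolding pd[OF that] by (simp add: axis_def)
  moreover have "partial_deriv v i 2 x = c i + e i * x $ 1 + (2 * f i) * x $ 2" if "x \<in> interior T" for i x
    unfolding pd[OF that] by (simp add: axis_def)
  ultimately show ?thesis using v
    by - (rule exI[of _ a], rule exI[of _ b], rule exI[of _ c], rule exI[of _ d],
        rule exI[of _ e], rule exI[of _ f], blast)
qed

lemma partial_deriv_lincomb:
  assumes "u differentiable at x" "v differentiable at x"
  shows "partial_deriv (\<lambda>x. \<alpha> *\<^sub>R u x + \<beta> *\<^sub>R v x) i j x = \<alpha> * partial_deriv u i j x + \<beta> * partial_deriv v i j x"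
proof -
  have "((\<lambda>x. \<alpha> *\<^sub>R u x + \<beta> *\<^sub>R v x) has_derivative
      (\<lambda>h. \<alpha> *\<^sub>R frechet_derivative u (at x) h + \<beta> *\<^sub>R frechet_derivative v (at x) h)) (at x)"
    using assms by (intro has_derivative_add has_derivative_scaleR_right) (simp_all flip: frechet_derivative_works)
  note der = frechet_derivative_at[OF this, symmetric]
  have pd: "partial_deriv w i j x = frechet_derivative w (at x) (axis j 1) $ i" for w
    by (simp add: partial_deriv_def jacobian_def matrix_def)
  show ?thesis unfolding pd der by simp
qed

text \<open>The integrands of the forms are only controlled off the sides of the triangles; there they
  are continuous and bounded.\<close>

definition broken_continuous :: "point set set \<Rightarrow> (point \<Rightarrow> real) \<Rightarrow> bool" where
  "broken_continuous \<T> q \<longleftrightarrow>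
     continuous_on (\<Union>(interior ` \<T>)) q \<and> bounded (q ` (\<Union>(interior ` \<T>)))"

lemma broken_continuous_lincomb:
  assumes "broken_continuous \<T> p" "broken_continuous \<T> q"
  shows "broken_continuous \<T> (\<lambda>x. \<alpha> * p x + \<beta> * q x)"
proof -
  obtain B C where "\<forall>y\<in>p ` \<Union>(interior ` \<T>). norm y \<le> B" "\<forall>y\<in>q ` \<Union>(interior ` \<T>). norm y \<le> C"
    using assms unfolding broken_continuous_def bounded_iff by blast
  then have B: "\<bar>p x\<bar> \<le> B" "\<bar>q x\<bar> \<le> C" if "x \<in> \<Union>(interior ` \<T>)" for x
    using that by (auto simp del: UN_iff)
  have "\<bar>\<alpha> * p x + \<beta> * q x\<bar> \<le> \<bar>\<alpha>\<bar> * B + \<bar>\<beta>\<bar> * C" if "x \<in> \<Union>(interior ` \<T>)" for x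
  proof -
    have "\<bar>\<alpha> * p x + \<beta> * q x\<bar> \<le> \<bar>\<alpha>\<bar> * \<bar>p x\<bar> + \<bar>\<beta>\<bar> * \<bar>q x\<bar>"
      using abs_triangle_ineq[of "\<alpha> * p x" "\<beta> * q x"] by (simp add: abs_mult)
    also have "\<dots> \<le> \<bar>\<alpha>\<bar> * B + \<bar>\<beta>\<bar> * C"
      using B[OF that] by (intro add_mono mult_left_mono) auto
    finally show ?thesis .
  qed
  then show ?thesis
    using assms unfolding broken_continuous_def bounded_iff
    by (auto intro!: continuous_intros)
qed

lemma broken_continuous_mult:
  assumes "broken_continuous \<T> p" "broken_continuous \<T> q"
  shows "broken_continuous \<T> (\<lambda>x. p x * q x)"
proof -
  obtain B C where "\<forall>y\<in>p ` \<Union>(interior ` \<T>). norm y \<le> B" "\<forall>y\<in>q ` \<Union>(interior ` \<T>). norm y \<le> C"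
    using assms unfolding broken_continuous_def bounded_iff by blast
  then have B: "\<bar>p x\<bar> \<le> B" "\<bar>q x\<bar> \<le> C" if "x \<in> \<Union>(interior ` \<T>)" for x
    using that by (auto simp del: UN_iff)
  have "\<bar>p x * q x\<bar> \<le> B * C" if "x \<in> \<Union>(interior ` \<T>)" for x
    unfolding abs_mult using B[OF that] by (intro mult_mono) auto
  then show ?thesis
    using assms unfolding broken_continuous_def bounded_iff
    by (auto intro!: continuous_intros)
qed

lemma partial_deriv_broken_continuous:
  assumes v: "v \<in> V_h \<Omega> \<T>" and mesh: "triangular_mesh \<T>"
  shows "broken_continuous \<T> (partial_deriv v i j)"
proof -
  have *: "continuous_on (interior T) (partial_deriv v i j) \<and> bounded (partial_deriv v i j ` interior T)"
    if T: "T \<in> \<T>" for T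
  proof -
    obtain b c d e f where p: "\<forall>x\<in>interior T. v differentiable at x \<and>
      (\<forall>i. partial_deriv v i 1 x = b i + (2 * d i) * x $ 1 + e i * x $ 2) \<and>
      (\<forall>i. partial_deriv v i 2 x = c i + e i * x $ 1 + (2 * f i) * x $ 2)"
      using V_h_local[OF v T] by (elim exE conjE) (rule that)
    obtain k l m where eq: "\<forall>x\<in>interior T. partial_deriv v i j x = k + l * x $ 1 + m * x $ 2"
    proof (cases "j = 1")
      case True then show thesis using p by (intro that[of "b i" "2 * d i" "e i"]) simp
    next
      case False then have "j = 2" using exhaust_2[of j] by simp
      then show thesis using p by (intro that[of "c i" "e i" "2 * f i"]) simp
    qed
    let ?g = "\<lambda>x::point. k + l * x $ 1 + m * x $ 2"
    \<comment> \<open>The derivative is known only on the open triangle; the affine formula for it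
      is bounded on the compact one.\<close>
    have "bounded (?g ` T)"
      using mesh_triangle(2)[OF mesh T]
      by (intro compact_imp_bounded compact_continuous_image continuous_intros)
    then have "bounded (?g ` interior T)"
      by (rule bounded_subset) (use interior_subset in blast)
    moreover have "continuous_on (interior T) ?g" by (intro continuous_intros)
    moreover have "partial_deriv v i j ` interior T = ?g ` interior T"
      by (rule image_cong) (use eq in auto)
    ultimately show ?thesis
      using eq continuous_on_cong[OF refl, of "interior T" "partial_deriv v i j" ?g] by simp
  qed
  have "bounded (\<Union>T\<in>\<T>. partial_deriv v i j ` interior T)"
    using * mesh_finite[OF mesh] by blast
  then have "bounded (partial_deriv v i j ` (\<Union>(interior ` \<T>)))" by (simp add: image_UN)
  moreover have "continuous_on (\<Union>(interior ` \<T>)) (partial_deriv v i j)"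
    by (rule continuous_on_open_Union) (use * in auto)
  ultimately show ?thesis by (simp add: broken_continuous_def)
qed

text \<open>Written with explicit coefficients to match
  \<open>broken_continuous_lincomb\<close>.\<close>

lemma strain_eq: "strain v i j = (\<lambda>x. 1/2 * partial_deriv v i j x + 1/2 * partial_deriv v j i x)"
  by (rule ext) (simp only: strain_def add_divide_distrib times_divide_eq_left mult_1)

lemma divergence_eq: "divergence v = (\<lambda>x. 1 * partial_deriv v 1 1 x + 1 * partial_deriv v 2 2 x)"
  by (rule ext) (simp add: divergence_def sum_2)

section \<open>Integration over the meshed domain and bilinearity of the forms\<close>

locale meshed_domain =
  fixes \<Omega> :: "point set" and \<T> :: "point set set"
  assumes mesh: "triangular_mesh \<T>" and cover: "\<Union>\<T> = closure \<Omega>"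
    and open_domain: "open \<Omega>" and connected_domain: "connected \<Omega>" and bounded_domain: "bounded \<Omega>"
begin

text \<open>Outside the open triangles a point of the domain lies on the frontier of a convex set,
  and such frontiers are null.\<close>

lemma negligible_skeleton: "negligible (\<Omega> - \<Union>(interior ` \<T>))"
proof -
  have "negligible (\<Union>(frontier ` \<T>))"
  proof (rule negligible_Union)
    show "finite (frontier ` \<T>)" using mesh_finite[OF mesh] by simp
    show "negligible F" if "F \<in> frontier ` \<T>" for F
      using that negligible_convex_frontier mesh_triangle(1)[OF mesh] by blast
  qed
  moreover have "\<Omega> - \<Union>(interior ` \<T>) \<subseteq> \<Union>(frontier ` \<T>)"
  proof
    fix x assume x: "x \<in> \<Omega> - \<Union>(interior ` \<T>)"
    then have "x \<in> closure \<Omega>" using closure_subset by blast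
    then obtain T where "T \<in> \<T>" "x \<in> T" unfolding cover[symmetric] by blast
    then have "x \<in> frontier T" using x closure_subset[of T] unfolding frontier_def by blast
    then show "x \<in> \<Union>(frontier ` \<T>)" using \<open>T \<in> \<T>\<close> by blast
  qed
  ultimately show ?thesis by (rule negligible_subset)
qed

lemma broken_continuous_integrable:
  assumes "broken_continuous \<T> q"
  shows "set_integrable lebesgue \<Omega> q"
proof -
  let ?U = "\<Union>(interior ` \<T>)"
  have op: "open (\<Omega> \<inter> ?U)" using open_domain by auto
  obtain B where B: "\<forall>y\<in>q ` ?U. norm y \<le> B"
    using assms unfolding broken_continuous_def bounded_iff by blast
  have meas: "\<Omega> \<inter> ?U \<in> lmeasurable"
    using op bounded_domain by (intro bounded_set_imp_lmeasurable) (auto intro: bounded_Int)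
  have "q absolutely_integrable_on (\<Omega> \<inter> ?U)"
  proof (rule measurable_bounded_by_integrable_imp_absolutely_integrable)
    show "q \<in> borel_measurable (lebesgue_on (\<Omega> \<inter> ?U))"
      using assms meas by (intro continuous_imp_measurable_on_sets_lebesgue)
        (auto simp: broken_continuous_def intro: continuous_on_subset)
    show "(\<lambda>x. B) integrable_on \<Omega> \<inter> ?U" using meas by (rule integrable_on_const)
  qed (use meas B in auto)
  then show ?thesis
    by (rule absolutely_integrable_spike_set)
      (auto intro: negligible_subset[OF negligible_skeleton])
qed

text \<open>The identity for \<open>r\<close> is required only inside the triangles, since on their
  sides the classical derivative of a sum need not be the sum of the derivatives.\<close>

lemma broken_integral_lincomb:
  assumes "broken_continuous \<T> p" "broken_continuous \<T> q"
    and eq: "\<And>x. x \<in> \<Union>(interior ` \<T>) \<Longrightarrow> r x = \<alpha> * p x + \<beta> * q x"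
  shows "(LINT x:\<Omega>|lebesgue. r x) = \<alpha> * (LINT x:\<Omega>|lebesgue. p x) + \<beta> * (LINT x:\<Omega>|lebesgue. q x)"
proof -
  let ?L = "\<lambda>x. \<alpha> * p x + \<beta> * q x"
  have i: "set_integrable lebesgue \<Omega> ?L"
    by (intro broken_continuous_integrable broken_continuous_lincomb assms)
  have r: "set_integrable lebesgue \<Omega> r"
    by (rule absolutely_integrable_spike[OF i negligible_skeleton]) (use eq in auto)
  have "(LINT x:\<Omega>|lebesgue. r x) = integral \<Omega> r"
    by (rule set_lebesgue_integral_eq_integral(2)[OF r])
  also have "\<dots> = integral \<Omega> ?L"
    by (rule integral_spike[OF negligible_skeleton]) (use eq in auto)
  also have "\<dots> = (LINT x:\<Omega>|lebesgue. ?L x)"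
    by (rule set_lebesgue_integral_eq_integral(2)[OF i, symmetric])
  also have "\<dots> = \<alpha> * (LINT x:\<Omega>|lebesgue. p x) + \<beta> * (LINT x:\<Omega>|lebesgue. q x)"
    using broken_continuous_integrable[OF assms(1)] broken_continuous_integrable[OF assms(2)]
    by (simp add: set_integral_add(2) set_integrable_mult_right)
  finally show ?thesis .
qed

lemma V_h_differentiable:
  assumes "v \<in> V_h \<Omega> \<T>" "x \<in> \<Union>(interior ` \<T>)"
  shows "v differentiable at x"
  using assms(2) V_h_local[OF assms(1)] by blast

lemma strain_broken_continuous: "v \<in> V_h \<Omega> \<T> \<Longrightarrow> broken_continuous \<T> (strain v i j)"
  unfolding strain_eq by (intro broken_continuous_lincomb partial_deriv_broken_continuous[OF _ mesh])

lemma divergence_broken_continuous: "v \<in> V_h \<Omega> \<T> \<Longrightarrow> broken_continuous \<T> (divergence v)"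
  unfolding divergence_eq by (intro broken_continuous_lincomb partial_deriv_broken_continuous[OF _ mesh])

lemma Q_h_broken_continuous:
  assumes "q \<in> Q_h \<Omega> \<T>"
  shows "broken_continuous \<T> q"
proof -
  have c: "continuous_on (closure \<Omega>) q" using assms by (simp add: Q_h_def C0_def)
  have sub: "\<Union>(interior ` \<T>) \<subseteq> closure \<Omega>" unfolding cover[symmetric] using interior_subset by blast
  have "bounded (q ` closure \<Omega>)"
    using c bounded_domain by (intro compact_imp_bounded compact_continuous_image) simp_all
  then show ?thesis unfolding broken_continuous_def
    using continuous_on_subset[OF c sub] bounded_subset[OF _ image_mono[OF sub]] by blast
qed

lemma form_a_sym: "form_a \<Omega> \<nu> u v = form_a \<Omega> \<nu> v u"
  by (simp add: form_a_def mult.commute)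

lemma form_a_lincomb_left:
  assumes "u \<in> V_h \<Omega> \<T>" "v \<in> V_h \<Omega> \<T>" "w \<in> V_h \<Omega> \<T>"
  shows "form_a \<Omega> \<nu> (\<lambda>x. \<alpha> *\<^sub>R u x + \<beta> *\<^sub>R v x) w = \<alpha> * form_a \<Omega> \<nu> u w + \<beta> * form_a \<Omega> \<nu> v w"
proof -
  have "(LINT x:\<Omega>|lebesgue. strain (\<lambda>x. \<alpha> *\<^sub>R u x + \<beta> *\<^sub>R v x) i j x * strain w i j x) =
     \<alpha> * (LINT x:\<Omega>|lebesgue. strain u i j x * strain w i j x) + \<beta> * (LINT x:\<Omega>|lebesgue. strain v i j x * strain w i j x)"
    for i j
  proof (rule broken_integral_lincomb)
    show "strain (\<lambda>x. \<alpha> *\<^sub>R u x + \<beta> *\<^sub>R v x) i j x * strain w i j x =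
        \<alpha> * (strain u i j x * strain w i j x) + \<beta> * (strain v i j x * strain w i j x)"
      if "x \<in> \<Union>(interior ` \<T>)" for x
      using V_h_differentiable[OF assms(1) that] V_h_differentiable[OF assms(2) that]
      by (simp add: strain_eq partial_deriv_lincomb field_simps)
  qed (intro broken_continuous_mult strain_broken_continuous assms)+
  then show ?thesis
    by (simp add: form_a_def sum.distrib sum_distrib_left algebra_simps)
qed

lemma form_a_lincomb_right:
  assumes "u \<in> V_h \<Omega> \<T>" "v \<in> V_h \<Omega> \<T>" "w \<in> V_h \<Omega> \<T>"
  shows "form_a \<Omega> \<nu> w (\<lambda>x. \<alpha> *\<^sub>R u x + \<beta> *\<^sub>R v x) = \<alpha> * form_a \<Omega> \<nu> w u + \<beta> * form_a \<Omega> \<nu> w v"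
  using form_a_lincomb_left[OF assms] by (simp add: form_a_sym)

lemma form_b_lincomb:
  assumes "u \<in> V_h \<Omega> \<T>" "v \<in> V_h \<Omega> \<T>" "q \<in> Q_h \<Omega> \<T>"
  shows "form_b \<Omega> (\<lambda>x. \<alpha> *\<^sub>R u x + \<beta> *\<^sub>R v x) q = \<alpha> * form_b \<Omega> u q + \<beta> * form_b \<Omega> v q"
proof -
  have "(LINT x:\<Omega>|lebesgue. divergence (\<lambda>x. \<alpha> *\<^sub>R u x + \<beta> *\<^sub>R v x) x * q x) =
     \<alpha> * (LINT x:\<Omega>|lebesgue. divergence u x * q x) + \<beta> * (LINT x:\<Omega>|lebesgue. divergence v x * q x)"
  proof (rule broken_integral_lincomb)
    show "divergence (\<lambda>x. \<alpha> *\<^sub>R u x + \<beta> *\<^sub>R v x) x * q x =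
        \<alpha> * (divergence u x * q x) + \<beta> * (divergence v x * q x)"
      if "x \<in> \<Union>(interior ` \<T>)" for x
      using V_h_differentiable[OF assms(1) that] V_h_differentiable[OF assms(2) that]
      by (simp add: divergence_eq partial_deriv_lincomb algebra_simps)
  qed (intro broken_continuous_mult divergence_broken_continuous Q_h_broken_continuous assms)+
  then show ?thesis by (simp add: form_b_def)
qed

lemma L2_inner_integrable:
  assumes f: "f \<in> L2_vec \<Omega>" and v: "v \<in> V_h \<Omega> \<T>"
  shows "set_integrable lebesgue \<Omega> (\<lambda>x. f x \<bullet> v x)"
proof -
  have c: "continuous_on (closure \<Omega>) v" using v by (simp add: V_h_def C0_def)
  have "bounded (v ` closure \<Omega>)"
    using c bounded_domain by (intro compact_imp_bounded compact_continuous_image) simp_all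
  then obtain B where B: "\<And>x. x \<in> \<Omega> \<Longrightarrow> norm (v x) \<le> B" "B > 0"
    unfolding bounded_pos using closure_subset by blast
  have \<Omega>: "\<Omega> \<in> sets lebesgue" "\<Omega> \<in> lmeasurable"
    using open_domain bounded_domain by (auto intro: bounded_set_imp_lmeasurable)
  have fm: "f \<in> borel_measurable (lebesgue_on \<Omega>)"
    using f \<Omega> unfolding L2_vec_def set_borel_measurable_def
    by (simp add: borel_measurable_restrict_space_iff)
  have vm: "v \<in> borel_measurable (lebesgue_on \<Omega>)"
    using \<Omega> c closure_subset by (intro continuous_imp_measurable_on_sets_lebesgue) (auto intro: continuous_on_subset)
  have fi: "(\<lambda>x. (norm (f x))\<^sup>2) absolutely_integrable_on \<Omega>"
    using f unfolding L2_vec_def by simp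
  show ?thesis
  proof (rule measurable_bounded_by_integrable_imp_absolutely_integrable)
    show "(\<lambda>x. f x \<bullet> v x) \<in> borel_measurable (lebesgue_on \<Omega>)"
      using fm vm by measurable
    \<comment> \<open>The dominating function trades \<open>norm (f x)\<close> for
      \<open>1 + (norm (f x))\<^sup>2\<close>; the constant is integrable because the domain is
      bounded.\<close>
    show "(\<lambda>x. B * (1 + (norm (f x))\<^sup>2)) integrable_on \<Omega>"
      using fi \<Omega> by (intro integrable_on_mult_right integrable_add integrable_on_const)
        (auto simp: absolutely_integrable_on_def)
    show "norm (f x \<bullet> v x) \<le> B * (1 + (norm (f x))\<^sup>2)" if "x \<in> \<Omega>" for x
    proof -
      have "norm (f x \<bullet> v x) \<le> norm (f x) * norm (v x)" using Cauchy_Schwarz_ineq2 by simp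
      also have "\<dots> \<le> norm (f x) * B" using B that by (intro mult_left_mono) auto
      also have "\<dots> \<le> (1 + (norm (f x))\<^sup>2) * B"
      proof (rule mult_right_mono)
        have "2 * 1 * norm (f x) \<le> 1\<^sup>2 + (norm (f x))\<^sup>2" by (rule sum_squares_bound)
        then show "norm (f x) \<le> 1 + (norm (f x))\<^sup>2"
          using norm_ge_zero[of "f x"] unfolding one_power2 by linarith
      qed (use B in simp)
      finally show ?thesis by (simp add: mult.commute)
    qed
  qed (rule \<Omega>)
qed

lemma L2_inner_lincomb:
  assumes "f \<in> L2_vec \<Omega>" "u \<in> V_h \<Omega> \<T>" "v \<in> V_h \<Omega> \<T>"
  shows "L2_inner \<Omega> f (\<lambda>x. \<alpha> *\<^sub>R u x + \<beta> *\<^sub>R v x) = \<alpha> * L2_inner \<Omega> f u + \<beta> * L2_inner \<Omega> f v"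
  unfolding L2_inner_def
  using L2_inner_integrable[OF assms(1,2)] L2_inner_integrable[OF assms(1,3)]
  by (simp add: inner_add_right set_integral_add(2) set_integrable_mult_right)

lemma form_a_nonneg: "\<nu> > 0 \<Longrightarrow> form_a \<Omega> \<nu> v v \<ge> 0"
  unfolding form_a_def
  by (intro mult_nonneg_nonneg sum_nonneg) (auto simp: set_lebesgue_integral_def indicator_def intro!: integral_nonneg)

text \<open>A vanishing sum of integrals of squares makes each strain component zero almost
  everywhere; inside the triangles it is continuous, so its nonzero set is open and null, hence
  empty.\<close>

lemma strain_eq_0_if_form_a_eq_0:
  assumes v: "v \<in> V_h \<Omega> \<T>" and "\<nu> > 0" "form_a \<Omega> \<nu> v v = 0"
    and x: "x \<in> \<Omega>" "x \<in> \<Union>(interior ` \<T>)"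
  shows "strain v i j x = 0"
proof -
  let ?I = "\<lambda>i j. LINT x:\<Omega>|lebesgue. strain v i j x * strain v i j x"
  have nn: "?I i j \<ge> 0" for i j
    by (auto simp: set_lebesgue_integral_def indicator_def intro!: integral_nonneg)
  have "(\<Sum>i\<in>UNIV. \<Sum>j\<in>UNIV. ?I i j) = 0" using assms(2,3) by (simp add: form_a_def)
  then have "?I i j = 0"
    using nn by (simp add: sum_nonneg_eq_0_iff sum_nonneg)
  moreover have bc: "broken_continuous \<T> (strain v i j)" by (rule strain_broken_continuous[OF v])
  then have "set_integrable lebesgue \<Omega> (\<lambda>x. strain v i j x * strain v i j x)"
    by (intro broken_continuous_integrable broken_continuous_mult)
  ultimately have "AE x in lebesgue. indicator \<Omega> x *\<^sub>R (strain v i j x * strain v i j x) = 0"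
    unfolding set_lebesgue_integral_def set_integrable_def
    by (subst (asm) integral_nonneg_eq_0_iff_AE) (auto simp: indicator_def)
  then obtain N where N: "N \<in> null_sets lebesgue"
      "{x. \<not> indicator \<Omega> x *\<^sub>R (strain v i j x * strain v i j x) = 0} \<subseteq> N"
    by (auto simp: eventually_ae_filter)
  let ?W = "(\<Omega> \<inter> \<Union>(interior ` \<T>)) \<inter> strain v i j -` (- {0})"
  have "?W \<subseteq> N" using N(2) by (auto simp: indicator_def)
  then have "negligible ?W" using N(1) negligible_iff_null_sets negligible_subset by blast
  moreover have "open ?W"
    using bc open_domain by (intro continuous_open_preimage)
      (auto simp: broken_continuous_def intro: continuous_on_subset)
  ultimately have "?W = {}" using open_not_negligible by blast
  then show ?thesis using x by blast
qed

lemma interior_triangle_nonempty: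
  assumes "T \<in> \<T>"
  shows "interior T \<noteq> {}"
proof -
  have "aff_dim T = 2" using aff_dim_simplex[OF mesh_simplex[OF mesh assms]] .
  then have "affine hull T = UNIV" "T \<noteq> {}" using aff_dim_eq_full[of T] by auto
  then show ?thesis
    using rel_interior_eq_empty[OF mesh_triangle(1)[OF mesh assms]] rel_interior_interior by metis
qed

text \<open>The interior of a triangle is so far only known to lie in
  \<open>closure \<Omega>\<close>; the open set available for the strain argument is its
  intersection with \<Omega>.\<close>

lemma open_interior_Int_domain:
  assumes "T \<in> \<T>"
  shows "open (interior T \<inter> \<Omega>)" "interior T \<inter> \<Omega> \<noteq> {}"
proof -
  have "interior T \<subseteq> closure \<Omega>" using assms cover interior_subset by blast
  then have "interior T \<inter> closure \<Omega> \<noteq> {}" using interior_triangle_nonempty[OF assms] by blast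
  then show "interior T \<inter> \<Omega> \<noteq> {}" using open_Int_closure_eq_empty[OF open_interior] by blast
qed (use open_domain in auto)

section \<open>Infinitesimal rigid motions of the plane, the kernel of the strain\<close>

definition rigid_on :: "(point \<Rightarrow> point) \<Rightarrow> point set \<Rightarrow> point \<Rightarrow> real \<Rightarrow> bool" where
  "rigid_on v S a k \<longleftrightarrow> (\<forall>x\<in>S. v x $ 1 = a $ 1 + k * x $ 2 \<and> v x $ 2 = a $ 2 - k * x $ 1)"

text \<open>Subtracting the equations at the two points leaves \<open>k - l\<close> times the
  nonzero vector between them.\<close>

lemma rigid_on_unique:
  assumes "rigid_on v S a k" "rigid_on v S b l" "x \<in> S" "y \<in> S" "x \<noteq> y"
  shows "a = b" "k = l"
proof -
  have 1: "a $ 1 + k * x $ 2 = b $ 1 + l * x $ 2" "a $ 2 - k * x $ 1 = b $ 2 - l * x $ 1"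
    using assms by (auto simp: rigid_on_def)
  have 2: "a $ 1 + k * y $ 2 = b $ 1 + l * y $ 2" "a $ 2 - k * y $ 1 = b $ 2 - l * y $ 1"
    using assms by (auto simp: rigid_on_def)
  have "(k - l) * (x $ 2 - y $ 2) = 0" "(k - l) * (x $ 1 - y $ 1) = 0"
    using 1 2 by (simp_all add: algebra_simps)
  moreover have "x $ 1 \<noteq> y $ 1 \<or> x $ 2 \<noteq> y $ 2" using assms(5) by (auto simp: vec_eq_iff forall_2)
  ultimately show "k = l" by auto
  then show "a = b" using 1 by (auto simp: vec_eq_iff forall_2)
qed

text \<open>The strain components are affine on the triangle and vanish on an open set, so their
  coefficients vanish: every quadratic coefficient drops out and the linear part becomes
  skew.\<close>

lemma rigid_on_triangle:
  assumes v: "v \<in> V_h \<Omega> \<T>" and "\<nu> > 0" "form_a \<Omega> \<nu> v v = 0" and T: "T \<in> \<T>"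
  shows "\<exists>a k. rigid_on v T a k"
proof -
  obtain a b c d e f where
    val: "\<forall>x\<in>T. \<forall>i. v x $ i = a i + b i * x $ 1 + c i * x $ 2 + d i * (x $ 1)\<^sup>2 + e i * (x $ 1 * x $ 2) + f i * (x $ 2)\<^sup>2"
    and p: "\<forall>x\<in>interior T. v differentiable at x \<and>
      (\<forall>i. partial_deriv v i 1 x = b i + (2 * d i) * x $ 1 + e i * x $ 2) \<and>
      (\<forall>i. partial_deriv v i 2 x = c i + e i * x $ 1 + (2 * f i) * x $ 2)"
    using V_h_local[OF v T] by (elim exE conjE) (rule that)
  note op = open_interior_Int_domain[OF T]
  have s: "strain v i j x = 0" if "x \<in> interior T \<inter> \<Omega>" for i j x
    by (rule strain_eq_0_if_form_a_eq_0[OF v assms(2,3)]) (use that T in auto)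
  have 1: "b 1 + (2 * d 1) * x $ 1 + e 1 * x $ 2 = 0"
     and 2: "c 2 + e 2 * x $ 1 + (2 * f 2) * x $ 2 = 0"
     and 3: "(c 1 + b 2) + (e 1 + 2 * d 2) * x $ 1 + (2 * f 1 + e 2) * x $ 2 = 0"
     if x: "x \<in> interior T \<inter> \<Omega>" for x
    using s[OF x, of 1 1] s[OF x, of 2 2] s[OF x, of 1 2] p x
    by (simp_all add: strain_def algebra_simps)
  have z1: "b 1 = 0" "d 1 = 0" "e 1 = 0" using affine_eq_0_on_open[OF op 1] by simp_all
  have z2: "c 2 = 0" "e 2 = 0" "f 2 = 0" using affine_eq_0_on_open[OF op 2] by simp_all
  have z3: "c 1 + b 2 = 0" "e 1 + 2 * d 2 = 0" "2 * f 1 + e 2 = 0"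
    using affine_eq_0_on_open[OF op 3] by blast+
  have z4: "b 2 = - c 1" "d 2 = 0" "f 1 = 0" using z1 z2 z3 by linarith+
  have "v x $ 1 = a 1 + c 1 * x $ 2" "v x $ 2 = a 2 - c 1 * x $ 1" if "x \<in> T" for x
    using bspec[OF val that, THEN spec[of _ 1]] bspec[OF val that, THEN spec[of _ 2]]
    unfolding z1 z2 z4 by simp_all
  then have "rigid_on v T (vector [a 1, a 2]) (c 1)"
    unfolding rigid_on_def vector_2 by blast
  then show ?thesis by blast
qed

text \<open>Deleting the finitely many vertices leaves \<open>\<Omega>\<close> connected, and two triangles that share a
  point which is not a vertex share a whole side, on which a rigid motion is determined.\<close>

lemma rigid_on_domain:
  assumes v: "v \<in> V_h \<Omega> \<T>" and "\<nu> > 0" "form_a \<Omega> \<nu> v v = 0"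
  shows "\<exists>a k. rigid_on v (closure \<Omega>) a k"
proof (cases "\<T> = {}")
  case True
  then show ?thesis unfolding cover[symmetric] by (simp add: rigid_on_def)
next
  case False
  then obtain T0 where T0: "T0 \<in> \<T>" by blast
  obtain a k where ak: "rigid_on v T0 a k" using rigid_on_triangle[OF assms T0] by blast
  let ?X = "\<Omega> - mesh_vertices \<T>"
  let ?A = "{T \<in> \<T>. rigid_on v T a k}" and ?B = "{T \<in> \<T>. \<not> rigid_on v T a k}"
  have fin: "finite (mesh_vertices \<T>)" by (rule finite_mesh_vertices[OF mesh])
  have conn: "connected ?X"
    using fin open_domain connected_domain by (intro connected_open_diff_countable) (auto intro: countable_finite)
  have meets: "T \<inter> ?X \<noteq> {}" if "T \<in> \<T>" for T
  proof -
    have "infinite (interior T \<inter> \<Omega>)"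
      using open_interior_Int_domain[OF that] finite_imp_not_open by blast
    then have "interior T \<inter> \<Omega> - mesh_vertices \<T> \<noteq> {}" using fin by (metis Diff_infinite_finite finite.emptyI)
    then show ?thesis using interior_subset by blast
  qed
  have "?B = {}"
  proof (rule ccontr)
    assume "?B \<noteq> {}"
    then have "\<Union>?A \<inter> ?X \<noteq> {}" "\<Union>?B \<inter> ?X \<noteq> {}" using meets T0 ak by blast+
    moreover have "closed (\<Union>?A)" "closed (\<Union>?B)"
      using mesh_finite[OF mesh] mesh_triangle(3)[OF mesh] by (auto intro!: closed_Union)
    moreover have "?X \<subseteq> \<Union>?A \<union> \<Union>?B" using cover closure_subset[of \<Omega>] by blast
    \<comment> \<open>Two closed sets that cover the connected \<open>?X\<close> and both meet it
      share a point of \<open>?X\<close>, which is not a vertex because the vertices were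
      removed.\<close>
    ultimately have "\<Union>?A \<inter> \<Union>?B \<inter> ?X \<noteq> {}" using connected_closedD[OF conn] by blast
    then obtain x T1 T2 where x: "x \<notin> mesh_vertices \<T>" "x \<in> T1" "x \<in> T2" "T1 \<in> \<T>" "T2 \<in> \<T>"
      "rigid_on v T1 a k" "\<not> rigid_on v T2 a k" by blast
    have "T1 \<inter> T2 \<noteq> {x}"
    proof
      assume "T1 \<inter> T2 = {x}"
      then have "x extreme_point_of T1" using mesh_face[OF mesh x(4,5)] by (simp add: face_of_singleton)
      then show False using x by (auto simp: mesh_vertices_def)
    qed
    then obtain y where y: "y \<in> T1" "y \<in> T2" "y \<noteq> x" using x by blast
    obtain b l where bl: "rigid_on v T2 b l" using rigid_on_triangle[OF assms x(5)] by blast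
    have "rigid_on v (T1 \<inter> T2) a k" "rigid_on v (T1 \<inter> T2) b l"
      using bl x by (auto simp: rigid_on_def)
    from rigid_on_unique[OF this, of x y] x y bl show False by auto
  qed
  then have "rigid_on v (\<Union>\<T>) a k" by (auto simp: rigid_on_def)
  then show ?thesis unfolding cover by blast
qed

text \<open>A nonzero rigid motion has at most one zero; outside \<open>closure \<Omega>\<close> the
  representative is zero by convention.\<close>

lemma form_a_eq_0_imp_eq_0:
  assumes v: "v \<in> V_h \<Omega> \<T>" and "\<nu> > 0" "form_a \<Omega> \<nu> v v = 0"
    and zeros: "A \<in> closure \<Omega>" "B \<in> closure \<Omega>" "A \<noteq> B" "v A = 0" "v B = 0"
  shows "v = (\<lambda>x. 0)"
proof
  fix x
  obtain a k where ak: "rigid_on v (closure \<Omega>) a k" using rigid_on_domain[OF assms(1-3)] by blast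
  then have "rigid_on v {A, B} a k" "rigid_on v {A, B} 0 0" using zeros by (auto simp: rigid_on_def)
  from rigid_on_unique[OF this, of A B] zeros have "a = 0" "k = 0" by auto
  then show "v x = 0"
    using ak v by (cases "x \<in> closure \<Omega>") (auto simp: rigid_on_def vec_eq_iff forall_2 V_h_def C0_def)
qed

end

subsection \<open>Geometry of the side carrying the friction condition\<close>

text \<open>With at least three vertices, three consecutive indices are distinct modulo the length,
  so the endpoint sets of two consecutive sides have one element in common.\<close>

lemma simple_polygon_sides_only_meet_at_vertex:
  assumes P: "simple_polygon vs" and j: "j < length vs"
  defines "k \<equiv> Suc j mod length vs"
  shows "polygon_side vs j \<inter> polygon_side vs k = {vs ! k}"
    "vs ! j \<noteq> vs ! k" "vs ! k \<noteq> vs ! (Suc k mod length vs)"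
proof -
  let ?N = "length vs"
  have N: "3 \<le> ?N" "distinct vs" using P by (auto simp: simple_polygon_def)
  have k: "k < ?N" "k \<noteq> j" and l: "Suc k mod ?N < ?N" "Suc k mod ?N \<noteq> k" "Suc k mod ?N \<noteq> j"
    using j N(1) by (auto simp: k_def mod_Suc)
  have "polygon_side vs j \<inter> polygon_side vs k = {vs ! j, vs ! k} \<inter> {vs ! k, vs ! (Suc k mod ?N)}"
    using P j k unfolding simple_polygon_def k_def by metis
  then show "polygon_side vs j \<inter> polygon_side vs k = {vs ! k}"
    using N(2) j k l by (auto simp: nth_eq_iff_index_eq)
  show "vs ! j \<noteq> vs ! k" "vs ! k \<noteq> vs ! (Suc k mod ?N)"
    using N(2) j k l by (auto simp: nth_eq_iff_index_eq)
qed

lemma in_closure_segment_diff: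
  fixes a b :: point
  assumes "a \<noteq> b" "closed_segment a b \<inter> S \<subseteq> {a}"
  shows "a \<in> closure (closed_segment a b - S)"
proof -
  have "open_segment a b \<subseteq> closed_segment a b - S"
    using assms by (auto simp: open_segment_def)
  moreover have "a \<in> closure (open_segment a b)" using assms(1) by (simp add: closure_open_segment)
  ultimately show ?thesis using closure_mono by blast
qed

text \<open>At each endpoint another side of the polygon starts and meets the given one only there,
  so the endpoint is a limit of polygon points off the given side.\<close>

lemma polygon_side_endpoints_in_closure:
  assumes P: "simple_polygon vs" and i: "i < length vs" and x: "x \<in> {vs ! i, vs ! (Suc i mod length vs)}"
  shows "x \<in> closure (polygon_path vs - polygon_side vs i)"
proof -
  let ?N = "length vs"
  have N: "?N > 0" using i by linarith
  have "\<exists>a\<in>{..<?N}. \<exists>y. y \<noteq> x \<and> polygon_side vs a = closed_segment x y \<and> polygon_side vs a \<inter> polygon_side vs i \<subseteq> {x}"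
  proof (cases "x = vs ! (Suc i mod ?N)")
    case True
    let ?k = "Suc i mod ?N"
    show ?thesis
    proof (intro bexI exI conjI)
      show "?k \<in> {..<?N}" using N by simp
      show "vs ! (Suc ?k mod ?N) \<noteq> x" using simple_polygon_sides_only_meet_at_vertex(3)[OF P i] True by auto
      show "polygon_side vs ?k = closed_segment x (vs ! (Suc ?k mod ?N))"
        using True by (simp add: polygon_side_def)
      show "polygon_side vs ?k \<inter> polygon_side vs i \<subseteq> {x}"
        using simple_polygon_sides_only_meet_at_vertex(1)[OF P i] True by auto
    qed
  next
    case False
    then have xi: "x = vs ! i" using x by blast
    \<comment> \<open>The predecessor of \<open>i\<close> in the cyclic order; for index 0 it wraps
      around to \<open>?N - 1\<close>.\<close>
    obtain j where j: "j < ?N" "Suc j mod ?N = i"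
    proof (cases i)
      case 0 then show thesis using N by (intro that[of "?N - 1"]) auto
    next
      case (Suc l) then show thesis using i by (intro that[of l]) auto
    qed
    show ?thesis
    proof (intro bexI exI conjI)
      show "j \<in> {..<?N}" using j by simp
      show "vs ! j \<noteq> x" using simple_polygon_sides_only_meet_at_vertex(2)[OF P j(1)] j xi by auto
      show "polygon_side vs j = closed_segment x (vs ! j)"
        using j xi by (simp add: polygon_side_def closed_segment_commute)
      show "polygon_side vs j \<inter> polygon_side vs i \<subseteq> {x}"
        using simple_polygon_sides_only_meet_at_vertex(1)[OF P j(1)] j xi by auto
    qed
  qed
  then obtain a y where a: "a < ?N" "y \<noteq> x" "polygon_side vs a = closed_segment x y"
    "polygon_side vs a \<inter> polygon_side vs i \<subseteq> {x}" by blast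
  have "x \<in> closure (closed_segment x y - polygon_side vs i)"
    using in_closure_segment_diff a by metis
  moreover have "closed_segment x y - polygon_side vs i \<subseteq> polygon_path vs - polygon_side vs i"
    using a by (auto simp: polygon_path_def)
  ultimately show ?thesis using closure_mono by blast
qed

text \<open>A discrete intermediate value argument: either \<open>t\<close> is at most the left end
  of the last interval, or it falls in that interval.\<close>

lemma covering_interval:
  fixes s :: "nat \<Rightarrow> real"
  assumes "m \<ge> 1" "s 1 \<le> t" "t \<le> s (m + 1)"
  shows "\<exists>i\<in>{1..m}. s i \<le> t \<and> t \<le> s (i + 1)"
  using assms
proof (induction m rule: nat_induct_at_least)
  case base
  then show ?case by (intro bexI[of _ 1]) auto
next
  case (Suc m)
  show ?case
  proof (cases "t \<le> s (m + 1)")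
    case True
    then show ?thesis using Suc.IH[OF Suc.prems(1)] by auto
  next
    case False
    then show ?thesis using Suc by (intro bexI[of _ "Suc m"]) auto
  qed
qed

locale discretised_domain =
  fixes P :: "point list set" and \<Omega> \<Gamma>0 \<Gamma>1 :: "point set" and A B n :: point
    and \<T> :: "point set set" and h :: real and m :: nat and M :: "nat \<Rightarrow> point"
  assumes domain: "polygonal_domain P \<Omega>"
    and boundary: "boundary_partition P \<Omega> \<Gamma>0 \<Gamma>1 A B"
    and normal: "outer_unit_normal \<Omega> A B n"
    and admissible: "admissible_mesh \<Omega> h \<T>"
    and nodes: "side_vertices \<T> A B m M"
begin

sublocale meshed_domain \<Omega> \<T>
  using domain admissible
  by unfold_locales (auto simp: polygonal_domain_def admissible_mesh_def triangular_mesh_def)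

lemma side: "\<Gamma>1 = open_segment A B" "A \<noteq> B" "closure \<Gamma>1 = closed_segment A B"
proof -
  show 1: "\<Gamma>1 = open_segment A B" using boundary by (simp add: boundary_partition_def)
  show 2: "A \<noteq> B" using boundary by (auto simp: boundary_partition_def)
  show "closure \<Gamma>1 = closed_segment A B" using 1 2 by (simp add: closure_open_segment)
qed

lemma boundary_parts:
  "openin (top_of_set (frontier \<Omega>)) \<Gamma>0" "openin (top_of_set (frontier \<Omega>)) \<Gamma>1"
  "\<Gamma>0 \<inter> \<Gamma>1 = {}" "frontier \<Omega> = closure \<Gamma>0 \<union> closure \<Gamma>1"
  using boundary unfolding boundary_partition_def by - (elim conjE, assumption)+

lemma boundary_parts_subset: "\<Gamma>0 \<subseteq> frontier \<Omega>" "\<Gamma>1 \<subseteq> frontier \<Omega>"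
  using boundary_parts by (blast dest: openin_imp_subset)+

lemma Gamma1_eq_open_Int: obtains U where "open U" "\<Gamma>1 = frontier \<Omega> \<inter> U"
  using boundary_parts(2) unfolding openin_open by blast

text \<open>The polygon without the friction side lies in \<open>closure \<Gamma>0\<close> and
  accumulates at both endpoints. This is why the members of \<open>V_tau_h\<close> vanish
  there.\<close>

lemma endpoints_in_closure_Gamma0: "A \<in> closure \<Gamma>0" "B \<in> closure \<Gamma>0"
proof -
  obtain vs i where vs: "vs \<in> P" "i < length vs" "{A, B} = {vs ! i, vs ! (Suc i mod length vs)}"
    using boundary by (auto simp: boundary_partition_def)
  have simple: "simple_polygon vs" using domain vs by (simp add: polygonal_domain_def)
  have "polygon_side vs i = closed_segment A B"
    using vs(3) by (auto simp: polygon_side_def doubleton_eq_iff closed_segment_commute)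
  then have "polygon_path vs - polygon_side vs i \<subseteq> closure \<Gamma>0"
    using domain vs(1) boundary_parts(4) side(3) unfolding polygonal_domain_def by blast
  then have "closure (polygon_path vs - polygon_side vs i) \<subseteq> closure \<Gamma>0"
    by (rule closure_minimal) simp
  then show "A \<in> closure \<Gamma>0" "B \<in> closure \<Gamma>0"
    using polygon_side_endpoints_in_closure[OF simple vs(2)] vs(3) by blast+
qed

text \<open>Relative openness isolates \<open>\<Gamma>1\<close> from \<open>\<Gamma>0\<close> by an
  open set, hence also from its closure. Basis functions of nodes on \<open>\<Gamma>1\<close>
  therefore respect the condition at the nodes of \<open>closure \<Gamma>0\<close>.\<close>

lemma Gamma1_Int_closure_Gamma0: "\<Gamma>1 \<inter> closure \<Gamma>0 = {}"
proof -
  obtain U where "open U" "\<Gamma>1 = frontier \<Omega> \<inter> U"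
    by (rule Gamma1_eq_open_Int)
  moreover have "\<Gamma>0 \<subseteq> frontier \<Omega>" "\<Gamma>0 \<inter> \<Gamma>1 = {}"
    by (rule boundary_parts_subset boundary_parts)+
  ultimately have "U \<inter> \<Gamma>0 = {}" by blast
  then have "U \<inter> closure \<Gamma>0 = {}" using \<open>open U\<close> open_Int_closure_eq_empty by blast
  then show ?thesis using \<open>\<Gamma>1 = frontier \<Omega> \<inter> U\<close> by blast
qed

lemma normal_orthogonal: "n \<bullet> A = n \<bullet> B"
  using normal by (simp add: outer_unit_normal_def inner_diff_right)

lemma normal_segment: "x \<in> closed_segment A B \<Longrightarrow> n \<bullet> x = n \<bullet> A"
  by (auto simp: in_segment inner_simps normal_orthogonal[symmetric] left_diff_distrib)

text \<open>Near a point of \<open>\<Gamma>\<^sub>1\<close> the frontier is contained in \<open>\<Gamma>\<^sub>1\<close>, so the half ball on the outer side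
  does not meet the frontier; it is connected and has a point outside \<open>closure \<Omega>\<close>.\<close>

lemma outer_half_ball:
  assumes x: "x \<in> \<Gamma>1"
  obtains r where "r > 0" "\<And>y. y \<in> ball x r \<Longrightarrow> n \<bullet> y > n \<bullet> x \<Longrightarrow> y \<notin> closure \<Omega>"
proof -
  obtain U where U: "open U" "\<Gamma>1 = frontier \<Omega> \<inter> U"
    by (rule Gamma1_eq_open_Int)
  then obtain r where r: "r > 0" "ball x r \<subseteq> U" using x open_contains_ball by blast
  let ?H = "ball x r \<inter> {y. n \<bullet> y > n \<bullet> x}"
  have nx: "n \<bullet> y = n \<bullet> x" if "y \<in> \<Gamma>1" for y
    using normal_segment that x side(1) open_closed_segment by metis
  have H_frontier: "?H \<inter> frontier \<Omega> = {}"
    using U(2) r(2) nx by fastforce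
  have "connected ?H"
    by (intro convex_connected convex_Int convex_ball convex_halfspace_gt)
  moreover obtain t where t: "x + t *\<^sub>R n \<in> ?H" "x + t *\<^sub>R n \<notin> \<Omega>"
  proof -
    obtain \<epsilon> where e: "\<epsilon> > 0" "\<And>t. 0 < t \<Longrightarrow> t < \<epsilon> \<Longrightarrow> x + t *\<^sub>R n \<notin> closure \<Omega>"
      using normal x side(1) unfolding outer_unit_normal_def by blast
    have nn: "norm n = 1" "n \<bullet> n = 1" using normal by (auto simp: outer_unit_normal_def norm_eq_1)
    let ?t = "min \<epsilon> r / 2"
    have "0 < ?t" "?t < \<epsilon>" "?t < r" using e r by auto
    then show thesis
      using e(2)[of ?t] nn closure_subset[of \<Omega>]
      by (intro that[of ?t]) (auto simp: dist_norm inner_add_right)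
  qed
  ultimately have "?H \<inter> \<Omega> = {}"
    using connected_Int_frontier[of ?H \<Omega>] H_frontier by blast
  then have "?H \<inter> closure \<Omega> = {}"
    using open_domain H_frontier by (auto simp: frontier_def interior_open)
  then show thesis using r(1) that[of r] by blast
qed

text \<open>By convexity, a point of \<open>T\<close> beyond the line would be joined to
  \<open>x\<close> by a segment in \<open>T\<close> that runs through the outer half ball around
  \<open>x\<close>.\<close>

lemma triangle_halfplane:
  assumes T: "T \<in> \<T>" and x: "x \<in> T" "x \<in> \<Gamma>1" and y: "y \<in> T"
  shows "n \<bullet> y \<le> n \<bullet> A"
proof (rule ccontr)
  assume "\<not> n \<bullet> y \<le> n \<bullet> A"
  then have gt: "n \<bullet> y > n \<bullet> x"
    using normal_segment[of x] x side(1) open_closed_segment by (metis not_le)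
  obtain r where r: "r > 0" "\<And>y. y \<in> ball x r \<Longrightarrow> n \<bullet> y > n \<bullet> x \<Longrightarrow> y \<notin> closure \<Omega>"
    using outer_half_ball[OF x(2)] by metis
  have ne: "norm (y - x) > 0" using gt by auto
  \<comment> \<open>The factor 2 keeps the point strictly inside the ball of radius
    \<open>r\<close>.\<close>
  define t where "t = min 1 (r / (2 * norm (y - x)))"
  have t: "0 < t" "t \<le> 1" "t * norm (y - x) < r"
  proof -
    show "0 < t" "t \<le> 1" using ne r by (auto simp: t_def)
    have "t * norm (y - x) \<le> r / (2 * norm (y - x)) * norm (y - x)"
      using ne by (intro mult_right_mono) (auto simp: t_def)
    also have "\<dots> < r" using ne r by simp
    finally show "t * norm (y - x) < r" .
  qed
  let ?z = "x + t *\<^sub>R (y - x)"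
  have "?z = (1 - t) *\<^sub>R x + t *\<^sub>R y" by (simp add: algebra_simps)
  then have "?z \<in> T"
    using mesh_triangle(1)[OF mesh T] x(1) y t by (simp add: convexD_alt)
  then have "?z \<in> closure \<Omega>" using T cover by blast
  moreover have "?z \<in> ball x r" using t by (simp add: dist_norm)
  moreover have "n \<bullet> ?z > n \<bullet> x" using gt t(1) by (simp add: inner_simps)
  ultimately show False using r(2) by blast
qed

section \<open>The side parametrised by the unit interval\<close>

definition side_point :: "real \<Rightarrow> point" where
  "side_point t = A + t *\<^sub>R (B - A)"

lemma side_point_inj: "side_point s = side_point t \<longleftrightarrow> s = t"
  using side(2) by (simp add: side_point_def)

lemma side_point_combination: "(1 - u) *\<^sub>R side_point s + u *\<^sub>R side_point t = side_point ((1 - u) * s + u * t)"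
  by (simp add: side_point_def algebra_simps)

lemma in_closed_side_segment:
  assumes "s \<le> t"
  shows "x \<in> closed_segment (side_point s) (side_point t) \<longleftrightarrow> (\<exists>r. s \<le> r \<and> r \<le> t \<and> x = side_point r)"
proof
  assume "x \<in> closed_segment (side_point s) (side_point t)"
  then obtain u where u: "0 \<le> u" "u \<le> 1" "x = side_point ((1 - u) * s + u * t)"
    by (auto simp: in_segment side_point_combination)
  have "0 \<le> u * (t - s)" "u * (t - s) \<le> 1 * (t - s)"
    using u assms mult_right_mono[of u 1 "t - s"] by auto
  then show "\<exists>r. s \<le> r \<and> r \<le> t \<and> x = side_point r"
    using u by (intro exI[of _ "(1 - u) * s + u * t"]) (auto simp: algebra_simps)
next
  assume "\<exists>r. s \<le> r \<and> r \<le> t \<and> x = side_point r"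
  then obtain r where r: "s \<le> r" "r \<le> t" "x = side_point r" by blast
  show "x \<in> closed_segment (side_point s) (side_point t)"
  proof (cases "s = t")
    case True then show ?thesis using r by simp
  next
    case False
    then have "t - s > 0" using assms by simp
    define u where "u = (r - s) / (t - s)"
    have u: "0 \<le> u" "u \<le> 1" "u * (t - s) = r - s"
      using r \<open>t - s > 0\<close> by (auto simp: u_def)
    then have "(1 - u) * s + u * t = r" by (simp add: algebra_simps)
    then show ?thesis unfolding in_segment r(3)
      by (intro exI[of _ u]) (simp add: u side_point_combination)
  qed
qed

lemma in_open_side_segment:
  assumes "s < t"
  shows "x \<in> open_segment (side_point s) (side_point t) \<longleftrightarrow> (\<exists>r. s < r \<and> r < t \<and> x = side_point r)"
  using in_closed_side_segment[of s t x] assms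
  by (auto simp: open_segment_def side_point_inj order.strict_iff_order)

lemma side_point_0_1: "side_point 0 = A" "side_point 1 = B"
  by (simp_all add: side_point_def)

lemma in_side: "x \<in> closed_segment A B \<longleftrightarrow> (\<exists>r. 0 \<le> r \<and> r \<le> 1 \<and> x = side_point r)"
  using in_closed_side_segment[of 0 1 x] by (simp add: side_point_0_1)

lemma in_Gamma1: "x \<in> \<Gamma>1 \<longleftrightarrow> (\<exists>r. 0 < r \<and> r < 1 \<and> x = side_point r)"
  using in_open_side_segment[of 0 1 x] by (simp add: side_point_0_1 side(1))

definition side_param :: "nat \<Rightarrow> real" where
  "side_param i = (THE r. side_point r = M i)"

lemma side_param:
  assumes "1 \<le> i" "i \<le> m + 1"
  shows "M i = side_point (side_param i)" "0 \<le> side_param i" "side_param i \<le> 1"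
proof -
  have "M i \<in> closed_segment A B" using nodes assms unfolding side_vertices_def by auto
  then obtain r where r: "0 \<le> r" "r \<le> 1" "M i = side_point r" using in_side by blast
  then have "side_param i = r" unfolding side_param_def by (intro the_equality) (simp_all add: side_point_inj)
  then show "M i = side_point (side_param i)" "0 \<le> side_param i" "side_param i \<le> 1" using r by auto
qed

lemma side_param_less:
  assumes ij: "1 \<le> i" "i < j" "j \<le> m + 1"
  shows "side_param i < side_param j"
proof -
  have d: "dist A (side_point r) = r * norm (B - A)" if "0 \<le> r" for r
    using that by (simp add: side_point_def dist_norm)
  have "dist A (M i) < dist A (M j)" using nodes ij unfolding side_vertices_def by blast
  then have "side_param i * norm (B - A) < side_param j * norm (B - A)"
    using side_param[of i] side_param[of j] ij d by auto
  then show ?thesis by (simp add: mult_less_cancel_right_disj)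
qed

lemma mesh_vertex_side_param:
  assumes "side_point r \<in> mesh_vertices \<T>" "0 \<le> r" "r \<le> 1"
  obtains i where "1 \<le> i" "i \<le> m + 1" "r = side_param i"
proof -
  have "side_point r \<in> M ` {1..m + 1}" using nodes assms in_side unfolding side_vertices_def by blast
  then obtain i where "1 \<le> i" "i \<le> m + 1" "side_point r = M i" by auto
  then show thesis using that[of i] side_param(1)[of i] side_point_inj by simp
qed

lemma m_pos: "m \<ge> 1"
proof (rule ccontr)
  assume "\<not> m \<ge> 1"
  then have "m = 0" by simp
  then show False using nodes side(2) unfolding side_vertices_def by auto
qed

lemma side_param_ends: "side_param 1 = 0" "side_param (m + 1) = 1"
proof -
  have "side_point (side_param 1) = side_point 0" "side_point (side_param (m + 1)) = side_point 1"
    using side_param(1)[of 1] side_param(1)[of "m + 1"] nodes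
    unfolding side_vertices_def side_point_0_1 by simp_all
  then show "side_param 1 = 0" "side_param (m + 1) = 1" by (simp_all add: side_point_inj)
qed

lemma side_param_interval:
  assumes "i \<in> {1..m}"
  shows "0 \<le> side_param i" "side_param i < side_param (i + 1)" "side_param (i + 1) \<le> 1"
    "M i = side_point (side_param i)" "M (i + 1) = side_point (side_param (i + 1))"
  using assms side_param[of i] side_param[of "i + 1"] side_param_less[of i "i + 1"] by auto

text \<open>The triangle at an interior point of \<open>[M\<^sub>i, M\<^sub>i\<^sub>+\<^sub>1]\<close> lies on one side of the line \<open>AB\<close>, hence meets
  it in one of its sides, whose endpoints are consecutive vertices.\<close>

lemma side_interval_is_edge:
  assumes i: "i \<in> {1..m}"
  shows "\<exists>T\<in>\<T>. closed_segment (M i) (M (i + 1)) edge_of T"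
proof -
  let ?s = side_param
  note s01 = side_param_interval[OF i]
  have Mv: "M k \<in> mesh_vertices \<T>" if "1 \<le> k" "k \<le> m + 1" for k
    using nodes that unfolding side_vertices_def by auto
  have between: "k = i \<or> k = i + 1" if "1 \<le> k" "k \<le> m + 1" "?s i \<le> ?s k" "?s k \<le> ?s (i + 1)" for k
  proof (rule ccontr)
    assume "\<not> ?thesis"
    then have "k < i \<or> i + 1 < k" by auto
    then show False using side_param_less[of k i] side_param_less[of "i + 1" k] that i by auto
  qed
  define r where "r = (?s i + ?s (i + 1)) / 2"
  have r: "?s i < r" "r < ?s (i + 1)" using s01 by (auto simp: r_def)
  have notv: "side_point r \<notin> mesh_vertices \<T>"
  proof
    assume "side_point r \<in> mesh_vertices \<T>"
    then obtain k where k: "1 \<le> k" "k \<le> m + 1" "r = ?s k"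
      using mesh_vertex_side_param[of r] r s01 by auto
    then have "k = i \<or> k = i + 1" using between[of k] r by auto
    then show False using k r by auto
  qed
  have rG: "side_point r \<in> \<Gamma>1" unfolding in_Gamma1 using r s01(1-3) by (intro exI[of _ r]) simp
  then have "side_point r \<in> frontier \<Omega>"
    using boundary_parts_subset by blast
  then have "side_point r \<in> closure \<Omega>" by (auto simp: frontier_def)
  then obtain T where T: "T \<in> \<T>" "side_point r \<in> T" unfolding cover[symmetric] by blast
  note tri = mesh_triangle[OF mesh T(1)]
  \<comment> \<open>The parameters at which the line through \<open>A\<close> and \<open>B\<close>
    runs inside \<open>T\<close>: a compact convex set of reals, hence an interval.\<close>
  define J where "J = {t. side_point t \<in> T}"
  have "J = side_point -` T" by (auto simp: J_def)
  moreover have "continuous_on UNIV side_point" unfolding side_point_def by (intro continuous_intros)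
  ultimately have "closed J" using tri(3) by (simp add: continuous_closed_vimage continuous_on_eq_continuous_at)
  moreover have "bounded J"
  proof -
    obtain R where R: "\<And>y. y \<in> T \<Longrightarrow> norm y \<le> R" using tri(4) by (auto simp: bounded_iff)
    have "norm t \<le> (R + norm A) / norm (B - A)" if "t \<in> J" for t
    proof -
      have "norm (t *\<^sub>R (B - A)) = norm (side_point t - A)" by (simp add: side_point_def)
      also have "\<dots> \<le> R + norm A" using R[of "side_point t"] that norm_triangle_ineq4[of "side_point t" A] by (auto simp: J_def)
      finally show ?thesis using side(2) by (simp add: pos_le_divide_eq)
    qed
    then show ?thesis unfolding bounded_iff by blast
  qed
  ultimately have "compact J" using compact_eq_bounded_closed by blast
  moreover have "convex J"
    unfolding convex_alt J_def
  proof (clarify)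
    fix x y u :: real assume "side_point x \<in> T" "side_point y \<in> T" "0 \<le> u" "u \<le> 1"
    then show "side_point ((1 - u) *\<^sub>R x + u *\<^sub>R y) \<in> T"
      using convexD_alt[OF tri(1), of "side_point x" "side_point y" u] side_point_combination by simp
  qed
  ultimately obtain c d where J: "J = {c..d}"
    using connected_compact_interval_1 convex_connected by metis
  have cd: "c \<le> r" "r \<le> d" using T(2) J by (auto simp: J_def)
  have in_J: "side_point t \<in> T \<longleftrightarrow> c \<le> t \<and> t \<le> d" for t using J by (auto simp: J_def)
  have lineE: "\<exists>t. y = side_point t" if "n \<bullet> y = n \<bullet> A" for y
  proof -
    define w z where "w = B - A" and "z = y - A"
    \<comment> \<open>Both \<open>w\<close> and \<open>z\<close> are orthogonal to the nonzero
      \<open>n\<close>, so in the plane they are parallel and their determinant vanishes.\<close>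
    have eqs: "n $ 1 * w $ 1 + n $ 2 * w $ 2 = 0" "n $ 1 * z $ 1 + n $ 2 * z $ 2 = 0"
      using that normal_orthogonal by (simp_all add: w_def z_def inner_vec_def sum_2 algebra_simps)
    have "n $ 1 * (w $ 1 * z $ 2 - w $ 2 * z $ 1) = 0" "n $ 2 * (w $ 1 * z $ 2 - w $ 2 * z $ 1) = 0"
      using eqs by algebra+
    moreover have "n \<noteq> 0" using normal by (auto simp: outer_unit_normal_def)
    then have "n $ 1 \<noteq> 0 \<or> n $ 2 \<noteq> 0" by (simp add: vec_eq_iff forall_2)
    ultimately have det: "w $ 1 * z $ 2 = w $ 2 * z $ 1" by auto
    have ww: "w \<bullet> w \<noteq> 0" using side(2) by (simp add: w_def)
    have eq: "(w \<bullet> w) *\<^sub>R z = (z \<bullet> w) *\<^sub>R w"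
      using det by (simp add: vec_eq_iff forall_2 inner_vec_def sum_2) algebra
    have "z = (1 / (w \<bullet> w)) *\<^sub>R ((w \<bullet> w) *\<^sub>R z)" using ww by simp
    also have "\<dots> = (z \<bullet> w / (w \<bullet> w)) *\<^sub>R w" unfolding eq by simp
    finally have "y = A + (z \<bullet> w / (w \<bullet> w)) *\<^sub>R (B - A)" unfolding w_def z_def by (simp add: algebra_simps)
    then show ?thesis unfolding side_point_def by blast
  qed
  \<comment> \<open>By the half-plane bound the line supports \<open>T\<close>, so it cuts out a
    face.\<close>
  define F where "F = T \<inter> {y. n \<bullet> y = n \<bullet> A}"
  have face: "F face_of T"
    unfolding F_def using triangle_halfplane[OF T rG] by (intro face_of_Int_supporting_hyperplane_le tri(1))
  have F: "F = closed_segment (side_point c) (side_point d)"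
  proof (rule set_eqI)
    fix y
    have "n \<bullet> side_point t = n \<bullet> A" for t
      using normal_orthogonal by (simp add: side_point_def inner_simps)
    then show "y \<in> F \<longleftrightarrow> y \<in> closed_segment (side_point c) (side_point d)"
      using in_closed_side_segment[of c d y] cd in_J lineE[of y] by (auto simp: F_def)
  qed
  \<comment> \<open>If the line touched \<open>T\<close> in one point only, the chosen point would
    be a vertex.\<close>
  have "c < d"
  proof (rule ccontr)
    assume "\<not> c < d"
    then have "c = r" "d = r" using cd by auto
    then have "side_point r extreme_point_of T" using face F by (simp add: face_of_singleton)
    then show False using notv T(1) by (auto simp: mesh_vertices_def)
  qed
  have ends: "side_point c \<in> mesh_vertices \<T>" "side_point d \<in> mesh_vertices \<T>"
    using extreme_point_of_face[OF face] T(1) unfolding F mesh_vertices_def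
    by (auto simp: extreme_point_of_segment)
  \<comment> \<open>A mesh vertex in \<open>T\<close> is extreme in \<open>T\<close>, so it cannot
    lie strictly between two points of \<open>T\<close>.\<close>
  have no_inner: "\<not> (c < ?s k \<and> ?s k < d)" if k: "1 \<le> k" "k \<le> m + 1" for k
  proof
    assume a: "c < ?s k \<and> ?s k < d"
    then have "M k \<in> T" using in_J side_param(1)[OF k] by auto
    then have "M k extreme_point_of T" using mesh_vertex_extreme[OF mesh Mv[OF k] _ T(1)] by blast
    moreover have "M k \<in> open_segment (side_point c) (side_point d)"
      using in_open_side_segment[OF \<open>c < d\<close>] a side_param(1)[OF k] by blast
    moreover have "side_point c \<in> T" "side_point d \<in> T" using in_J \<open>c < d\<close> by auto
    ultimately show False by (auto simp: extreme_point_of_def)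
  qed
  have le: "?s i \<le> c" "d \<le> ?s (i + 1)"
    using no_inner[of i] no_inner[of "i + 1"] i r cd by auto
  obtain k where k: "1 \<le> k" "k \<le> m + 1" "c = ?s k" using mesh_vertex_side_param[OF ends(1)] le cd r s01 by auto
  obtain l where l: "1 \<le> l" "l \<le> m + 1" "d = ?s l" using mesh_vertex_side_param[OF ends(2)] le cd r s01 by auto
  have "c = ?s i" using between[of k] k le cd r by auto
  moreover have "d = ?s (i + 1)" using between[of l] l le cd r by auto
  ultimately have "F = closed_segment (M i) (M (i + 1))" using F s01(4,5) by simp
  moreover have "M i \<noteq> M (i + 1)" using s01 side_point_inj by auto
  ultimately have "closed_segment (M i) (M (i + 1)) edge_of T"
    using face by (simp add: edge_of_def segment_convex_hull aff_dim_convex_hull aff_dim_2)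
  then show ?thesis using T(1) by blast
qed

lemma endpoints_nodes: "A \<in> mesh_nodes \<T>" "B \<in> mesh_nodes \<T>"
proof -
  have "M ` {1..m + 1} = mesh_vertices \<T> \<inter> closed_segment A B" "M 1 = A" "M (m + 1) = B"
    using nodes by (auto simp: side_vertices_def)
  then have "A \<in> mesh_vertices \<T>" "B \<in> mesh_vertices \<T>"
    by (metis Int_iff atLeastAtMost_iff image_eqI le_add2 order_refl)+
  then show "A \<in> mesh_nodes \<T>" "B \<in> mesh_nodes \<T>" by (auto simp: mesh_nodes_def)
qed

lemma mesh_nodes_in_closure: "mesh_nodes \<T> \<subseteq> closure \<Omega>"
  unfolding cover[symmetric]
proof
  fix x assume "x \<in> mesh_nodes \<T>"
  then consider T where "T \<in> \<T>" "x extreme_point_of T"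
    | C D T where "x = midpoint C D" "T \<in> \<T>" "closed_segment C D edge_of T"
    by (auto simp: mesh_nodes_def mesh_vertices_def)
  then show "x \<in> \<Union>\<T>"
  proof cases
    case 2
    then show ?thesis using edge_of_imp_subset midpoint_in_closed_segment by blast
  qed (auto simp: extreme_point_of_def)
qed

lemma endpoints_in_closure: "A \<in> closure \<Omega>" "B \<in> closure \<Omega>"
  using endpoints_nodes mesh_nodes_in_closure by blast+

lemma side_vertex_cases:
  assumes "i \<in> {1..m + 1}"
  shows "M i = A \<or> M i = B \<or> M i \<in> \<Gamma>1 \<inter> mesh_nodes \<T>"
proof -
  have "M i \<in> mesh_vertices \<T> \<inter> closed_segment A B"
    using nodes assms unfolding side_vertices_def by blast
  then show ?thesis by (auto simp: side(1) open_segment_def mesh_nodes_def)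
qed

text \<open>The midpoint is a mesh node because the interval is a side of a triangle; hence a basis
  function is attached to every Simpson midpoint.\<close>

lemma side_midpoint:
  assumes i: "i \<in> {1..m}"
  shows "midpoint (M i) (M (i + 1)) \<in> \<Gamma>1 \<inter> mesh_nodes \<T>" "dist (M i) (M (i + 1)) > 0"
proof -
  let ?s = side_param
  note s01 = side_param_interval[OF i]
  have "midpoint (M i) (M (i + 1)) = side_point ((?s i + ?s (i + 1)) / 2)"
    unfolding s01(4,5) by (simp add: midpoint_def side_point_def algebra_simps vec_eq_iff field_simps)
  moreover have "0 < (?s i + ?s (i + 1)) / 2" "(?s i + ?s (i + 1)) / 2 < 1" using s01 by auto
  ultimately have "midpoint (M i) (M (i + 1)) \<in> \<Gamma>1" using in_Gamma1 by blast
  moreover have "midpoint (M i) (M (i + 1)) \<in> mesh_nodes \<T>"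
    using side_interval_is_edge[OF i] by (auto simp: mesh_nodes_def)
  ultimately show "midpoint (M i) (M (i + 1)) \<in> \<Gamma>1 \<inter> mesh_nodes \<T>" by blast
  show "dist (M i) (M (i + 1)) > 0" unfolding s01(4,5) using s01 side_point_inj by auto
qed

lemma side_covered:
  assumes "x \<in> closed_segment A B"
  shows "\<exists>i\<in>{1..m}. x \<in> closed_segment (M i) (M (i + 1))"
proof -
  obtain t where t: "0 \<le> t" "t \<le> 1" "x = side_point t" using assms in_side by blast
  obtain i where i: "i \<in> {1..m}" "side_param i \<le> t" "t \<le> side_param (i + 1)"
    using covering_interval[of m side_param t] side_param_ends m_pos t by auto
  then have "x \<in> closed_segment (M i) (M (i + 1))"
    unfolding side_param_interval(4,5)[OF i(1)]
    using in_closed_side_segment[of "side_param i" "side_param (i + 1)" x] t by auto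
  then show ?thesis using i by blast
qed

end

subsection \<open>Minimisation in finitely many coordinates\<close>

lemma continuous_on_coordinate: "continuous_on UNIV (\<lambda>c::'i \<Rightarrow> real. c k)"
  by (rule continuous_on_product_coordinates)

text \<open>Coordinate functions carry the product topology; fixing the coordinates outside
  \<open>K\<close> to 0 makes the box a product of compact factors.\<close>

lemma compact_coordinate_box: "compact {c :: 'i \<Rightarrow> real. (\<forall>k. k \<notin> K \<longrightarrow> c k = 0) \<and> (\<forall>k\<in>K. \<bar>c k\<bar> \<le> R)}"
proof -
  have bounds: "\<bar>r\<bar> \<le> R \<longleftrightarrow> r \<in> {-R..R}" for r :: real by auto
  have "{c :: 'i \<Rightarrow> real. (\<forall>k. k \<notin> K \<longrightarrow> c k = 0) \<and> (\<forall>k\<in>K. \<bar>c k\<bar> \<le> R)} =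
      PiE UNIV (\<lambda>k. if k \<in> K then {-R..R} else {0})"
    unfolding bounds by (auto simp: PiE_iff split: if_splits)
  moreover have "compactin (product_topology (\<lambda>k. euclidean) UNIV)
      (PiE UNIV (\<lambda>k::'i. if k \<in> K then {-R..R} else {0}))"
    unfolding compactin_PiE by auto
  ultimately show ?thesis by (simp add: euclidean_product_topology)
qed

text \<open>By homogeneity it suffices to bound \<open>q\<close> from below and \<open>l\<close>
  from above on the unit sphere of \<open>W\<close>, which is compact. Then \<open>q\<close>
  dominates \<open>l\<close> outside a ball, and the minimum over the ball is global. The sum of
  squares \<open>N\<close> serves as squared norm.\<close>

lemma coercive_minimizer_exists:
  fixes q j l :: "('i \<Rightarrow> real) \<Rightarrow> real"
  assumes K: "finite K" and W: "closed W" "W \<subseteq> {c. \<forall>k. k \<notin> K \<longrightarrow> c k = 0}" "(\<lambda>k. 0) \<in> W"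
    and scale: "\<And>c t. c \<in> W \<Longrightarrow> (\<lambda>k. t * c k) \<in> W"
    and cont: "continuous_on UNIV q" "continuous_on UNIV j" "continuous_on UNIV l"
    and q: "\<And>c t. q (\<lambda>k. t * c k) = t\<^sup>2 * q c" "\<And>c. c \<in> W \<Longrightarrow> c \<noteq> (\<lambda>k. 0) \<Longrightarrow> q c > 0"
    and j: "\<And>c. j c \<ge> 0" "j (\<lambda>k. 0) = 0"
    and l: "\<And>c t. l (\<lambda>k. t * c k) = t * l c"
  shows "\<exists>c\<in>W. \<forall>d\<in>W. q c / 2 + j c - l c \<le> q d / 2 + j d - l d"
\<comment> \<open>In the trivial space the unit sphere would be empty.\<close>
proof (cases "W = {\<lambda>k. 0}")
  case True
  then show ?thesis by simp
next
  case False
  define N where "N c = (\<Sum>k\<in>K. (c k)\<^sup>2)" for c :: "'i \<Rightarrow> real"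
  have N_nonneg: "N c \<ge> 0" for c by (simp add: N_def sum_nonneg)
  have N_cont: "continuous_on UNIV N"
    unfolding N_def by (intro continuous_intros continuous_on_coordinate)
  have N_coord: "\<bar>c k\<bar> \<le> sqrt (N c)" if "k \<in> K" for c k
  proof -
    have "(c k)\<^sup>2 \<le> N c" unfolding N_def using K that by (intro member_le_sum) auto
    then show ?thesis by (rule real_le_rsqrt[of "\<bar>c k\<bar>" "N c", simplified])
  qed
  have N_pos: "N c > 0" if "c \<in> W" "c \<noteq> (\<lambda>k. 0)" for c
  proof -
    obtain k where k: "c k \<noteq> 0" using \<open>c \<noteq> (\<lambda>k. 0)\<close> by auto
    then have "k \<in> K" using W(2) \<open>c \<in> W\<close> by auto
    then show ?thesis using N_coord[of k c] k N_nonneg[of c] by (cases "N c = 0") auto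
  qed
  \<comment> \<open>Serves both the unit sphere and the closed ball of radius
    \<open>R\<close>.\<close>
  have bounded_part: "compact {c \<in> W. N c \<in> S}" if S: "closed S" "S \<subseteq> {..R\<^sup>2}" "R \<ge> 0" for S R
  proof -
    have cl: "closed (W \<inter> N -` S)"
      using N_cont S(1) W(1) by (intro closed_Int closed_vimage)
    have sub: "W \<inter> N -` S \<subseteq> {c. (\<forall>k. k \<notin> K \<longrightarrow> c k = 0) \<and> (\<forall>k\<in>K. \<bar>c k\<bar> \<le> R)}"
    proof (intro subsetI CollectI conjI ballI)
      fix c assume c: "c \<in> W \<inter> N -` S"
      show "\<forall>k. k \<notin> K \<longrightarrow> c k = 0" using W(2) c by (simp add: subset_iff)
      fix k assume k: "k \<in> K"
      have "N c \<le> R\<^sup>2" using S(2) c by auto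
      then have "sqrt (N c) \<le> R" using S(3) by (simp add: real_le_lsqrt N_nonneg)
      then show "\<bar>c k\<bar> \<le> R" using N_coord[OF k, of c] by linarith
    qed
    have "compact (W \<inter> N -` S)"
      using compact_Int_closed[OF compact_coordinate_box[of K R] cl] unfolding Int_absorb1[OF sub] .
    moreover have "{c \<in> W. N c \<in> S} = W \<inter> N -` S" by auto
    ultimately show ?thesis by simp
  qed
  let ?S = "{c \<in> W. N c \<in> {1}}"
  have S_compact: "compact ?S" by (rule bounded_part[of "{1}" 1]) auto
  have to_sphere: "(\<lambda>k. (1 / sqrt (N c)) * c k) \<in> ?S" if c: "c \<in> W" "c \<noteq> (\<lambda>k. 0)" for c
  proof -
    have "N (\<lambda>k. (1 / sqrt (N c)) * c k) = (\<Sum>k\<in>K. (c k)\<^sup>2 / N c)"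
      unfolding N_def[of "\<lambda>k. (1 / sqrt (N c)) * c k"]
      using N_nonneg[of c] by (intro sum.cong) (auto simp: power_mult_distrib power_divide)
    also have "\<dots> = 1" using N_pos[OF c] by (simp add: N_def flip: sum_divide_distrib)
    finally show ?thesis using scale[OF c(1), of "1 / sqrt (N c)"] by blast
  qed
  have S_ne: "?S \<noteq> {}"
  proof -
    obtain c where "c \<in> W" "c \<noteq> (\<lambda>k. 0)" using False W(3) by blast
    then show ?thesis using to_sphere by blast
  qed
  obtain c1 where c1: "c1 \<in> ?S" "\<forall>c\<in>?S. q c1 \<le> q c"
    using continuous_attains_inf[OF S_compact S_ne, of q] cont(1) continuous_on_subset by blast
  have "continuous_on ?S (\<lambda>c. \<bar>l c\<bar>)"
    by (intro continuous_on_rabs continuous_on_subset[OF cont(3)]) simp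
  then obtain c2 where c2: "c2 \<in> ?S" "\<forall>c\<in>?S. \<bar>l c\<bar> \<le> \<bar>l c2\<bar>"
    using continuous_attains_sup[OF S_compact S_ne, of "\<lambda>c. \<bar>l c\<bar>"] by blast
  define \<delta> \<beta> where "\<delta> = q c1" and "\<beta> = \<bar>l c2\<bar>"
  have \<delta>: "\<delta> > 0"
  proof -
    have "c1 \<noteq> (\<lambda>k. 0)" using c1(1) by (auto simp: N_def)
    then show ?thesis unfolding \<delta>_def using q(2) c1(1) by blast
  qed
  have lower: "q c \<ge> \<delta> * N c" "\<bar>l c\<bar> \<le> \<beta> * sqrt (N c)" if c: "c \<in> W" for c
  proof -
    show "q c \<ge> \<delta> * N c"
    proof (cases "c = (\<lambda>k. 0)")
      case True
      then show ?thesis using q(1)[of 0 c] by (simp add: N_def)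
    next
      case False
      have "\<delta> \<le> q (\<lambda>k. (1 / sqrt (N c)) * c k)"
        unfolding \<delta>_def using c1(2) to_sphere[OF c False] by blast
      also have "\<dots> = q c / N c" unfolding q(1) using N_nonneg[of c] by (simp add: power_divide)
      finally show ?thesis using N_pos[OF c False] by (simp add: pos_le_divide_eq)
    qed
    show "\<bar>l c\<bar> \<le> \<beta> * sqrt (N c)"
    proof (cases "c = (\<lambda>k. 0)")
      case True
      then show ?thesis using l[of 0 c] by (simp add: N_def)
    next
      case False
      have "\<bar>l (\<lambda>k. (1 / sqrt (N c)) * c k)\<bar> \<le> \<beta>"
        unfolding \<beta>_def using c2(2) to_sphere[OF c False] by blast
      then have "\<bar>l c\<bar> / sqrt (N c) \<le> \<beta>" unfolding l using N_nonneg[of c] by (simp add: abs_mult)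
      then show ?thesis using N_pos[OF c False] by (simp add: pos_divide_le_eq)
    qed
  qed
  \<comment> \<open>Beyond this radius \<open>\<delta> * N c / 2\<close>, a lower bound of
    \<open>q c / 2\<close>, is at least \<open>\<beta> * sqrt (N c)\<close>, so the functional is
    not below its value 0 at the origin.\<close>
  define R where "R = 2 * \<beta> / \<delta>"
  have R: "R \<ge> 0" using \<delta> by (simp add: R_def \<beta>_def)
  let ?D = "{c \<in> W. N c \<in> {..R\<^sup>2}}"
  let ?J = "\<lambda>c. q c / 2 + j c - l c"
  have D: "compact ?D" by (rule bounded_part[OF _ _ R]) auto
  have zero: "(\<lambda>k. 0) \<in> ?D" using W(3) by (simp add: N_def)
  have "continuous_on UNIV ?J" by (intro continuous_intros cont) simp
  then have "continuous_on ?D ?J" by (rule continuous_on_subset) simp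
  then obtain c0 where c0: "c0 \<in> ?D" "\<forall>c\<in>?D. ?J c0 \<le> ?J c"
    using continuous_attains_inf[OF D, of ?J] zero by blast
  have J0: "?J (\<lambda>k. 0) = 0" using q(1)[of 0 "\<lambda>k. 0"] l[of 0 "\<lambda>k. 0"] j(2) by simp
  have "?J c0 \<le> ?J d" if d: "d \<in> W" for d
  proof (cases "d \<in> ?D")
    case False
    then have "R\<^sup>2 < N d" using d by auto
    then have r: "R < sqrt (N d)" using R by (simp add: real_less_rsqrt)
    have "\<beta> \<le> \<delta> * sqrt (N d) / 2" using r \<delta> by (simp add: R_def field_simps)
    then have "\<beta> * sqrt (N d) \<le> \<delta> * sqrt (N d) / 2 * sqrt (N d)"
      using N_nonneg by (intro mult_right_mono) auto
    also have "\<dots> = \<delta> * N d / 2" using N_nonneg[of d] by simp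
    finally have "\<beta> * sqrt (N d) \<le> \<delta> * N d / 2" .
    then have "0 \<le> ?J d" using lower[OF d] j(1)[of d] by linarith
    then show ?thesis using c0(2) zero J0 by fastforce
  qed (use c0 in blast)
  then show ?thesis using c0(1) by blast
qed

section \<open>Linear spaces and linear forms of functions\<close>

definition linear_space :: "('a \<Rightarrow> 'b::real_vector) set \<Rightarrow> bool" where
  "linear_space S \<longleftrightarrow> (\<lambda>x. 0) \<in> S \<and> (\<forall>u\<in>S. \<forall>v\<in>S. \<forall>\<alpha> \<beta>. (\<lambda>x. \<alpha> *\<^sub>R u x + \<beta> *\<^sub>R v x) \<in> S)"

definition linear_form :: "('a \<Rightarrow> 'b::real_vector) set \<Rightarrow> (('a \<Rightarrow> 'b) \<Rightarrow> real) \<Rightarrow> bool" where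
  "linear_form S L \<longleftrightarrow>
     (\<forall>u\<in>S. \<forall>v\<in>S. \<forall>\<alpha> \<beta>. L (\<lambda>x. \<alpha> *\<^sub>R u x + \<beta> *\<^sub>R v x) = \<alpha> * L u + \<beta> * L v)"

lemma linear_space_lincomb:
  "linear_space S \<Longrightarrow> u \<in> S \<Longrightarrow> v \<in> S \<Longrightarrow> (\<lambda>x. \<alpha> *\<^sub>R u x + \<beta> *\<^sub>R v x) \<in> S"
  by (simp add: linear_space_def)

lemma linear_space_scale: "linear_space S \<Longrightarrow> u \<in> S \<Longrightarrow> (\<lambda>x. \<alpha> *\<^sub>R u x) \<in> S"
  using linear_space_lincomb[of S u u \<alpha> 0] by simp

lemma linear_space_diff: "linear_space S \<Longrightarrow> u \<in> S \<Longrightarrow> v \<in> S \<Longrightarrow> (\<lambda>x. u x - v x) \<in> S"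
  using linear_space_lincomb[of S u v 1 "-1"] by simp

lemma linear_space_sum:
  assumes S: "linear_space S" and K: "finite K" "\<And>k. k \<in> K \<Longrightarrow> e k \<in> S"
  shows "(\<lambda>x. \<Sum>k\<in>K. c k *\<^sub>R e k x) \<in> S"
  using K
proof (induction K rule: finite_induct)
  case empty
  then show ?case using S by (simp add: linear_space_def)
next
  case (insert k K)
  then show ?case using linear_space_lincomb[OF S, of "e k" "\<lambda>x. \<Sum>k\<in>K. c k *\<^sub>R e k x" "c k" 1] by simp
qed

lemma linear_form_lincomb:
  "linear_form S L \<Longrightarrow> u \<in> S \<Longrightarrow> v \<in> S \<Longrightarrow> L (\<lambda>x. \<alpha> *\<^sub>R u x + \<beta> *\<^sub>R v x) = \<alpha> * L u + \<beta> * L v"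
  by (simp add: linear_form_def)

lemma linear_form_scale: "linear_form S L \<Longrightarrow> u \<in> S \<Longrightarrow> L (\<lambda>x. \<alpha> *\<^sub>R u x) = \<alpha> * L u"
  using linear_form_lincomb[of S L u u \<alpha> 0] by simp

lemma linear_form_diff: "linear_form S L \<Longrightarrow> u \<in> S \<Longrightarrow> v \<in> S \<Longrightarrow> L (\<lambda>x. u x - v x) = L u - L v"
  using linear_form_lincomb[of S L u v 1 "-1"] by simp

lemma linear_form_zero: "linear_form S L \<Longrightarrow> u \<in> S \<Longrightarrow> L (\<lambda>x. 0) = 0"
  using linear_form_lincomb[of S L u u 0 0] by simp

lemma linear_form_subset: "linear_form S L \<Longrightarrow> T \<subseteq> S \<Longrightarrow> linear_form T L"
  unfolding linear_form_def by blast

lemma linear_form_plus: "linear_form S L \<Longrightarrow> linear_form S L' \<Longrightarrow> linear_form S (\<lambda>v. L v + L' v)"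
  and linear_form_minus: "linear_form S L \<Longrightarrow> linear_form S L' \<Longrightarrow> linear_form S (\<lambda>v. L v - L' v)"
  and linear_form_uminus: "linear_form S L \<Longrightarrow> linear_form S (\<lambda>v. - L v)"
  by (simp_all add: linear_form_def algebra_simps)

lemma linear_form_sum:
  assumes S: "linear_space S" and L: "linear_form S L" and K: "finite K" "\<And>k. k \<in> K \<Longrightarrow> e k \<in> S"
  shows "L (\<lambda>x. \<Sum>k\<in>K. c k *\<^sub>R e k x) = (\<Sum>k\<in>K. c k * L (e k))"
  using K
proof (induction K rule: finite_induct)
  case empty
  have "(\<lambda>x. 0) \<in> S" using S by (simp add: linear_space_def)
  then show ?case using linear_form_zero[OF L] by simp
next
  case (insert k K)
  have "(\<lambda>x. \<Sum>k\<in>K. c k *\<^sub>R e k x) \<in> S" using insert by (intro linear_space_sum S) auto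
  then show ?case
    using insert linear_form_lincomb[OF L, of "e k" "\<lambda>x. \<Sum>k\<in>K. c k *\<^sub>R e k x" "c k" 1] by simp
qed

text \<open>Testing with \<open>0\<close> and \<open>2u\<close>, where \<open>j\<close> is positively homogeneous.\<close>

lemma variational_inequality_energy:
  assumes S: "linear_space S" and L: "linear_form S L" and u: "u \<in> S"
    and j: "\<And>v \<alpha>. v \<in> S \<Longrightarrow> j (\<lambda>x. \<alpha> *\<^sub>R v x) = \<bar>\<alpha>\<bar> * (j v :: real)"
    and vi: "\<And>v. v \<in> S \<Longrightarrow> L v - L u + j v - j u \<ge> 0"
  shows "L u + j u = 0" "\<And>v. v \<in> S \<Longrightarrow> \<bar>L v\<bar> \<le> j v"
proof -
  have *: "(\<alpha> - 1) * L u + (\<bar>\<alpha>\<bar> - 1) * j u \<ge> 0" for \<alpha>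
    using vi[OF linear_space_scale[OF S u, of \<alpha>]] linear_form_scale[OF L u, of \<alpha>] j[OF u, of \<alpha>]
    by (simp add: algebra_simps)
  show 0: "L u + j u = 0" using *[of 0] *[of 2] by simp
  fix v assume v: "v \<in> S"
  \<comment> \<open>Since \<open>L u + j u = 0\<close>, the inequality reads
    \<open>L v + j v \<ge> 0\<close>; \<open>v\<close> and its negative give the two signs.\<close>
  show "\<bar>L v\<bar> \<le> j v"
    using vi[OF v] vi[OF linear_space_scale[OF S v, of "-1"]] linear_form_scale[OF L v, of "-1"] j[OF v, of "-1"] 0
    by simp
qed

subsection \<open>The friction functional and the Lagrange multiplier\<close>

locale friction_problem = discretised_domain P \<Omega> \<Gamma>0 \<Gamma>1 A B n \<T> h m M
  for P \<Omega> \<Gamma>0 \<Gamma>1 A B n \<T> h m M +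
  fixes \<nu> :: real and f :: "point \<Rightarrow> point" and g :: "point \<Rightarrow> real"
  assumes nu: "\<nu> > 0" and f: "f \<in> L2_vec \<Omega>"
    and g_cont: "continuous_on (closure \<Gamma>1) g"
    and g_pos: "\<And>x. x \<in> \<Gamma>1 \<Longrightarrow> g x > 0"
begin

abbreviation "V \<equiv> V_tau_h \<Omega> \<Gamma>0 \<Gamma>1 n \<T>"
abbreviation "V\<sigma> \<equiv> V_tau_sigma_h \<Omega> \<Gamma>0 \<Gamma>1 n \<T>"
abbreviation "N \<equiv> \<Gamma>1 \<inter> mesh_nodes \<T>"
abbreviation "tr \<equiv> normal_trace \<Gamma>1 n"
abbreviation "j \<equiv> \<lambda>v. j_h g m M (tr v)"

lemma normal_unit: "n \<bullet> n = 1" "n \<bullet> tangent n = 0"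
  using normal by (simp_all add: outer_unit_normal_def norm_eq_1 tangent_def inner_vec_def sum_2)

lemma linear_space_V_h: "linear_space (V_h \<Omega> \<T>)"
  using V_h_lincomb by (simp add: linear_space_def) (simp add: V_h_def C0_def polynomial_on_zero)

lemma linear_space_V: "linear_space V"
  using linear_space_V_h by (auto simp: linear_space_def V_tau_h_def inner_simps)

lemma V_subset: "v \<in> V \<Longrightarrow> v \<in> V_h \<Omega> \<T>"
  by (simp add: V_tau_h_def)

lemma linear_form_b: "q \<in> Q_h \<Omega> \<T> \<Longrightarrow> linear_form (V_h \<Omega> \<T>) (\<lambda>v. form_b \<Omega> v q)"
  by (simp add: linear_form_def form_b_lincomb)

lemma linear_space_V\<sigma>: "linear_space V\<sigma>"
proof -
  have "(\<lambda>x. 0) \<in> V\<sigma>"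
    using linear_space_V linear_form_zero[OF linear_form_b] linear_space_V_h
    by (auto simp: linear_space_def V_tau_sigma_h_def)
  moreover have "(\<lambda>x. \<alpha> *\<^sub>R u x + \<beta> *\<^sub>R v x) \<in> V\<sigma>" if "u \<in> V\<sigma>" "v \<in> V\<sigma>" for u v \<alpha> \<beta>
    using that linear_space_lincomb[OF linear_space_V] V_subset
    by (simp add: V_tau_sigma_h_def form_b_lincomb)
  ultimately show ?thesis by (simp add: linear_space_def)
qed

lemma V\<sigma>_subset: "v \<in> V\<sigma> \<Longrightarrow> v \<in> V" "v \<in> V\<sigma> \<Longrightarrow> v \<in> V_h \<Omega> \<T>"
  by (simp_all add: V_tau_sigma_h_def V_tau_h_def)

lemma linear_form_a: "u \<in> V_h \<Omega> \<T> \<Longrightarrow> linear_form (V_h \<Omega> \<T>) (form_a \<Omega> \<nu> u)"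
  by (simp add: linear_form_def form_a_lincomb_right)

lemma linear_form_L2: "linear_form (V_h \<Omega> \<T>) (L2_inner \<Omega> f)"
  by (simp add: linear_form_def L2_inner_lincomb f)

lemma V_endpoints: "v \<in> V \<Longrightarrow> v A = 0" "v \<in> V \<Longrightarrow> v B = 0"
  using endpoints_nodes endpoints_in_closure_Gamma0 by (auto simp: V_tau_h_def)

lemma form_a_definite:
  assumes "v \<in> V" "form_a \<Omega> \<nu> v v = 0"
  shows "v = (\<lambda>x. 0)"
  by (rule form_a_eq_0_imp_eq_0[OF V_subset[OF assms(1)] nu assms(2) endpoints_in_closure side(2)])
    (use V_endpoints assms in auto)

section \<open>The Simpson rule weighted by \<open>g\<close>\<close>

definition quadrature :: "(point \<Rightarrow> real) \<Rightarrow> real" where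
  "quadrature \<Phi> = (\<Sum>i=1..m. dist (M i) (M (i + 1)) / 6 * (g (M i) * \<Phi> (M i)
     + 4 * g (midpoint (M i) (M (i + 1))) * \<Phi> (midpoint (M i) (M (i + 1)))
     + g (M (i + 1)) * \<Phi> (M (i + 1))))"

text \<open>\<open>j_h\<close> and \<open>form_Lambda\<close> are one rule applied to different
  integrands, so linearity, monotonicity and positivity need only one proof.\<close>

lemma j_h_quadrature: "j_h g m M \<eta> = quadrature (\<lambda>x. \<bar>\<eta> x\<bar>)"
  by (simp add: j_h_def quadrature_def Let_def sum_distrib_left)

lemma form_Lambda_quadrature: "form_Lambda g m M \<eta> \<mu> = quadrature (\<lambda>x. \<eta> x * \<mu> x)"
  by (simp add: form_Lambda_def quadrature_def Let_def sum_distrib_left mult.assoc)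

lemma quadrature_lincomb: "quadrature (\<lambda>x. \<alpha> * \<Phi> x + \<beta> * \<Psi> x) = \<alpha> * quadrature \<Phi> + \<beta> * quadrature \<Psi>"
  by (simp add: quadrature_def sum_distrib_left sum.distrib [symmetric] algebra_simps)

lemma linear_form_quadrature: "linear_form UNIV quadrature"
  by (simp add: linear_form_def quadrature_lincomb)

lemma quadrature_mult: "quadrature (\<lambda>x. \<alpha> * \<Phi> x) = \<alpha> * quadrature \<Phi>"
  using quadrature_lincomb[of \<alpha> \<Phi> 0 \<Phi>] by simp

text \<open>The rule evaluates only at mesh nodes of the open side and at the two endpoints, so a
  property of these points reaches every term.\<close>

lemma quadrature_nodes:
  assumes "\<And>x. x \<in> N \<Longrightarrow> Q x" "Q A" "Q B" "i \<in> {1..m}"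
  shows "Q (M i)" "Q (midpoint (M i) (M (i + 1)))" "Q (M (i + 1))"
  using assms side_vertex_cases[of i] side_vertex_cases[of "i + 1"] side_midpoint(1)[of i] by auto

lemma quadrature_cong:
  assumes "\<And>x. x \<in> N \<Longrightarrow> \<Phi> x = \<Psi> x" "\<Phi> A = \<Psi> A" "\<Phi> B = \<Psi> B"
  shows "quadrature \<Phi> = quadrature \<Psi>"
  unfolding quadrature_def
  by (intro sum.cong refl) (simp only: quadrature_nodes[of "\<lambda>x. \<Phi> x = \<Psi> x", OF assms])

lemma g_nonneg: "x \<in> closed_segment A B \<Longrightarrow> g x \<ge> 0"
  using continuous_ge_on_closure[of \<Gamma>1 g x 0] g_cont g_pos side(3) less_imp_le by metis

lemma quadrature_mono:
  assumes "\<And>x. x \<in> N \<Longrightarrow> \<Phi> x \<le> \<Psi> x" "\<Phi> A \<le> \<Psi> A" "\<Phi> B \<le> \<Psi> B"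
  shows "quadrature \<Phi> \<le> quadrature \<Psi>"
proof -
  have N: "N \<subseteq> closed_segment A B" using side(1) open_closed_segment by blast
  have g: "g (M i) \<ge> 0" "g (midpoint (M i) (M (i + 1))) \<ge> 0" "g (M (i + 1)) \<ge> 0" if "i \<in> {1..m}" for i
    using quadrature_nodes[of "\<lambda>x. g x \<ge> 0", OF _ _ _ that] g_nonneg N by auto
  show ?thesis
    unfolding quadrature_def
    using quadrature_nodes[of "\<lambda>x. \<Phi> x \<le> \<Psi> x", OF assms] g
    by (intro sum_mono mult_left_mono add_mono) (auto intro!: mult_left_mono)
qed

lemma quadrature_nonneg: "(\<And>x. \<Phi> x \<ge> 0) \<Longrightarrow> quadrature \<Phi> \<ge> 0"
  using quadrature_mono[of "\<lambda>x. 0" \<Phi>] by (simp add: quadrature_def)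

text \<open>The points at which \<open>quadrature\<close> evaluates. A positive weight is available
  only for those of them in \<open>\<Gamma>1\<close>, so positivity and uniqueness are stated with
  this set instead of \<open>N\<close>.\<close>

definition side_nodes :: "point set" where
  "side_nodes = M ` {1..m + 1} \<union> (\<lambda>i. midpoint (M i) (M (i + 1))) ` {1..m}"

lemma quadrature_pos:
  assumes \<Phi>: "\<And>x. \<Phi> x \<ge> 0" and x: "x \<in> side_nodes" "x \<in> \<Gamma>1" "\<Phi> x > 0"
  shows "quadrature \<Phi> > 0"
proof -
  have gx: "g x * \<Phi> x > 0" using g_pos x by simp
  have N: "N \<subseteq> closed_segment A B" using side(1) open_closed_segment by blast
  have g: "g (M i) \<ge> 0" "g (midpoint (M i) (M (i + 1))) \<ge> 0" "g (M (i + 1)) \<ge> 0" if "i \<in> {1..m}" for i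
    using quadrature_nodes[of "\<lambda>x. g x \<ge> 0", OF _ _ _ that] g_nonneg N by auto
  have g\<Phi>: "g (M i) * \<Phi> (M i) \<ge> 0" "g (midpoint (M i) (M (i + 1))) * \<Phi> (midpoint (M i) (M (i + 1))) \<ge> 0"
    "g (M (i + 1)) * \<Phi> (M (i + 1)) \<ge> 0" if "i \<in> {1..m}" for i
    using g[OF that] \<Phi> by auto
  obtain i where i: "i \<in> {1..m}" "x = M i \<or> x = midpoint (M i) (M (i + 1)) \<or> x = M (i + 1)"
  proof -
    consider k where "k \<in> {1..m + 1}" "x = M k" | i where "i \<in> {1..m}" "x = midpoint (M i) (M (i + 1))"
      using x(1) by (auto simp: side_nodes_def)
    then show thesis
    proof cases
      case 1
      show thesis
      \<comment> \<open>The last vertex starts no interval and is taken as the right end of the last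
        one.\<close>
      proof (cases "k \<le> m")
        case True
        then show thesis using that[of k] 1 by auto
      next
        case False
        then have "k = m + 1" using 1 by simp
        then show thesis using that[of m] 1 m_pos by auto
      qed
    qed (use that in blast)
  qed
  have "0 < dist (M i) (M (i + 1)) / 6 * (g (M i) * \<Phi> (M i)
     + 4 * (g (midpoint (M i) (M (i + 1))) * \<Phi> (midpoint (M i) (M (i + 1))))
     + g (M (i + 1)) * \<Phi> (M (i + 1)))"
    using side_midpoint(2)[OF i(1)] g\<Phi>[OF i(1)] gx i(2) by (intro mult_pos_pos) auto
  then show ?thesis
    unfolding quadrature_def mult.assoc using side_midpoint(2) g\<Phi> i(1)
    by (intro sum_pos2[of _ i]) (auto intro!: mult_nonneg_nonneg add_nonneg_nonneg)
qed

lemma tr_endpoints: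
  assumes "v \<in> V"
  shows "tr v A = 0" "tr v B = 0"
  by (simp_all add: normal_trace_def V_endpoints[OF assms])

lemma tr_lincomb: "tr (\<lambda>x. \<alpha> *\<^sub>R u x + \<beta> *\<^sub>R v x) = (\<lambda>x. \<alpha> * tr u x + \<beta> * tr v x)"
  by (auto simp: normal_trace_def inner_simps)

lemma tr_scale: "tr (\<lambda>x. \<alpha> *\<^sub>R v x) = (\<lambda>x. \<alpha> * tr v x)"
  by (auto simp: normal_trace_def)

lemma j_scale: "j (\<lambda>x. \<alpha> *\<^sub>R v x) = \<bar>\<alpha>\<bar> * j v"
  by (simp add: j_h_quadrature tr_scale abs_mult quadrature_mult)

lemma j_nonneg: "j v \<ge> 0"
  by (simp add: j_h_quadrature quadrature_nonneg)

lemma j_convex: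
  assumes "0 \<le> \<alpha>" "0 \<le> \<beta>"
  shows "j (\<lambda>x. \<alpha> *\<^sub>R u x + \<beta> *\<^sub>R v x) \<le> \<alpha> * j u + \<beta> * j v"
proof -
  have "\<bar>\<alpha> * a + \<beta> * b\<bar> \<le> \<alpha> * \<bar>a\<bar> + \<beta> * \<bar>b\<bar>" for a b
    using abs_triangle_ineq[of "\<alpha> * a" "\<beta> * b"] assms by (simp add: abs_mult)
  then show ?thesis
    unfolding j_h_quadrature tr_lincomb quadrature_lincomb[symmetric] by (intro quadrature_mono)
qed

lemma V_h_eq_0_if_nodal_eq_0:
  assumes v: "v \<in> V_h \<Omega> \<T>" and 0: "\<And>x. x \<in> mesh_nodes \<T> \<Longrightarrow> v x = 0"
  shows "v = (\<lambda>x. 0)"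
proof
  fix y
  show "v y = 0"
  proof (cases "y \<in> closure \<Omega>")
    case True
    then obtain T where T: "T \<in> \<T>" "y \<in> T" unfolding cover[symmetric] by blast
    have "v y $ i = 0" for i
      by (rule p2_eq_0_if_nodal_eq_0[OF mesh T(1) _ _ T(2)]) (use v T 0 in \<open>auto simp: V_h_def\<close>)
    then show ?thesis by (simp add: vec_eq_iff)
  qed (use v in \<open>simp add: V_h_def C0_def\<close>)
qed

text \<open>Vanishing outside \<open>closure \<Omega>\<close> is included because members of
  \<open>V_h\<close> are represented by their extension by zero.\<close>

definition is_nodal_basis :: "(point \<Rightarrow> point \<Rightarrow> real) \<Rightarrow> bool" where
  "is_nodal_basis \<phi> \<longleftrightarrow> (\<forall>x\<in>mesh_nodes \<T>. continuous_on (closure \<Omega>) (\<phi> x) \<and>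
     (\<forall>y. y \<notin> closure \<Omega> \<longrightarrow> \<phi> x y = 0) \<and> (\<forall>T\<in>\<T>. polynomial_on 2 T (\<phi> x)) \<and>
     (\<forall>y\<in>mesh_nodes \<T>. \<phi> x y = (if y = x then 1 else 0)))"

definition nodal :: "point \<Rightarrow> point \<Rightarrow> real" where
  "nodal = (SOME \<phi>. is_nodal_basis \<phi>)"

lemma nodal: "is_nodal_basis nodal"
proof -
  obtain \<phi> where \<phi>: "\<And>x. x \<in> mesh_nodes \<T> \<Longrightarrow> continuous_on (\<Union>\<T>) (\<phi> x)"
    "\<And>x T. x \<in> mesh_nodes \<T> \<Longrightarrow> T \<in> \<T> \<Longrightarrow> polynomial_on 2 T (\<phi> x)"
    "\<And>x y. x \<in> mesh_nodes \<T> \<Longrightarrow> y \<in> mesh_nodes \<T> \<Longrightarrow> \<phi> x y = (if y = x then 1 else 0 :: real)"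
    using p2_nodal_basis[OF mesh] by blast
  have "is_nodal_basis (\<lambda>x y. if y \<in> closure \<Omega> then \<phi> x y else 0)"
    unfolding is_nodal_basis_def
  proof (intro ballI conjI allI impI)
    fix x assume x: "x \<in> mesh_nodes \<T>"
    show "continuous_on (closure \<Omega>) (\<lambda>y. if y \<in> closure \<Omega> then \<phi> x y else 0)"
      by (rule continuous_on_eq[of _ "\<phi> x"]) (use \<phi>(1)[OF x] cover in auto)
    show "polynomial_on 2 T (\<lambda>y. if y \<in> closure \<Omega> then \<phi> x y else 0)" if "T \<in> \<T>" for T
      by (rule polynomial_on_cong[OF \<phi>(2)[OF x that]]) (use cover that in auto)
    show "(if y \<in> closure \<Omega> then \<phi> x y else 0) = (if y = x then 1 else 0)" if "y \<in> mesh_nodes \<T>" for y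
      using \<phi>(3)[OF x that] mesh_nodes_in_closure that by auto
  qed auto
  then show ?thesis unfolding nodal_def by (rule someI[of is_nodal_basis])
qed

lemma nodal_delta: "x \<in> mesh_nodes \<T> \<Longrightarrow> y \<in> mesh_nodes \<T> \<Longrightarrow> nodal x y = (if y = x then 1 else 0)"
  using nodal by (simp add: is_nodal_basis_def)

lemma nodal_vector_in_V_h:
  assumes "x \<in> mesh_nodes \<T>"
  shows "(\<lambda>y. nodal x y *\<^sub>R w) \<in> V_h \<Omega> \<T>"
proof -
  have "polynomial_on 2 T (\<lambda>y. nodal x y * w $ i)" if "T \<in> \<T>" for T i
  proof -
    have "polynomial_on 2 T (nodal x)" using nodal assms that by (simp add: is_nodal_basis_def)
    from polynomial_on_lincomb[OF this this, of "w $ i" 0] show ?thesis by (simp add: mult.commute)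
  qed
  then show ?thesis
    using nodal assms by (auto simp: is_nodal_basis_def V_h_def C0_def intro!: continuous_intros)
qed

lemma Gamma1_node_not_Gamma0: "x \<in> N \<Longrightarrow> x \<notin> closure \<Gamma>0"
  using Gamma1_Int_closure_Gamma0 by blast

text \<open>The direction \<open>n\<close> meets the tangential condition, and a node on
  \<open>\<Gamma>1\<close> is not one of \<open>closure \<Gamma>0\<close>. These velocities probe
  one normal nodal value at a time.\<close>

lemma nodal_normal_in_V:
  assumes x: "x \<in> N"
  shows "(\<lambda>y. nodal x y *\<^sub>R n) \<in> V"
proof -
  have "nodal x y = 0" if "y \<in> closure \<Gamma>0 \<inter> mesh_nodes \<T>" for y
    using nodal_delta[of x y] x that Gamma1_node_not_Gamma0[OF x] by auto
  then show ?thesis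
    using nodal_vector_in_V_h[of x n] x normal_unit by (simp add: V_tau_h_def)
qed

lemma tr_nodal: "tr (\<lambda>y. nodal x y *\<^sub>R n) y = (if y \<in> closure \<Gamma>1 then nodal x y else 0)"
  by (simp add: normal_trace_def normal_unit)

lemma N_in_closure: "x \<in> N \<Longrightarrow> x \<in> closure \<Gamma>1"
  using closure_subset by blast

lemma endpoints_not_N: "A \<notin> N" "B \<notin> N"
  using side(1) by (auto simp: open_segment_def)

lemma nodal_endpoints: "x \<in> N \<Longrightarrow> nodal x A = 0" "x \<in> N \<Longrightarrow> nodal x B = 0"
  using nodal_delta[of x A] nodal_delta[of x B] endpoints_nodes endpoints_not_N by auto

text \<open>A quadratic basis function may change sign between nodes, but the rule sees only nodes,
  where its value is 0 or 1.\<close>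

lemma j_nodal: "x \<in> N \<Longrightarrow> j (\<lambda>y. nodal x y *\<^sub>R n) = quadrature (nodal x)"
  unfolding j_h_quadrature
  by (rule quadrature_cong) (auto simp: tr_nodal N_in_closure nodal_delta nodal_endpoints)

lemma finite_N: "finite N"
  using finite_mesh_nodes[OF mesh] by blast

text \<open>The trace on the side of the quadratic mesh function with nodal values \<open>c\<close>
  on \<open>N\<close>, cut off to fit the zero extension in \<open>Lambda_h\<close>.\<close>

definition interpolant :: "(point \<Rightarrow> real) \<Rightarrow> point \<Rightarrow> real" where
  "interpolant c = (\<lambda>y. if y \<in> closure \<Gamma>1 then \<Sum>x\<in>N. c x *\<^sub>R nodal x y else 0)"

lemma interpolant_node: "y \<in> N \<Longrightarrow> interpolant c y = c y"
proof -
  assume y: "y \<in> N"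
  have "(\<Sum>x\<in>N. c x *\<^sub>R nodal x y) = (\<Sum>x\<in>N. if x = y then c x else 0)"
    by (rule sum.cong) (use y nodal_delta in auto)
  also have "\<dots> = c y" using y finite_N by simp
  finally show ?thesis using N_in_closure[OF y] by (simp add: interpolant_def)
qed

text \<open>Each interval is a side of a triangle, on which the mesh function is quadratic.
  \<open>Lambda_tilde_h\<close> restricts nodal values only, so overshoot between nodes does no
  harm.\<close>

lemma interpolant_in_Lambda_tilde:
  assumes "\<And>x. x \<in> N \<Longrightarrow> \<bar>c x\<bar> \<le> 1"
  shows "interpolant c \<in> Lambda_tilde_h \<Gamma>1 \<T> m M"
proof -
  have sub: "closure \<Gamma>1 \<subseteq> closure \<Omega>"
  proof -
    have "\<Gamma>1 \<subseteq> closure \<Omega>" using boundary_parts_subset by (auto simp: frontier_def)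
    then show ?thesis by (rule closure_minimal) simp
  qed
  have "continuous_on (closure \<Gamma>1) (interpolant c)"
  proof (rule continuous_on_eq)
    show "continuous_on (closure \<Gamma>1) (\<lambda>y. \<Sum>x\<in>N. c x *\<^sub>R nodal x y)"
      using nodal sub by (intro continuous_intros) (auto simp: is_nodal_basis_def intro: continuous_on_subset)
  qed (simp add: interpolant_def)
  moreover have "polynomial_on 2 (closed_segment (M i) (M (i + 1))) (interpolant c)" if i: "i \<in> {1..m}" for i
  proof -
    obtain T where T: "T \<in> \<T>" "closed_segment (M i) (M (i + 1)) \<subseteq> T"
      using side_interval_is_edge[OF i] edge_of_imp_subset by blast
    have "polynomial_on 2 T (\<lambda>y. \<Sum>x\<in>K. c x *\<^sub>R nodal x y)" if "finite K" "K \<subseteq> N" for K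
      using that
    proof (induction K rule: finite_induct)
      case empty
      then show ?case by (simp add: polynomial_on_zero)
    next
      case (insert x K)
      have "polynomial_on 2 T (nodal x)" using insert nodal T(1) by (simp add: is_nodal_basis_def)
      from polynomial_on_lincomb[OF this, of "\<lambda>y. \<Sum>x\<in>K. c x *\<^sub>R nodal x y" "c x" 1] show ?case
        using insert by simp
    qed
    then have poly: "polynomial_on 2 (closed_segment (M i) (M (i + 1))) (\<lambda>y. \<Sum>x\<in>N. c x *\<^sub>R nodal x y)"
      using polynomial_on_subset[OF _ T(2)] finite_N by blast
    have seg: "closed_segment (M i) (M (i + 1)) \<subseteq> closure \<Gamma>1"
    proof -
      have "M i \<in> closed_segment A B" "M (i + 1) \<in> closed_segment A B"
        using i nodes unfolding side_vertices_def by auto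
      then show ?thesis unfolding side(3) by (intro closed_segment_subset convex_closed_segment)
    qed
    have "interpolant c y = (\<Sum>x\<in>N. c x *\<^sub>R nodal x y)" if "y \<in> closed_segment (M i) (M (i + 1))" for y
      using subsetD[OF seg that] by (simp add: interpolant_def)
    with poly show ?thesis by (rule polynomial_on_cong)
  qed
  moreover have "interpolant c A = 0" "interpolant c B = 0"
    using nodal_endpoints by (simp_all add: interpolant_def)
  then have "interpolant c (M 1) = 0" "interpolant c (M (m + 1)) = 0"
    using nodes by (simp_all add: side_vertices_def)
  ultimately show ?thesis
    using assms by (auto simp: Lambda_tilde_h_def Lambda_h_def C0_def interpolant_node)
      (auto simp: interpolant_def)
qed

lemma Lambda_tilde_bound:
  assumes v: "v \<in> V" and \<mu>: "\<mu> \<in> Lambda_tilde_h \<Gamma>1 \<T> m M"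
  shows "form_Lambda g m M (tr v) \<mu> \<le> j v"
  unfolding form_Lambda_quadrature j_h_quadrature
proof (rule quadrature_mono)
  fix x assume "x \<in> N"
  then have "\<bar>\<mu> x\<bar> \<le> 1" using \<mu> by (simp add: Lambda_tilde_h_def)
  then have "\<bar>tr v x * \<mu> x\<bar> \<le> \<bar>tr v x\<bar> * 1" unfolding abs_mult by (intro mult_left_mono) auto
  then show "tr v x * \<mu> x \<le> \<bar>tr v x\<bar>" by simp
qed (simp_all add: tr_endpoints[OF v])

text \<open>The sign turns each nodal product into an absolute value, so the bound of
  \<open>Lambda_tilde_bound\<close> is attained: \<open>j\<close> is the support function of the
  multiplier set at the normal trace.\<close>

lemma form_Lambda_sgn:
  assumes v: "v \<in> V"
  shows "form_Lambda g m M (tr v) (interpolant (\<lambda>x. sgn (tr v x))) = j v"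
  unfolding form_Lambda_quadrature j_h_quadrature
  by (rule quadrature_cong) (simp_all add: interpolant_node tr_endpoints[OF v] abs_sgn)

text \<open>On each interval the difference is quadratic and vanishes at both ends and at the
  midpoint.\<close>

lemma Lambda_h_determined_by_nodes:
  assumes "lam \<in> Lambda_h \<Gamma>1 m M" "\<mu> \<in> Lambda_h \<Gamma>1 m M"
    and eq: "\<And>x. x \<in> side_nodes \<Longrightarrow> x \<in> \<Gamma>1 \<Longrightarrow> lam x = \<mu> x"
  shows "lam = \<mu>"
proof
  fix y
  show "lam y = \<mu> y"
  proof (cases "y \<in> closure \<Gamma>1")
    case True
    then obtain i where i: "i \<in> {1..m}" "y \<in> closed_segment (M i) (M (i + 1))"
      using side_covered side(3) by blast
    have ends: "lam A = \<mu> A" "lam B = \<mu> B"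
      using assms(1,2) nodes by (simp_all add: Lambda_h_def side_vertices_def)
    have vert: "lam (M k) = \<mu> (M k)" if k: "k \<in> {1..m + 1}" for k
      using side_vertex_cases[OF k] ends eq[of "M k"] k by (auto simp: side_nodes_def)
    have mid: "lam (midpoint (M i) (M (i + 1))) = \<mu> (midpoint (M i) (M (i + 1)))"
      using side_midpoint(1)[OF i(1)] i(1) by (intro eq) (auto simp: side_nodes_def)
    have "polynomial_on 2 (closed_segment (M i) (M (i + 1))) (\<lambda>x. 1 * lam x + (-1) * \<mu> x)"
      by (rule polynomial_on_lincomb) (use assms(1,2) i(1) in \<open>auto simp: Lambda_h_def\<close>)
    from polynomial_on_2_segment_eq_0[OF this _ _ _ i(2)] have "1 * lam y + (-1) * \<mu> y = 0"
      using vert[of i] vert[of "i + 1"] mid i(1) by simp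
    then show ?thesis by simp
  qed (use assms in \<open>simp add: Lambda_h_def C0_def\<close>)
qed

text \<open>A linear form bounded by \<open>j\<close> only sees the normal nodal values on \<open>\<Gamma>\<^sub>1\<close>; the multiplier is
  obtained by testing with the nodal basis functions there.  A vanishing weight \<open>j\<close> of such a
  function forces the form to vanish on it, so the division by zero is harmless.\<close>

lemma multiplier_exists:
  assumes L: "linear_form V L" and bound: "\<And>v. v \<in> V \<Longrightarrow> \<bar>L v\<bar> \<le> j v"
  shows "\<exists>lam \<in> Lambda_tilde_h \<Gamma>1 \<T> m M. \<forall>v\<in>V. form_Lambda g m M (tr v) lam = L v"
proof -
  let ?e = "\<lambda>x y. nodal x y *\<^sub>R n"
  define c where "c x = L (?e x) / j (?e x)" for x
  have c_mult: "c x * j (?e x) = L (?e x)" and c_le: "\<bar>c x\<bar> \<le> 1" if "x \<in> N" for x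
  proof -
    have b: "\<bar>L (?e x)\<bar> \<le> j (?e x)" by (rule bound[OF nodal_normal_in_V[OF that]])
    then show "c x * j (?e x) = L (?e x)" by (cases "j (?e x) = 0") (auto simp: c_def)
    show "\<bar>c x\<bar> \<le> 1" using b j_nonneg[of "?e x"] by (cases "j (?e x) = 0") (auto simp: c_def divide_le_eq)
  qed
  have "form_Lambda g m M (tr v) (interpolant c) = L v" if v: "v \<in> V" for v
  proof -
    \<comment> \<open>\<open>?v\<close> keeps only the normal nodal values of \<open>v\<close> on
      the open side; the remainder has zero trace at every quadrature point, so \<open>j\<close>,
      and with it \<open>L\<close>, vanishes on the remainder.\<close>
    let ?v = "\<lambda>y. \<Sum>x\<in>N. tr v x *\<^sub>R ?e x y"
    have v': "?v \<in> V" by (intro linear_space_sum linear_space_V finite_N nodal_normal_in_V)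
    have d: "(\<lambda>y. v y - ?v y) \<in> V" by (rule linear_space_diff[OF linear_space_V v v'])
    have "tr (\<lambda>y. v y - ?v y) y = 0" if "y \<in> N" for y
    proof -
      have "tr ?v y = interpolant (tr v) y"
        by (simp add: normal_trace_def interpolant_def inner_sum_left normal_unit)
      then have "tr ?v y = tr v y" using interpolant_node[OF that] by simp
      then show ?thesis by (simp add: normal_trace_def inner_diff_left split: if_splits)
    qed
    then have "j (\<lambda>y. v y - ?v y) = quadrature (\<lambda>x. 0)"
      unfolding j_h_quadrature using tr_endpoints[OF d] by (intro quadrature_cong) auto
    then have "L (\<lambda>y. v y - ?v y) = 0" using bound[OF d] by (simp add: quadrature_def)
    then have "L v = L ?v" using linear_form_diff[OF L v v'] by simp
    also have "\<dots> = (\<Sum>x\<in>N. tr v x * L (?e x))"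
      by (rule linear_form_sum[OF linear_space_V L finite_N nodal_normal_in_V])
    also have "\<dots> = (\<Sum>x\<in>N. (tr v x * c x) * quadrature (nodal x))"
      by (rule sum.cong) (simp_all add: j_nodal flip: c_mult)
    also have "\<dots> = quadrature (\<lambda>y. \<Sum>x\<in>N. (tr v x * c x) *\<^sub>R nodal x y)"
      using linear_form_sum[OF _ linear_form_quadrature finite_N, of nodal "\<lambda>x. tr v x * c x"]
      by (simp only: linear_space_def UNIV_I simp_thms ball_UNIV)
    also have "\<dots> = quadrature (\<lambda>y. tr v y * interpolant c y)"
    proof (rule quadrature_cong)
      fix y assume y: "y \<in> N"
      have "(\<Sum>x\<in>N. (tr v x * c x) *\<^sub>R nodal x y) = interpolant (\<lambda>x. tr v x * c x) y"
        using N_in_closure[OF y] by (simp add: interpolant_def)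
      then show "(\<Sum>x\<in>N. (tr v x * c x) *\<^sub>R nodal x y) = tr v y * interpolant c y"
        using interpolant_node[OF y] by simp
    qed (simp_all add: nodal_endpoints tr_endpoints[OF v])
    finally show ?thesis by (simp add: form_Lambda_quadrature)
  qed
  moreover have "interpolant c \<in> Lambda_tilde_h \<Gamma>1 \<T> m M"
    by (rule interpolant_in_Lambda_tilde) (rule c_le)
  ultimately show ?thesis by (intro bexI[of _ "interpolant c"] ballI)
qed

text \<open>Pairing with a nodal normal velocity returns the nodal value of the multiplier times a
  weight, which is positive because \<open>g\<close> is positive on the open side.\<close>

lemma multiplier_unique:
  assumes "lam \<in> Lambda_tilde_h \<Gamma>1 \<T> m M" "\<mu> \<in> Lambda_tilde_h \<Gamma>1 \<T> m M"
    and eq: "\<And>v. v \<in> V \<Longrightarrow> form_Lambda g m M (tr v) lam = form_Lambda g m M (tr v) \<mu>"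
  shows "lam = \<mu>"
proof (rule Lambda_h_determined_by_nodes)
  show "lam \<in> Lambda_h \<Gamma>1 m M" "\<mu> \<in> Lambda_h \<Gamma>1 m M"
    using assms(1,2) by (simp_all add: Lambda_tilde_h_def)
  fix x assume x: "x \<in> side_nodes" "x \<in> \<Gamma>1"
  then have xN: "x \<in> N"
    using side_vertex_cases side_midpoint(1) endpoints_nodes by (fastforce simp: side_nodes_def)
  have *: "form_Lambda g m M (tr (\<lambda>y. nodal x y *\<^sub>R n)) \<kappa> = \<kappa> x * j (\<lambda>y. nodal x y *\<^sub>R n)" for \<kappa>
    unfolding form_Lambda_quadrature j_nodal[OF xN] quadrature_mult[symmetric]
    by (rule quadrature_cong) (use xN in \<open>auto simp: tr_nodal nodal_delta nodal_endpoints N_in_closure\<close>)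
  have "j (\<lambda>y. nodal x y *\<^sub>R n) > 0"
    unfolding j_h_quadrature
    by (rule quadrature_pos[OF _ x]) (use xN in \<open>auto simp: tr_nodal nodal_delta N_in_closure\<close>)
  then show "lam x = \<mu> x" using eq[OF nodal_normal_in_V[OF xN]] unfolding * by simp
qed

text \<open>Convexity of \<open>j\<close> turns minimality along the segment from \<open>u\<close> to \<open>v\<close> into the variational
  inequality.\<close>

lemma minimizer_solves_VI:
  assumes u: "u \<in> V\<sigma>"
    and min: "\<And>v. v \<in> V\<sigma> \<Longrightarrow> form_a \<Omega> \<nu> u u / 2 + j u - L2_inner \<Omega> f u
        \<le> form_a \<Omega> \<nu> v v / 2 + j v - L2_inner \<Omega> f v"
    and v: "v \<in> V\<sigma>"
  shows "form_a \<Omega> \<nu> u v - form_a \<Omega> \<nu> u u + j v - j u \<ge> L2_inner \<Omega> f v - L2_inner \<Omega> f u"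
proof (rule ccontr)
  let ?a = "form_a \<Omega> \<nu>" and ?l = "L2_inner \<Omega> f"
  \<comment> \<open>\<open>X\<close> is the defect in the inequality and \<open>D\<close> the
    quadratic remainder: on the way from \<open>u\<close> to \<open>v\<close> the functional grows
    by at most \<open>t * X + t\<^sup>2 * D / 2\<close>.\<close>
  define X D where "X = ?a u v - ?a u u + j v - j u - (?l v - ?l u)"
    and "D = ?a (\<lambda>x. v x - u x) (\<lambda>x. v x - u x)"
  assume "\<not> ?thesis"
  then have X: "X < 0" by (simp add: X_def)
  note uV = V\<sigma>_subset(2)[OF u] and vV = V\<sigma>_subset(2)[OF v]
  have dV: "(\<lambda>x. v x - u x) \<in> V_h \<Omega> \<T>" by (rule linear_space_diff[OF linear_space_V_h vV uV])
  have D: "D \<ge> 0" unfolding D_def by (rule form_a_nonneg[OF nu])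
  have D_eq: "D = ?a v v - 2 * ?a u v + ?a u u"
  proof -
    let ?d = "\<lambda>x. v x - u x"
    have "D = ?a v ?d - ?a u ?d"
      unfolding D_def linear_form_diff[OF linear_form_a[OF dV] vV uV]
      by (simp only: form_a_sym[of \<nu> ?d v] form_a_sym[of \<nu> ?d u])
    also have "\<dots> = (?a v v - ?a v u) - (?a u v - ?a u u)"
      by (simp only: linear_form_diff[OF linear_form_a[OF vV] vV uV] linear_form_diff[OF linear_form_a[OF uV] vV uV])
    also have "\<dots> = ?a v v - 2 * ?a u v + ?a u u"
      unfolding form_a_sym[of \<nu> v u] by simp
    finally show ?thesis .
  qed
  \<comment> \<open>Small enough that \<open>t * D \<le> - X\<close>, which keeps
    \<open>X + t * D / 2\<close> negative; \<open>D + 1\<close> avoids a division by zero.\<close>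
  define t where "t = min 1 (- X / (D + 1))"
  have t: "0 < t" "t \<le> 1" using X D by (auto simp: t_def divide_neg_pos)
  let ?w = "\<lambda>x. (1 - t) *\<^sub>R u x + t *\<^sub>R v x"
  have w: "?w \<in> V\<sigma>" by (rule linear_space_lincomb[OF linear_space_V\<sigma> u v])
  have "?a ?w ?w = (1 - t) * ((1 - t) * ?a u u + t * ?a u v) + t * ((1 - t) * ?a u v + t * ?a v v)"
    unfolding form_a_lincomb_right[OF uV vV V\<sigma>_subset(2)[OF w]]
      form_a_lincomb_left[OF uV vV uV] form_a_lincomb_left[OF uV vV vV] form_a_sym[of \<nu> v u] ..
  also have "\<dots> = ?a u u + 2 * t * (?a u v - ?a u u) + t\<^sup>2 * D"
    unfolding D_eq by (simp add: algebra_simps power2_eq_square)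
  finally have aw: "?a ?w ?w = ?a u u + 2 * t * (?a u v - ?a u u) + t\<^sup>2 * D" .
  have jw: "j ?w \<le> (1 - t) * j u + t * j v" using t by (intro j_convex) auto
  have lw: "?l ?w = (1 - t) * ?l u + t * ?l v" by (rule L2_inner_lincomb[OF f uV vV])
  have "0 \<le> t * X + t\<^sup>2 * D / 2"
  proof -
    have "?a u u / 2 + j u - ?l u \<le> (?a u u + 2 * t * (?a u v - ?a u u) + t\<^sup>2 * D) / 2
        + ((1 - t) * j u + t * j v) - ((1 - t) * ?l u + t * ?l v)"
      using min[OF w] jw unfolding aw lw by linarith
    moreover have "(?a u u + 2 * t * (?a u v - ?a u u) + t\<^sup>2 * D) / 2
        + ((1 - t) * j u + t * j v) - ((1 - t) * ?l u + t * ?l v) =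
        ?a u u / 2 + j u - ?l u + (t * X + t\<^sup>2 * D / 2)"
      by (simp add: X_def field_simps)
    ultimately show ?thesis by linarith
  qed
  then have "0 \<le> t * (X + t * D / 2)" by (simp add: algebra_simps power2_eq_square)
  then have "0 \<le> X + t * D / 2" using t(1) by (simp add: zero_le_mult_iff)
  moreover have "t * D \<le> - X"
  proof -
    have "t * D \<le> - X / (D + 1) * D" using D by (intro mult_right_mono) (auto simp: t_def)
    also have "\<dots> \<le> - X"
    proof -
      have "D / (D + 1) \<le> 1" using D by simp
      then have "- X * (D / (D + 1)) \<le> - X * 1" using X by (intro mult_left_mono) auto
      then show ?thesis by simp
    qed
    finally show ?thesis .
  qed
  ultimately show False using X by linarith
qed

end

subsection \<open>The discrete problems\<close>

context friction_problem
begin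

section \<open>Nodal coordinates of velocities\<close>

definition nodal_combination :: "(point \<times> 2 \<Rightarrow> real) \<Rightarrow> point \<Rightarrow> point" where
  "nodal_combination c = (\<lambda>y. \<Sum>k\<in>mesh_nodes \<T> \<times> UNIV. c k *\<^sub>R (nodal (fst k) y *\<^sub>R axis (snd k) 1))"

lemma finite_indices: "finite (mesh_nodes \<T> \<times> (UNIV :: 2 set))"
  using finite_mesh_nodes[OF mesh] by simp

lemma nodal_axis_in_V_h: "k \<in> mesh_nodes \<T> \<times> UNIV \<Longrightarrow> (\<lambda>y. nodal (fst k) y *\<^sub>R axis (snd k) 1) \<in> V_h \<Omega> \<T>"
  by (intro nodal_vector_in_V_h) auto

lemma nodal_combination_in_V_h: "nodal_combination c \<in> V_h \<Omega> \<T>"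
  unfolding nodal_combination_def
  by (intro linear_space_sum linear_space_V_h finite_indices nodal_axis_in_V_h)

lemma linear_form_nodal_combination:
  assumes "linear_form (V_h \<Omega> \<T>) L"
  shows "L (nodal_combination c) =
    (\<Sum>k\<in>mesh_nodes \<T> \<times> UNIV. c k * L (\<lambda>y. nodal (fst k) y *\<^sub>R axis (snd k) 1))"
  unfolding nodal_combination_def
  by (rule linear_form_sum[OF linear_space_V_h assms finite_indices nodal_axis_in_V_h])

lemma linear_form_nodal_combination_continuous:
  assumes "linear_form (V_h \<Omega> \<T>) L"
  shows "continuous_on UNIV (\<lambda>c. L (nodal_combination c))"
  unfolding linear_form_nodal_combination[OF assms]
  by (intro continuous_intros continuous_on_coordinate)

lemma nodal_combination_continuous: "continuous_on UNIV (\<lambda>c. nodal_combination c y)"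
  unfolding nodal_combination_def by (intro continuous_intros continuous_on_coordinate)

lemma nodal_combination_scale: "nodal_combination (\<lambda>k. t * c k) = (\<lambda>y. t *\<^sub>R nodal_combination c y)"
  by (simp add: nodal_combination_def scaleR_sum_right mult.assoc)

lemma nodal_combination_zero: "nodal_combination (\<lambda>k. 0) = (\<lambda>y. 0)"
  by (simp add: nodal_combination_def)

lemma nodal_combination_node:
  assumes "x \<in> mesh_nodes \<T>"
  shows "nodal_combination c x $ i = c (x, i)"
proof -
  have "nodal_combination c x $ i =
      (\<Sum>k\<in>mesh_nodes \<T> \<times> UNIV. c k * (nodal (fst k) x * axis (snd k) 1 $ i))"
    by (simp add: nodal_combination_def mult.assoc)
  also have "\<dots> = (\<Sum>k\<in>mesh_nodes \<T> \<times> UNIV. if k = (x, i) then c k else 0)"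
    using assms by (intro sum.cong) (auto simp: axis_def nodal_delta split: if_splits)
  also have "\<dots> = c (x, i)" using finite_indices assms by simp
  finally show ?thesis .
qed

lemma nodal_combination_surj:
  assumes v: "v \<in> V_h \<Omega> \<T>"
  shows "nodal_combination (\<lambda>k. if fst k \<in> mesh_nodes \<T> then v (fst k) $ snd k else 0) = v"
    (is "nodal_combination ?c = v")
proof -
  have "(\<lambda>x. nodal_combination ?c x - v x) = (\<lambda>x. 0)"
  proof (rule V_h_eq_0_if_nodal_eq_0)
    show "(\<lambda>x. nodal_combination ?c x - v x) \<in> V_h \<Omega> \<T>"
      by (intro linear_space_diff linear_space_V_h nodal_combination_in_V_h v)
    show "nodal_combination ?c x - v x = 0" if "x \<in> mesh_nodes \<T>" for x
      by (simp add: vec_eq_iff nodal_combination_node[OF that] that)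
  qed
  then show ?thesis by (simp add: fun_eq_iff)
qed

text \<open>Every defining condition of \<open>V\<sigma>\<close> is a continuous equation in the
  coordinates, and closed sets may be intersected over all pressures.\<close>

lemma closed_coordinates_V\<sigma>:
  "closed {c. (\<forall>k. k \<notin> mesh_nodes \<T> \<times> UNIV \<longrightarrow> c k = 0) \<and> nodal_combination c \<in> V\<sigma>}"
proof -
  have "{c. (\<forall>k. k \<notin> mesh_nodes \<T> \<times> UNIV \<longrightarrow> c k = 0) \<and> nodal_combination c \<in> V\<sigma>} =
      (\<Inter>k\<in>- (mesh_nodes \<T> \<times> UNIV). {c. c k = 0})
      \<inter> (\<Inter>x\<in>closure \<Gamma>0 \<inter> mesh_nodes \<T>. {c. nodal_combination c x = 0})
      \<inter> (\<Inter>x\<in>N. {c. nodal_combination c x \<bullet> tangent n = 0})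
      \<inter> (\<Inter>q\<in>Q_h \<Omega> \<T>. {c. form_b \<Omega> (nodal_combination c) q = 0})"
    using nodal_combination_in_V_h by (auto simp: V_tau_sigma_h_def V_tau_h_def)
  moreover have "closed \<dots>"
    by (intro closed_Int closed_INT ballI closed_Collect_eq continuous_intros continuous_on_coordinate
        nodal_combination_continuous linear_form_nodal_combination_continuous linear_form_b)
  ultimately show ?thesis by simp
qed

text \<open>The minimisation takes place on coordinates, where compactness is available; every
  velocity in \<open>V\<sigma>\<close> has coordinates in the constraint set.\<close>

lemma energy_minimizer_exists:
  "\<exists>u\<in>V\<sigma>. \<forall>v\<in>V\<sigma>. form_a \<Omega> \<nu> u u / 2 + j u - L2_inner \<Omega> f u
      \<le> form_a \<Omega> \<nu> v v / 2 + j v - L2_inner \<Omega> f v"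
proof -
  let ?n = nodal_combination
  let ?K = "mesh_nodes \<T> \<times> (UNIV :: 2 set)"
  let ?W = "{c. (\<forall>k. k \<notin> ?K \<longrightarrow> c k = 0) \<and> ?n c \<in> V\<sigma>}"
  let ?q = "\<lambda>c. form_a \<Omega> \<nu> (?n c) (?n c)" and ?j = "\<lambda>c. j (?n c)" and ?l = "\<lambda>c. L2_inner \<Omega> f (?n c)"
  have zero: "(\<lambda>x. 0) \<in> V\<sigma>" using linear_space_V\<sigma> by (simp add: linear_space_def)
  have "\<exists>c\<in>?W. \<forall>d\<in>?W. ?q c / 2 + ?j c - ?l c \<le> ?q d / 2 + ?j d - ?l d"
  proof (rule coercive_minimizer_exists[OF finite_indices closed_coordinates_V\<sigma>])
    show "?W \<subseteq> {c. \<forall>k. k \<notin> ?K \<longrightarrow> c k = 0}" by blast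
    show "(\<lambda>k. 0) \<in> ?W" using zero by (simp add: nodal_combination_zero)
    show "(\<lambda>k. t * c k) \<in> ?W" if "c \<in> ?W" for c t
      using that linear_space_scale[OF linear_space_V\<sigma>] by (simp add: nodal_combination_scale)
    show "continuous_on UNIV ?q"
    proof -
      \<comment> \<open>Both arguments depend on \<open>c\<close>. Expanding one of them leaves
        products of a coordinate with a continuous linear form.\<close>
      have "?q c = (\<Sum>k\<in>?K. c k * form_a \<Omega> \<nu> (\<lambda>y. nodal (fst k) y *\<^sub>R axis (snd k) 1) (?n c))" for c
        unfolding linear_form_nodal_combination[OF linear_form_a[OF nodal_combination_in_V_h]]
        by (intro sum.cong refl arg_cong2[of _ _ _ _ "(*)"] form_a_sym)
      moreover have "continuous_on UNIV (\<lambda>c. \<Sum>k\<in>?K. c k * form_a \<Omega> \<nu> (\<lambda>y. nodal (fst k) y *\<^sub>R axis (snd k) 1) (?n c))"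
        by (intro continuous_intros continuous_on_coordinate linear_form_nodal_combination_continuous
            linear_form_a nodal_axis_in_V_h)
      ultimately show ?thesis by simp
    qed
    show "continuous_on UNIV ?j"
    proof -
      have "continuous_on UNIV (\<lambda>c. tr (?n c) x)" for x
        by (cases "x \<in> closure \<Gamma>1")
          (auto simp: normal_trace_def intro!: continuous_intros nodal_combination_continuous)
      then show ?thesis
        unfolding j_h_quadrature quadrature_def by (intro continuous_intros) auto
    qed
    show "continuous_on UNIV ?l"
      by (rule linear_form_nodal_combination_continuous[OF linear_form_L2])
    show "?q (\<lambda>k. t * c k) = t\<^sup>2 * ?q c" for c t
    proof -
      note V = nodal_combination_in_V_h[of c]
      show ?thesis
        unfolding nodal_combination_scale linear_form_scale[OF linear_form_a[OF linear_space_scale[OF linear_space_V_h V]] V]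
          form_a_sym[of \<nu> "\<lambda>y. t *\<^sub>R ?n c y"] linear_form_scale[OF linear_form_a[OF V] V]
        by (simp add: power2_eq_square)
    qed
    show "?q c > 0" if c: "c \<in> ?W" "c \<noteq> (\<lambda>k. 0)" for c
    proof -
      have "?n c \<noteq> (\<lambda>x. 0)"
      proof
        assume 0: "?n c = (\<lambda>x. 0)"
        have "c k = 0" for k
        proof (cases "k \<in> ?K")
          case True
          then show ?thesis using nodal_combination_node[of "fst k" c "snd k"] 0 by auto
        qed (use c in blast)
        then show False using c(2) by blast
      qed
      then have "?q c \<noteq> 0" using form_a_definite[of "?n c"] c(1) V\<sigma>_subset(1) by blast
      then show ?thesis using form_a_nonneg[OF nu, of "?n c"] by simp
    qed
    show "?j c \<ge> 0" for c by (rule j_nonneg)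
    show "?j (\<lambda>k. 0) = 0" using j_scale[of 0 "\<lambda>x. 0"] by (simp add: nodal_combination_zero)
    show "?l (\<lambda>k. t * c k) = t * ?l c" for c t
      unfolding nodal_combination_scale by (rule linear_form_scale[OF linear_form_L2 nodal_combination_in_V_h])
  qed
  then obtain c where c: "c \<in> ?W" "\<forall>d\<in>?W. ?q c / 2 + ?j c - ?l c \<le> ?q d / 2 + ?j d - ?l d" by blast
  have "?q c / 2 + ?j c - ?l c \<le> form_a \<Omega> \<nu> v v / 2 + j v - L2_inner \<Omega> f v" if v: "v \<in> V\<sigma>" for v
  proof -
    let ?d = "\<lambda>k. if fst k \<in> mesh_nodes \<T> then v (fst k) $ snd k else 0"
    have nd: "?n ?d = v" by (rule nodal_combination_surj[OF V\<sigma>_subset(2)[OF v]])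
    have "?d \<in> ?W"
    proof (intro CollectI conjI allI impI)
      show "?d k = 0" if "k \<notin> ?K" for k using that by (simp add: mem_Times_iff)
      show "?n ?d \<in> V\<sigma>" unfolding nd by (rule v)
    qed
    from bspec[OF c(2) this] show ?thesis unfolding nd .
  qed
  then show ?thesis using c(1) by blast
qed

section \<open>Unique solvability and equivalence\<close>

abbreviation "VI\<sigma> \<equiv> solves_VI_h_sigma \<Omega> \<Gamma>0 \<Gamma>1 n \<nu> f g \<T> m M"
abbreviation "VI \<equiv> solves_VI_h \<Omega> \<Gamma>0 \<Gamma>1 n \<nu> f g \<T> m M"
abbreviation "VE \<equiv> solves_VE_h \<Omega> \<Gamma>0 \<Gamma>1 n \<nu> f g \<T> m M"

lemma form_a_diff:
  assumes "u \<in> V_h \<Omega> \<T>" "v \<in> V_h \<Omega> \<T>" "w \<in> V_h \<Omega> \<T>"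
  shows "form_a \<Omega> \<nu> w (\<lambda>x. v x - u x) = form_a \<Omega> \<nu> w v - form_a \<Omega> \<nu> w u"
  by (rule linear_form_diff[OF linear_form_a[OF assms(3)] assms(2,1)])

lemma form_b_diff:
  assumes "u \<in> V_h \<Omega> \<T>" "v \<in> V_h \<Omega> \<T>" "q \<in> Q_h \<Omega> \<T>"
  shows "form_b \<Omega> (\<lambda>x. v x - u x) q = form_b \<Omega> v q - form_b \<Omega> u q"
  by (rule linear_form_diff[OF linear_form_b[OF assms(3)] assms(2,1)])

lemma L2_inner_diff:
  assumes "u \<in> V_h \<Omega> \<T>" "v \<in> V_h \<Omega> \<T>"
  shows "L2_inner \<Omega> f (\<lambda>x. v x - u x) = L2_inner \<Omega> f v - L2_inner \<Omega> f u"
  by (rule linear_form_diff[OF linear_form_L2 assms(2,1)])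

text \<open>Brings the inequality into the form \<open>L v - L u + j v - j u \<ge> 0\<close> that
  \<open>variational_inequality_energy\<close> expects.\<close>

lemma VI\<sigma>_iff:
  "VI\<sigma> u \<longleftrightarrow> u \<in> V\<sigma> \<and> (\<forall>v\<in>V\<sigma>. (form_a \<Omega> \<nu> u v - L2_inner \<Omega> f v)
     - (form_a \<Omega> \<nu> u u - L2_inner \<Omega> f u) + j v - j u \<ge> 0)"
proof -
  have eqs: "form_a \<Omega> \<nu> u (\<lambda>x. v x - u x) = form_a \<Omega> \<nu> u v - form_a \<Omega> \<nu> u u"
    "L2_inner \<Omega> f (\<lambda>x. v x - u x) = L2_inner \<Omega> f v - L2_inner \<Omega> f u" if "u \<in> V\<sigma>" "v \<in> V\<sigma>" for v
    using that[THEN V\<sigma>_subset(2)] by (simp_all only: form_a_diff L2_inner_diff)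
  have "form_a \<Omega> \<nu> u (\<lambda>x. v x - u x) + j v - j u \<ge> L2_inner \<Omega> f (\<lambda>x. v x - u x) \<longleftrightarrow>
      (form_a \<Omega> \<nu> u v - L2_inner \<Omega> f v) - (form_a \<Omega> \<nu> u u - L2_inner \<Omega> f u) + j v - j u \<ge> 0"
    if "u \<in> V\<sigma>" "v \<in> V\<sigma>" for v
    unfolding eqs[OF that] by (intro iffI; linarith)
  then show ?thesis unfolding solves_VI_h_sigma_def by blast
qed

lemma VI_iff:
  "VI u p \<longleftrightarrow> u \<in> V \<and> p \<in> Q_h \<Omega> \<T> \<and> (\<forall>q\<in>Q_h \<Omega> \<T>. form_b \<Omega> u q = 0) \<and>
    (\<forall>v\<in>V. (form_a \<Omega> \<nu> u v + form_b \<Omega> v p - L2_inner \<Omega> f v)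
     - (form_a \<Omega> \<nu> u u + form_b \<Omega> u p - L2_inner \<Omega> f u) + j v - j u \<ge> 0)"
proof -
  have eqs: "form_a \<Omega> \<nu> u (\<lambda>x. v x - u x) = form_a \<Omega> \<nu> u v - form_a \<Omega> \<nu> u u"
    "form_b \<Omega> (\<lambda>x. v x - u x) p = form_b \<Omega> v p - form_b \<Omega> u p"
    "L2_inner \<Omega> f (\<lambda>x. v x - u x) = L2_inner \<Omega> f v - L2_inner \<Omega> f u"
    if "u \<in> V" "v \<in> V" "p \<in> Q_h \<Omega> \<T>" for v
    using that(1,2)[THEN V_subset] that(3) by (simp_all only: form_a_diff form_b_diff L2_inner_diff)
  have "form_a \<Omega> \<nu> u (\<lambda>x. v x - u x) + form_b \<Omega> (\<lambda>x. v x - u x) p + j v - j u \<ge> L2_inner \<Omega> f (\<lambda>x. v x - u x) \<longleftrightarrow>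
      (form_a \<Omega> \<nu> u v + form_b \<Omega> v p - L2_inner \<Omega> f v)
        - (form_a \<Omega> \<nu> u u + form_b \<Omega> u p - L2_inner \<Omega> f u) + j v - j u \<ge> 0"
    if "u \<in> V" "v \<in> V" "p \<in> Q_h \<Omega> \<T>" for v
    unfolding eqs[OF that] by (intro iffI; linarith)
  then show ?thesis unfolding solves_VI_h_def by blast
qed

lemma VI\<sigma>_unique_solution: "\<exists>!u. VI\<sigma> u"
proof (rule ex_ex1I)
  obtain u where u: "u \<in> V\<sigma>" "\<forall>v\<in>V\<sigma>. form_a \<Omega> \<nu> u u / 2 + j u - L2_inner \<Omega> f u
      \<le> form_a \<Omega> \<nu> v v / 2 + j v - L2_inner \<Omega> f v"
    using energy_minimizer_exists by blast
  have "(form_a \<Omega> \<nu> u v - L2_inner \<Omega> f v) - (form_a \<Omega> \<nu> u u - L2_inner \<Omega> f u) + j v - j u \<ge> 0"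
    if "v \<in> V\<sigma>" for v
    using minimizer_solves_VI[OF u(1) bspec[OF u(2)] that] by linarith
  then have "VI\<sigma> u" unfolding VI\<sigma>_iff using u(1) by blast
  then show "\<exists>u. VI\<sigma> u" by blast
next
  let ?a = "form_a \<Omega> \<nu>"
  fix u w assume u: "VI\<sigma> u" and w: "VI\<sigma> w"
  have uw: "u \<in> V\<sigma>" "w \<in> V\<sigma>" using u w by (simp_all add: VI\<sigma>_iff)
  let ?d = "\<lambda>x. u x - w x"
  have d: "?d \<in> V\<sigma>" by (rule linear_space_diff[OF linear_space_V\<sigma> uw])
  note V = V\<sigma>_subset(2)[OF uw(1)] V\<sigma>_subset(2)[OF uw(2)] V\<sigma>_subset(2)[OF d]
  \<comment> \<open>Each solution is a test function for the other; the two inequalities add up to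
    \<open>?a ?d ?d \<le> 0\<close>.\<close>
  have "(?a u w - L2_inner \<Omega> f w) - (?a u u - L2_inner \<Omega> f u) + j w - j u \<ge> 0"
    "(?a w u - L2_inner \<Omega> f u) - (?a w w - L2_inner \<Omega> f w) + j u - j w \<ge> 0"
    using u w uw unfolding VI\<sigma>_iff by blast+
  moreover have "?a ?d ?d = (?a u u - ?a u w) - (?a w u - ?a w w)"
    unfolding linear_form_diff[OF linear_form_a[OF V(3)] V(1,2)]
      form_a_sym[of \<nu> ?d u] form_a_sym[of \<nu> ?d w]
      linear_form_diff[OF linear_form_a[OF V(1)] V(1,2)] linear_form_diff[OF linear_form_a[OF V(2)] V(1,2)] ..
  ultimately have "?a ?d ?d = 0" using form_a_nonneg[OF nu, of ?d] by linarith
  then have "?d = (\<lambda>x. 0)" using form_a_definite V\<sigma>_subset(1)[OF d] by blast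
  then show "u = w" by (simp add: fun_eq_iff)
qed

lemma VI\<sigma>_energy:
  assumes "VI\<sigma> u"
  shows "form_a \<Omega> \<nu> u u + j u = L2_inner \<Omega> f u"
proof -
  let ?L = "\<lambda>v. form_a \<Omega> \<nu> u v - L2_inner \<Omega> f v"
  have u: "u \<in> V\<sigma>" using assms by (simp add: VI\<sigma>_iff)
  have "linear_form V\<sigma> ?L"
    by (rule linear_form_subset[OF linear_form_minus[OF linear_form_a linear_form_L2]])
      (use u V\<sigma>_subset(2) in auto)
  from variational_inequality_energy(1)[OF linear_space_V\<sigma> this u, of j]
  show ?thesis using assms by (simp add: VI\<sigma>_iff j_scale)
qed

text \<open>The multiplier represents the negative residual. By the energy identity its pairing with
  the normal trace of \<open>u\<close> equals \<open>j u\<close>, the largest value an admissible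
  multiplier can give.\<close>

lemma VI_imp_VE:
  assumes "VI u p"
  shows "\<exists>!lam. VE u p lam"
proof -
  let ?L = "\<lambda>v. form_a \<Omega> \<nu> u v + form_b \<Omega> v p - L2_inner \<Omega> f v"
  have up: "u \<in> V" "p \<in> Q_h \<Omega> \<T>" and div: "\<forall>q\<in>Q_h \<Omega> \<T>. form_b \<Omega> u q = 0"
    using assms by (simp_all add: VI_iff)
  have sub: "V \<subseteq> V_h \<Omega> \<T>" using V_subset by blast
  have L: "linear_form V ?L"
    by (rule linear_form_subset[OF linear_form_minus[OF linear_form_plus[OF linear_form_a linear_form_b] linear_form_L2]])
      (use up sub in auto)
  have vi: "?L v - ?L u + j v - j u \<ge> 0" if "v \<in> V" for v using assms that unfolding VI_iff by blast
  note en = variational_inequality_energy[OF linear_space_V L up(1), of j, OF j_scale vi]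
  have bound: "\<bar>- ?L v\<bar> \<le> j v" if "v \<in> V" for v using en(2)[OF _ that] by simp
  obtain lam where lam: "lam \<in> Lambda_tilde_h \<Gamma>1 \<T> m M"
    "\<forall>v\<in>V. form_Lambda g m M (tr v) lam = - ?L v"
    using multiplier_exists[OF linear_form_uminus[OF L] bound] by blast
  have "form_Lambda g m M (tr u) (\<lambda>x. \<mu> x - lam x) \<le> 0" if "\<mu> \<in> Lambda_tilde_h \<Gamma>1 \<T> m M" for \<mu>
  proof -
    have "form_Lambda g m M (tr u) (\<lambda>x. \<mu> x - lam x) =
        form_Lambda g m M (tr u) \<mu> - form_Lambda g m M (tr u) lam"
      using quadrature_lincomb[of 1 "\<lambda>x. tr u x * \<mu> x" "-1" "\<lambda>x. tr u x * lam x"]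
      by (simp add: form_Lambda_quadrature algebra_simps)
    then show ?thesis using Lambda_tilde_bound[OF up(1) that] bspec[OF lam(2) up(1)] en(1) by linarith
  qed
  then have "VE u p lam" unfolding solves_VE_h_def using up div lam by simp
  moreover have "\<mu> = lam" if "VE u p \<mu>" for \<mu>
  proof (rule multiplier_unique)
    show "\<mu> \<in> Lambda_tilde_h \<Gamma>1 \<T> m M" using that by (simp add: solves_VE_h_def)
    show "form_Lambda g m M (tr v) \<mu> = form_Lambda g m M (tr v) lam" if v: "v \<in> V" for v
    proof -
      have "form_a \<Omega> \<nu> u v + form_b \<Omega> v p + form_Lambda g m M (tr v) \<mu> = L2_inner \<Omega> f v"
        using \<open>VE u p \<mu>\<close> v unfolding solves_VE_h_def by blast
      then show ?thesis using bspec[OF lam(2) v] by linarith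
    qed
  qed (rule lam)
  ultimately show ?thesis by blast
qed

lemma VE_imp_VI:
  assumes "VE u p lam"
  shows "VI u p"
  unfolding VI_iff
proof (intro conjI ballI)
  show u: "u \<in> V" and "p \<in> Q_h \<Omega> \<T>" using assms by (simp_all add: solves_VE_h_def)
  show "form_b \<Omega> u q = 0" if "q \<in> Q_h \<Omega> \<T>" for q using assms that by (simp add: solves_VE_h_def)
  have lam: "lam \<in> Lambda_tilde_h \<Gamma>1 \<T> m M" using assms by (simp add: solves_VE_h_def)
  have eq: "form_a \<Omega> \<nu> u v + form_b \<Omega> v p + form_Lambda g m M (tr v) lam = L2_inner \<Omega> f v" if "v \<in> V" for v
    using assms that unfolding solves_VE_h_def by blast
  let ?\<mu> = "interpolant (\<lambda>x. sgn (tr u x))"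
  have "?\<mu> \<in> Lambda_tilde_h \<Gamma>1 \<T> m M" by (rule interpolant_in_Lambda_tilde) (simp add: abs_sgn_eq)
  then have "form_Lambda g m M (tr u) (\<lambda>x. ?\<mu> x - lam x) \<le> 0"
    using assms unfolding solves_VE_h_def by blast
  moreover have "form_Lambda g m M (tr u) (\<lambda>x. ?\<mu> x - lam x) =
      form_Lambda g m M (tr u) ?\<mu> - form_Lambda g m M (tr u) lam"
    using quadrature_lincomb[of 1 "\<lambda>x. tr u x * ?\<mu> x" "-1" "\<lambda>x. tr u x * lam x"]
    by (simp add: form_Lambda_quadrature algebra_simps)
  ultimately have ju: "j u \<le> form_Lambda g m M (tr u) lam"
    unfolding form_Lambda_sgn[OF u] by linarith
  fix v assume v: "v \<in> V"
  show "(form_a \<Omega> \<nu> u v + form_b \<Omega> v p - L2_inner \<Omega> f v)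
     - (form_a \<Omega> \<nu> u u + form_b \<Omega> u p - L2_inner \<Omega> f u) + j v - j u \<ge> 0"
    \<comment> \<open>Subtracting the two equations leaves only pairings with \<open>lam\<close>:
      that of \<open>v\<close> is at most \<open>j v\<close>, that of \<open>u\<close> at least
      \<open>j u\<close>.\<close>
    using eq[OF v] eq[OF u] ju Lambda_tilde_bound[OF v lam] by linarith
qed

end

theorem theorem5p1:
  fixes P :: "point list set" and \<Omega> \<Gamma>0 \<Gamma>1 :: "point set" and A B n :: point
    and \<nu> :: real and f :: "point \<Rightarrow> point" and g :: "point \<Rightarrow> real"
    and H :: "real set" and \<T> :: "real \<Rightarrow> point set set"
    and h :: real and m :: nat and M :: "nat \<Rightarrow> point"
  assumes domain: "polygonal_domain P \<Omega>"
    and boundary: "boundary_partition P \<Omega> \<Gamma>0 \<Gamma>1 A B"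
    and normal: "outer_unit_normal \<Omega> A B n"
    and nu: "\<nu> > 0"
    and f: "f \<in> L2_vec \<Omega>"
    and g_cont: "continuous_on (closure \<Gamma>1) g"
    and g_pos: "\<And>x. x \<in> \<Gamma>1 \<Longrightarrow> g x > 0"
    and mesh: "regular_mesh_family \<Omega> H \<T>"
    and h: "h \<in> H"
    and nodes: "side_vertices (\<T> h) A B m M"
  shows "(\<exists>!u. solves_VI_h_sigma \<Omega> \<Gamma>0 \<Gamma>1 n \<nu> f g (\<T> h) m M u) \<and>
    (\<forall>u. solves_VI_h_sigma \<Omega> \<Gamma>0 \<Gamma>1 n \<nu> f g (\<T> h) m M u \<longrightarrow>
       form_a \<Omega> \<nu> u u + j_h g m M (normal_trace \<Gamma>1 n u) = L2_inner \<Omega> f u) \<and>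
    (\<forall>u p. solves_VI_h \<Omega> \<Gamma>0 \<Gamma>1 n \<nu> f g (\<T> h) m M u p \<longrightarrow>
       (\<exists>!lam. solves_VE_h \<Omega> \<Gamma>0 \<Gamma>1 n \<nu> f g (\<T> h) m M u p lam)) \<and>
    (\<forall>u p lam. solves_VE_h \<Omega> \<Gamma>0 \<Gamma>1 n \<nu> f g (\<T> h) m M u p lam \<longrightarrow>
       solves_VI_h \<Omega> \<Gamma>0 \<Gamma>1 n \<nu> f g (\<T> h) m M u p)"
proof -
  interpret friction_problem P \<Omega> \<Gamma>0 \<Gamma>1 A B n "\<T> h" h m M \<nu> f g
    using assms by unfold_locales (auto simp: regular_mesh_family_def)
  show ?thesis
    by (intro conjI allI impI VI\<sigma>_unique_solution VI\<sigma>_energy VI_imp_VE) (auto intro: VE_imp_VI)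
qed

end
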